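(* Let $n\geq 2$, let $\mathbb{D}^n$ be the polydisk in $\mathbb{C}^n$, and let $\phi,\psi\in C^1(\overline{\mathbb{D}^n})$. Assume that for any holomorphic function $g:\mathbb{D}\to\partial\mathbb{D}^n$, either $\phi\circ g$ or $\psi\circ g$ is holomorphic. Then $H_{\psi}^*H_{\phi}$ is compact on $A^2(\mathbb{D}^n)$.
   Context: $\mathbb{D}$ is the open unit disk in $\mathbb{C}$, $\mathbb{D}^n$ is the product of $n$ copies of it, and $\partial\mathbb{D}^n$ is its topological boundary in $\mathbb{C}^n$. A holomorphic function $g:\mathbb{D}\to\partial\mathbb{D}^n$ is a holomorphic map $g:\mathbb{D}\to\mathbb{C}^n$ whose image is contained in $\partial\mathbb{D}^n$. Symbols are complex-valued, and $C^1(\overline{\mathbb{D}^n})$ denotes functions that are continuously differentiable (in the real sense) up to the boundary. For a domain $\Omega\subset\mathbb{C}^n$ with Lebesgue volume measure $dV$, the Bergman space $A^2(\Omega)$ is the closed subspace of $L^2(\Omega,dV)$ consisting of holomorphic functions, and $P:L^2(\Omega)\to A^2(\Omega)$ is the orthogonal projection. For $\phi\in L^\infty(\Omega)$, the Hankel operator $H_\phi:A^2(\Omega)\to A^2(\Omega)^\perp$ is $H_\phi f=(I-P)(\phi f)$, and $H_\phi^*$ is its Hilbert space adjoint. *)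

theory Defs
  imports "HOL-Complex_Analysis.Complex_Analysis"
begin

definition polydisk :: "(complex ^ 'n) set" where
  "polydisk = {z. \<forall>j. norm (z $ j) < 1}"

text \<open>Holomorphy in several variables, for open \<open>\<Omega>\<close>: the real Frechet derivative exists
  and is complex linear at every point.\<close>

definition mholomorphic_on :: "(complex ^ 'n \<Rightarrow> complex) \<Rightarrow> (complex ^ 'n) set \<Rightarrow> bool" where
  "mholomorphic_on f \<Omega> \<longleftrightarrow>
     (\<forall>z\<in>\<Omega>. \<exists>D. (f has_derivative D) (at z) \<and> (\<forall>c v. D (c *s v) = c * D v))"

text \<open>Membership in \<open>C\<^sup>1\<close> of the closure of an open set \<open>\<Omega>\<close>: real differentiability in \<open>\<Omega>\<close>,
  with the function and its derivative extending continuously to the closure. The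
  values of \<open>f\<close> off the closure are irrelevant.\<close>

definition C1_closure :: "(complex ^ 'n) set \<Rightarrow> (complex ^ 'n \<Rightarrow> complex) set" where
  "C1_closure \<Omega> = {f. continuous_on (closure \<Omega>) f \<and>
     (\<exists>D :: complex ^ 'n \<Rightarrow> (complex ^ 'n) \<Rightarrow>\<^sub>L complex. continuous_on (closure \<Omega>) D \<and>
        (\<forall>z\<in>\<Omega>. (f has_derivative blinfun_apply (D z)) (at z)))}"

text \<open>Square-integrable functions are handled through representatives; no quotient by
  almost everywhere equality is formed.\<close>

definition L2 :: "(complex ^ 'n) set \<Rightarrow> (complex ^ 'n \<Rightarrow> complex) set" where
  "L2 \<Omega> = {f. f \<in> borel_measurable (lebesgue_on \<Omega>) \<and>
              integrable (lebesgue_on \<Omega>) (\<lambda>z. (norm (f z))\<^sup>2)}"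

definition L2_inner ::
  "(complex ^ 'n) set \<Rightarrow> (complex ^ 'n \<Rightarrow> complex) \<Rightarrow> (complex ^ 'n \<Rightarrow> complex) \<Rightarrow> complex" where
  "L2_inner \<Omega> f g = (LINT z|lebesgue_on \<Omega>. f z * cnj (g z))"

definition L2_norm :: "(complex ^ 'n) set \<Rightarrow> (complex ^ 'n \<Rightarrow> complex) \<Rightarrow> real" where
  "L2_norm \<Omega> f = sqrt (LINT z|lebesgue_on \<Omega>. (norm (f z))\<^sup>2)"

text \<open>An element of the Bergman space is normalised to vanish off \<open>\<Omega>\<close>. For open \<open>\<Omega>\<close> each
  class of the Bergman space then has exactly one representative, which makes the definite
  descriptions below unique.\<close>

definition bergman :: "(complex ^ 'n) set \<Rightarrow> (complex ^ 'n \<Rightarrow> complex) set" where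
  "bergman \<Omega> = {f \<in> L2 \<Omega>. mholomorphic_on f \<Omega> \<and> (\<forall>z. z \<notin> \<Omega> \<longrightarrow> f z = 0)}"

definition bergman_perp :: "(complex ^ 'n) set \<Rightarrow> (complex ^ 'n \<Rightarrow> complex) set" where
  "bergman_perp \<Omega> = {g \<in> L2 \<Omega>. \<forall>f\<in>bergman \<Omega>. L2_inner \<Omega> f g = 0}"

definition bergman_proj ::
  "(complex ^ 'n) set \<Rightarrow> (complex ^ 'n \<Rightarrow> complex) \<Rightarrow> (complex ^ 'n \<Rightarrow> complex)" where
  "bergman_proj \<Omega> f = (THE h. h \<in> bergman \<Omega> \<and> (\<lambda>z. f z - h z) \<in> bergman_perp \<Omega>)"

definition hankel ::
  "(complex ^ 'n) set \<Rightarrow> (complex ^ 'n \<Rightarrow> complex) \<Rightarrow>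
   (complex ^ 'n \<Rightarrow> complex) \<Rightarrow> (complex ^ 'n \<Rightarrow> complex)" where
  "hankel \<Omega> \<phi> f = (\<lambda>z. \<phi> z * f z - bergman_proj \<Omega> (\<lambda>w. \<phi> w * f w) z)"

text \<open>Hilbert space adjoint of an operator \<open>T\<close> from the Bergman space to its orthogonal
  complement, evaluated at \<open>g\<close> in that complement.\<close>

definition bergman_adjoint ::
  "(complex ^ 'n) set \<Rightarrow> ((complex ^ 'n \<Rightarrow> complex) \<Rightarrow> (complex ^ 'n \<Rightarrow> complex)) \<Rightarrow>
   (complex ^ 'n \<Rightarrow> complex) \<Rightarrow> (complex ^ 'n \<Rightarrow> complex)" where
  "bergman_adjoint \<Omega> T g =
     (THE h. h \<in> bergman \<Omega> \<and> (\<forall>f\<in>bergman \<Omega>. L2_inner \<Omega> (T f) g = L2_inner \<Omega> f h))"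

text \<open>A compact operator is a linear self-map sending every bounded sequence to one with a
  norm-convergent subsequence.\<close>

definition compact_on_bergman ::
  "(complex ^ 'n) set \<Rightarrow> ((complex ^ 'n \<Rightarrow> complex) \<Rightarrow> (complex ^ 'n \<Rightarrow> complex)) \<Rightarrow> bool" where
  "compact_on_bergman \<Omega> T \<longleftrightarrow>
     (\<forall>f\<in>bergman \<Omega>. T f \<in> bergman \<Omega>) \<and>
     (\<forall>f\<in>bergman \<Omega>. \<forall>g\<in>bergman \<Omega>. \<forall>a b.
        T (\<lambda>z. a * f z + b * g z) = (\<lambda>z. a * T f z + b * T g z)) \<and>
     (\<forall>F :: nat \<Rightarrow> complex ^ 'n \<Rightarrow> complex.
        (\<forall>k. F k \<in> bergman \<Omega>) \<and> (\<exists>B. \<forall>k. L2_norm \<Omega> (F k) \<le> B) \<longrightarrow>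
        (\<exists>h\<in>bergman \<Omega>. \<exists>r :: nat \<Rightarrow> nat. strict_mono r \<and>
           (\<lambda>k. L2_norm \<Omega> (\<lambda>z. T (F (r k)) z - h z)) \<longlonglongrightarrow> 0))"

end

theory Submission
  imports Defs
begin

text \<open>Since \<open>H\<^sub>\<psi>\<^sup>* H\<^sub>\<phi> f = P (cnj \<psi> * (I - P) (\<phi> f))\<close>, compactness follows if this is small along bounded
  sequences in the Bergman space that tend to \<open>0\<close> locally uniformly. Such a sequence is a sum of sequences each of
  which escapes to a face \<open>\<bar>z\<^sub>i\<bar> = 1\<close> of the boundary, up to projections. Writing \<open>D\<^sub>t p z\<close> for the
  value of \<open>p\<close> at \<open>z\<close> with \<open>z\<^sub>i\<close> replaced by \<open>t z\<^sub>i\<close>, self-adjointness of \<open>D\<^sub>t\<close> shows that \<open>P\<close> preserves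
  escaping sequences. On these, multiplication by a continuous function of \<open>z\<^sub>i\<close> commutes asymptotically with \<open>P\<close>:
  for \<open>cnj z\<^sub>i\<close> divide \<open>p - D\<^sub>0 p\<close> by \<open>z\<^sub>i\<close>, then use Stone-Weierstrass. Hence near the face both symbols may be
  replaced by finitely many of their restrictions to slices \<open>z\<^sub>i = w\<close> with \<open>\<bar>w\<bar> = 1\<close>. On each slice one
  of the two is holomorphic, because otherwise a single holomorphic disc in the slice would detect the failure of
  the Cauchy-Riemann equations for both.\<close>

section \<open>Averaging over rotations\<close>

text \<open>The obstacle is that cutting a sequence off near one face destroys holomorphy, while
  projecting it back is a non-local operation that could spread its mass over the whole polydisk.
  This is handled by two facts on \<open>dil i t\<close>. As an average of rotations of
  \<open>z_i\<close> against a Cauchy kernel it is bounded and self-adjoint on the Bergman space. As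
  a change of variables its norm is, up to the factor \<open>t\<close>, the mass of the function on
  \<open>|z_i| < t\<close>. Hence the mass that a projection leaves away from the face can be
  measured by pairing with the unprojected function. The two symbols enter differently but with the
  same effect. Multiplication by a holomorphic function preserves the Bergman space, so
  \<open>I - P\<close> kills the result. Multiplication by its conjugate preserves the orthogonal
  complement, so \<open>P\<close> kills the result. One good symbol per slice is therefore enough,
  provided that the cut-off around the slice nearly commutes with \<open>P\<close>. First
  derivatives of the symbols serve to differentiate the restrictions to boundary slices, whereas the
  operator estimates rest on uniform continuity on the closed polydisk.\<close>

text \<open>Both sides, multiplied by the volume of the unit ball, are computed from \<open>\<integral>\<integral> g (f x + y)\<close> with \<open>y\<close> in the unit
  ball, using only translation invariance and Tonelli.\<close>

lemma nn_integral_lborel_isometry: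
  fixes f :: "'a::euclidean_space \<Rightarrow> 'a" and g :: "'a \<Rightarrow> ennreal"
  assumes f: "orthogonal_transformation f" and g [measurable]: "g \<in> borel_measurable borel"
  shows "(\<integral>\<^sup>+x. g (f x) \<partial>lborel) = (\<integral>\<^sup>+x. g x \<partial>lborel)"
proof -
  have f_meas [measurable]: "f \<in> borel_measurable borel"
    using orthogonal_transformation_linear[OF f]
    by (intro borel_measurable_continuous_onI linear_continuous_on) (simp add: linear_conv_bounded_linear)
  define h where "h = inv f"
  have fh: "f (h y) = y" for y
    unfolding h_def using f orthogonal_transformation_surj surj_f_inv_f by metis
  have lin: "f (x + y) = f x + f y" for x y
    using f orthogonal_transformation_linear linear_add by blast
  have nrm: "norm (f x) = norm x" for x
    using f orthogonal_transformation by blast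
  have dst: "dist (f x) (f y) = dist x y" for x y
    using f orthogonal_transformation_isometry by blast
  define c where "c = emeasure lborel (ball (0::'a) 1)"
  define B :: "'a \<Rightarrow> ennreal" where "B = indicator (ball 0 1)"
  have B [measurable]: "B \<in> borel_measurable borel"
    unfolding B_def by (intro borel_measurable_indicator) simp
  have cB: "(\<integral>\<^sup>+y. B y \<partial>lborel) = c" unfolding B_def c_def by simp
  have trans: "(\<integral>\<^sup>+x. k (a + x) \<partial>lborel) = (\<integral>\<^sup>+x. k x \<partial>lborel)"
    if [measurable]: "k \<in> borel_measurable borel" for k :: "'a \<Rightarrow> ennreal" and a
  proof -
    have "(\<integral>\<^sup>+x. k x \<partial>lborel) = (\<integral>\<^sup>+x. k x \<partial>distr lborel borel ((+) a))"
      by (simp add: lborel_distr_plus)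
    also have "\<dots> = (\<integral>\<^sup>+x. k (a + x) \<partial>lborel)"
      by (rule nn_integral_distr) auto
    finally show ?thesis by simp
  qed
  have c0: "c > 0" "c < \<infinity>"
    unfolding c_def using less_imp_neq[OF unit_ball_vol_pos[of "real DIM('a)"]] by (auto simp: emeasure_ball zero_less_iff_neq_zero)
  have "(\<integral>\<^sup>+x. g (f x) \<partial>lborel) * c = (\<integral>\<^sup>+x. \<integral>\<^sup>+y. g (f x) * B y \<partial>lborel \<partial>lborel)"
    by (simp add: nn_integral_cmult nn_integral_multc cB)
  also have "\<dots> = (\<integral>\<^sup>+y. \<integral>\<^sup>+x. g (f x) * B y \<partial>lborel \<partial>lborel)"
    by (rule lborel_pair.Fubini') measurable
  also have "\<dots> = (\<integral>\<^sup>+y. \<integral>\<^sup>+x. g (f x + y) * B y \<partial>lborel \<partial>lborel)"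
  proof (rule nn_integral_cong)
    fix y
    have "(\<integral>\<^sup>+x. g (f x + y) * B y \<partial>lborel) = (\<integral>\<^sup>+x. g (f (h y + x)) * B y \<partial>lborel)"
      by (simp add: lin fh add.commute)
    also have "\<dots> = (\<integral>\<^sup>+x. g (f x) * B y \<partial>lborel)"
      by (rule trans) measurable
    finally show "(\<integral>\<^sup>+x. g (f x) * B y \<partial>lborel) = (\<integral>\<^sup>+x. g (f x + y) * B y \<partial>lborel)" ..
  qed
  also have "\<dots> = (\<integral>\<^sup>+x. \<integral>\<^sup>+y. g (f x + y) * B y \<partial>lborel \<partial>lborel)"
    by (rule lborel_pair.Fubini') measurable
  also have "\<dots> = (\<integral>\<^sup>+x. \<integral>\<^sup>+y. g y * B (y - f x) \<partial>lborel \<partial>lborel)"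
  proof (rule nn_integral_cong)
    fix x
    show "(\<integral>\<^sup>+y. g (f x + y) * B y \<partial>lborel) = (\<integral>\<^sup>+y. g y * B (y - f x) \<partial>lborel)"
      using trans[of "\<lambda>y. g y * B (y - f x)" "f x"] by simp
  qed
  also have "\<dots> = (\<integral>\<^sup>+y. \<integral>\<^sup>+x. g y * B (y - f x) \<partial>lborel \<partial>lborel)"
    by (rule lborel_pair.Fubini') measurable
  also have "\<dots> = (\<integral>\<^sup>+y. g y * c \<partial>lborel)"
  proof (rule nn_integral_cong)
    fix y
    have "B (y - f x) = (indicator (ball (h y) 1) x :: ennreal)" for x
      unfolding B_def using dst[of "h y" x] by (auto simp: fh indicator_def dist_norm norm_minus_commute)
    then have "(\<integral>\<^sup>+x. B (y - f x) \<partial>lborel) = c"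
      by (simp add: c_def emeasure_ball)
    then show "(\<integral>\<^sup>+x. g y * B (y - f x) \<partial>lborel) = g y * c"
      by (subst nn_integral_cmult) auto
  qed
  also have "\<dots> = (\<integral>\<^sup>+y. g y \<partial>lborel) * c"
    by (simp add: nn_integral_multc)
  finally show ?thesis
    using c0 by (auto simp: mult.commute[of _ c] ennreal_mult_cancel_left)
qed

text \<open>The parameter interval of the circle has total mass one, so circle averages need no
  normalising factor and Cauchy-Schwarz costs no constant.\<close>

abbreviation I01 :: "real measure" where "I01 \<equiv> restrict_space lborel {0..1}"

lemma prob_I01: "emeasure I01 (space I01) = 1"
  by (simp add: emeasure_restrict_space space_restrict_space)

lemma finite_I01: "finite_measure I01"
  by (rule finite_measureI) (unfold prob_I01, simp)

lemma borel_I01: "f \<in> borel_measurable borel \<Longrightarrow> f \<in> borel_measurable I01"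
  by (simp add: measurable_restrict_space1)

text \<open>With the factor \<open>2 * pi\<close> the unit circle is traversed once over
  \<open>{0..1}\<close>, which agrees with the parametrisation of
  \<open>circlepath 0 1\<close>.\<close>

definition e1 :: "real \<Rightarrow> complex" where "e1 \<theta> = exp (2 * of_real pi * \<i> * of_real \<theta>)"

lemma norm_e1 [simp]: "norm (e1 \<theta>) = 1"
  by (simp add: e1_def)

lemma e1_nz [simp]: "e1 \<theta> \<noteq> 0"
  by (simp add: e1_def)

lemma continuous_e1 [continuous_intros]: "continuous_on A e1"
  unfolding e1_def by (intro continuous_intros)

lemma borel_e1 [measurable]: "e1 \<in> borel_measurable borel"
  by (intro borel_measurable_continuous_onI continuous_e1)

text \<open>Reversing the parameter inverts the rotation. The self-adjointness of dilations rests on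
  this symmetry.\<close>

lemma e1_minus: "e1 (1 - \<theta>) = cnj (e1 \<theta>)"
proof -
  have "e1 (1 - \<theta>) = exp (2 * of_real pi * \<i>) * exp (- (2 * of_real pi * \<i> * of_real \<theta>))"
    unfolding e1_def exp_add [symmetric] by (simp add: algebra_simps)
  also have "\<dots> = cnj (e1 \<theta>)"
    unfolding e1_def exp_cnj by simp
  finally show ?thesis .
qed

text \<open>Tonelli: each rotation preserves Lebesgue measure and the parameter measure has mass
  one. Pointwise estimates by a circle average thus integrate to estimates without loss.\<close>

lemma nn_integral_rotation_mean:
  fixes R :: "real \<Rightarrow> 'a::euclidean_space \<Rightarrow> 'a" and g :: "'a \<Rightarrow> ennreal"
  assumes "\<And>\<theta>. orthogonal_transformation (R \<theta>)"
    and R: "(\<lambda>x. R (fst x) (snd x)) \<in> borel_measurable (borel \<Otimes>\<^sub>M borel)"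
    and g [measurable]: "g \<in> borel_measurable borel"
  shows "(\<integral>\<^sup>+z. \<integral>\<^sup>+\<theta>. g (R \<theta> z) \<partial>I01 \<partial>lborel) = (\<integral>\<^sup>+z. g z \<partial>lborel)"
proof -
  interpret I: finite_measure I01 by (rule finite_I01)
  interpret pair_sigma_finite I01 "lborel :: 'a measure"
    by (intro pair_sigma_finite.intro I.sigma_finite_measure_axioms lborel.sigma_finite_measure_axioms)
  have [measurable]: "(\<lambda>x. R (fst x) (snd x)) \<in> borel_measurable (I01 \<Otimes>\<^sub>M lborel)"
  proof -
    have "(\<lambda>x. x) \<in> measurable (I01 \<Otimes>\<^sub>M (lborel :: 'a measure)) (borel \<Otimes>\<^sub>M borel)"
    proof (rule measurable_pair)
      have "(\<lambda>x. x) \<in> measurable I01 borel" by (rule borel_I01) simp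
      from measurable_compose[OF measurable_fst this]
      show "fst \<circ> (\<lambda>x. x) \<in> borel_measurable (I01 \<Otimes>\<^sub>M (lborel :: 'a measure))"
        by (simp add: comp_def)
    qed (simp add: comp_def)
    from measurable_compose[OF this R] show ?thesis .
  qed
  have "(\<integral>\<^sup>+z. \<integral>\<^sup>+\<theta>. g (R \<theta> z) \<partial>I01 \<partial>lborel) = (\<integral>\<^sup>+\<theta>. \<integral>\<^sup>+z. g (R \<theta> z) \<partial>lborel \<partial>I01)"
    by (rule Fubini') (simp add: split_beta')
  also have "\<dots> = (\<integral>\<^sup>+\<theta>. (\<integral>\<^sup>+z. g z \<partial>lborel) \<partial>I01)"
    using assms(1) by (simp add: nn_integral_lborel_isometry)
  also have "\<dots> = (\<integral>\<^sup>+z. g z \<partial>lborel)"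
    by (simp only: nn_integral_const prob_I01 mult_1_right)
  finally show ?thesis .
qed

lemma integral_I01:
  fixes f :: "real \<Rightarrow> complex"
  assumes "continuous_on {0..1} f"
  shows "integrable I01 f" "(LINT \<theta>|I01. f \<theta>) = integral {0..1} f"
proof -
  have *: "set_integrable lborel {0..1} f"
    using assms by (intro borel_integrable_atLeastAtMost') 
  then show "integrable I01 f"
    unfolding set_integrable_def by (subst integrable_restrict_space) auto
  show "(LINT \<theta>|I01. f \<theta>) = integral {0..1} f"
    using set_borel_integral_eq_integral(2)[OF *] by (simp add: integral_restrict_space set_lebesgue_integral_def)
qed

text \<open>Cauchy's formula on the unit circle: the differential
  \<open>2 * pi * \<i> * e1 \<theta>\<close> of the circle supplies the numerator
  \<open>e1 \<theta>\<close> of the kernel. For \<open>t = 0\<close> the kernel is 1 and the formula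
  is the mean value property.\<close>

lemma circle_mean_Cauchy:
  assumes h: "h holomorphic_on cball 0 1" and t: "norm t < 1"
  shows "(LINT \<theta>|I01. h (e1 \<theta>) * (e1 \<theta> / (e1 \<theta> - t))) = h t"
    and "continuous_on {0..1} (\<lambda>\<theta>. h (e1 \<theta>) * (e1 \<theta> / (e1 \<theta> - t)))"
proof -
  have ne: "e1 \<theta> - t \<noteq> 0" for \<theta>
    using t norm_e1[of \<theta>] by auto
  have cont: "continuous_on {0..1} (\<lambda>\<theta>. h (e1 \<theta>))"
    by (rule continuous_on_compose2[OF holomorphic_on_imp_continuous_on[OF h] continuous_e1]) auto
  show c: "continuous_on {0..1} (\<lambda>\<theta>. h (e1 \<theta>) * (e1 \<theta> / (e1 \<theta> - t)))"
    using ne by (intro continuous_intros cont) auto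
  have cp: "circlepath 0 1 x = e1 x" for x
    by (simp add: circlepath e1_def)
  have vd: "vector_derivative (circlepath 0 1) (at x within {0..1}) = 2 * of_real pi * \<i> * e1 x"
    if "x \<in> {0..1}" for x
    using that by (simp add: vector_derivative_circlepath01 e1_def)
  have "((\<lambda>u. h u / (u - t)) has_contour_integral (2 * of_real pi * \<i> * h t)) (circlepath 0 1)"
    using Cauchy_integral_circlepath_simple[OF h, of t] t by simp
  then have "((\<lambda>x. h (circlepath 0 1 x) / (circlepath 0 1 x - t) * vector_derivative (circlepath 0 1) (at x within {0..1}))
      has_integral (2 * of_real pi * \<i> * h t)) {0..1}"
    unfolding has_contour_integral_def .
  then have "((\<lambda>x. h (e1 x) / (e1 x - t) * (2 * of_real pi * \<i> * e1 x)) has_integral (2 * of_real pi * \<i> * h t)) {0..1}"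
    by (rule has_integral_eq[rotated]) (simp only: cp vd)
  then have "((\<lambda>x. (2 * of_real pi * \<i>) * (h (e1 x) * (e1 x / (e1 x - t)))) has_integral (2 * of_real pi * \<i> * h t)) {0..1}"
    by (simp add: mult_ac)
  then have "((\<lambda>x. h (e1 x) * (e1 x / (e1 x - t))) has_integral h t) {0..1}"
    by (subst (asm) has_integral_mult_right_iff) auto
  then show "(LINT \<theta>|I01. h (e1 \<theta>) * (e1 \<theta> / (e1 \<theta> - t))) = h t"
    using integral_I01(2)[OF c] integral_unique by metis
qed

section \<open>Holomorphic functions of several variables\<close>

lemma norm_vector_smult: "norm (c *s v) = norm c * norm v" for c :: complex and v :: "complex ^ 'n"
  by (simp add: norm_vec_def norm_mult L2_set_right_distrib)

lemma bounded_linear_vector_smult_left: "bounded_linear (\<lambda>c::complex. c *s v)" for v :: "complex ^ 'n"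
proof (rule bounded_linear_intro[where K = "norm v"])
  show "(x + y) *s v = x *s v + y *s v" for x y
    by (simp add: vec_eq_iff algebra_simps)
  show "(r *\<^sub>R x) *s v = r *\<^sub>R (x *s v)" for r x
    by (simp add: vec_eq_iff)
  show "norm (x *s v) \<le> norm x * norm v" for x
    by (simp add: norm_vector_smult)
qed

lemma has_derivative_complex_line:
  "((\<lambda>c. z + c *s v) has_derivative (\<lambda>c. c *s v)) (at c0 within A)" for v :: "complex ^ 'n"
proof -
  have "((\<lambda>c. c *s v) has_derivative (\<lambda>c. c *s v)) (at c0 within A)"
    using bounded_linear_imp_has_derivative[OF bounded_linear_vector_smult_left] .
  from has_derivative_add[OF has_derivative_const this] show ?thesis by simp
qed

lemma mholomorphic_onE:
  assumes "mholomorphic_on f \<Omega>"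
  obtains D where "\<And>z. z \<in> \<Omega> \<Longrightarrow> (f has_derivative D z) (at z)"
    "\<And>z c v. z \<in> \<Omega> \<Longrightarrow> D z (c *s v) = c * D z v"
  using assms unfolding mholomorphic_on_def by metis

lemma mholomorphic_on_subset: "mholomorphic_on f \<Omega> \<Longrightarrow> A \<subseteq> \<Omega> \<Longrightarrow> mholomorphic_on f A"
  unfolding mholomorphic_on_def by blast

lemma mholomorphic_on_const: "mholomorphic_on (\<lambda>z. c) \<Omega>"
  unfolding mholomorphic_on_def by (auto intro!: exI[of _ "\<lambda>_. 0"])

lemma mholomorphic_on_add:
  assumes "mholomorphic_on f \<Omega>" "mholomorphic_on g \<Omega>"
  shows "mholomorphic_on (\<lambda>z. f z + g z) \<Omega>"
proof -
  obtain D E where D: "\<And>z. z \<in> \<Omega> \<Longrightarrow> (f has_derivative D z) (at z)"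
      "\<And>z c v. z \<in> \<Omega> \<Longrightarrow> D z (c *s v) = c * D z v"
    and E: "\<And>z. z \<in> \<Omega> \<Longrightarrow> (g has_derivative E z) (at z)"
      "\<And>z c v. z \<in> \<Omega> \<Longrightarrow> E z (c *s v) = c * E z v"
    using assms by (auto elim!: mholomorphic_onE)
  show ?thesis unfolding mholomorphic_on_def
    by (intro ballI exI[of _ "\<lambda>v. D _ v + E _ v"]) (auto intro!: has_derivative_add D E simp: D E algebra_simps)
qed

lemma mholomorphic_on_mult:
  assumes "mholomorphic_on f \<Omega>" "mholomorphic_on g \<Omega>"
  shows "mholomorphic_on (\<lambda>z. f z * g z) \<Omega>"
proof -
  obtain D E where D: "\<And>z. z \<in> \<Omega> \<Longrightarrow> (f has_derivative D z) (at z)"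
      "\<And>z c v. z \<in> \<Omega> \<Longrightarrow> D z (c *s v) = c * D z v"
    and E: "\<And>z. z \<in> \<Omega> \<Longrightarrow> (g has_derivative E z) (at z)"
      "\<And>z c v. z \<in> \<Omega> \<Longrightarrow> E z (c *s v) = c * E z v"
    using assms by (auto elim!: mholomorphic_onE)
  show ?thesis unfolding mholomorphic_on_def
  proof
    fix z assume "z \<in> \<Omega>"
    then show "\<exists>F. ((\<lambda>z. f z * g z) has_derivative F) (at z) \<and> (\<forall>c v. F (c *s v) = c * F v)"
      by (intro exI[of _ "\<lambda>v. f z * E z v + D z v * g z"] conjI has_derivative_mult D E) (auto simp: D E algebra_simps)
  qed
qed

lemma mholomorphic_on_cmult: "mholomorphic_on f \<Omega> \<Longrightarrow> mholomorphic_on (\<lambda>z. c * f z) \<Omega>"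
  by (intro mholomorphic_on_mult mholomorphic_on_const)

lemma mholomorphic_on_diff:
  assumes "mholomorphic_on f \<Omega>" "mholomorphic_on g \<Omega>"
  shows "mholomorphic_on (\<lambda>z. f z - g z) \<Omega>"
  using mholomorphic_on_add[OF assms(1) mholomorphic_on_cmult[OF assms(2), of "-1"]] by simp

lemma mholomorphic_on_sum:
  "(\<And>a. a \<in> A \<Longrightarrow> mholomorphic_on (f a) \<Omega>) \<Longrightarrow> mholomorphic_on (\<lambda>z. \<Sum>a\<in>A. f a z) \<Omega>"
  by (induction A rule: infinite_finite_induct) (auto intro: mholomorphic_on_const mholomorphic_on_add)

lemma mholomorphic_on_inverse:
  assumes "mholomorphic_on f \<Omega>" "\<And>z. z \<in> \<Omega> \<Longrightarrow> f z \<noteq> 0"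
  shows "mholomorphic_on (\<lambda>z. inverse (f z)) \<Omega>"
proof -
  obtain D where D: "\<And>z. z \<in> \<Omega> \<Longrightarrow> (f has_derivative D z) (at z)"
      "\<And>z c v. z \<in> \<Omega> \<Longrightarrow> D z (c *s v) = c * D z v"
    using assms by (auto elim!: mholomorphic_onE)
  show ?thesis unfolding mholomorphic_on_def
  proof
    fix z assume "z \<in> \<Omega>"
    then show "\<exists>F. ((\<lambda>z. inverse (f z)) has_derivative F) (at z) \<and> (\<forall>c v. F (c *s v) = c * F v)"
      using assms(2)
      by (intro exI[of _ "\<lambda>v. - (inverse (f z) * D z v * inverse (f z))"]) 
        (auto intro!: has_derivative_inverse D simp: D)
  qed
qed

lemma mholomorphic_on_cong:
  assumes "open \<Omega>" "\<And>z. z \<in> \<Omega> \<Longrightarrow> f z = g z" "mholomorphic_on f \<Omega>"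
  shows "mholomorphic_on g \<Omega>"
  unfolding mholomorphic_on_def
proof
  fix z assume z: "z \<in> \<Omega>"
  then obtain D where "(f has_derivative D) (at z)" "\<forall>c v. D (c *s v) = c * D v"
    using assms(3) unfolding mholomorphic_on_def by blast
  then show "\<exists>D. (g has_derivative D) (at z) \<and> (\<forall>c v. D (c *s v) = c * D v)"
    using has_derivative_transform_within_open[OF _ assms(1) z] assms(2) by blast
qed

lemma mholomorphic_on_compose:
  assumes f: "mholomorphic_on f \<Omega>"
    and G: "\<And>z. z \<in> A \<Longrightarrow> G z \<in> \<Omega>"
      "\<And>z. z \<in> A \<Longrightarrow> \<exists>L. (G has_derivative L) (at z) \<and> (\<forall>c v. L (c *s v) = c *s L v)"
  shows "mholomorphic_on (\<lambda>z. f (G z)) A"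
  unfolding mholomorphic_on_def
proof
  fix z assume "z \<in> A"
  then obtain L D where L: "(G has_derivative L) (at z)" "\<forall>c v. L (c *s v) = c *s L v"
    and D: "(f has_derivative D) (at (G z))" "\<forall>c v. D (c *s v) = c * D v"
    using G f unfolding mholomorphic_on_def by meson
  show "\<exists>D. ((\<lambda>z. f (G z)) has_derivative D) (at z) \<and> (\<forall>c v. D (c *s v) = c * D v)"
    using has_derivative_compose[OF L(1) D(1)] L(2) D(2) by auto
qed

section \<open>Restriction to complex lines, Cauchy estimates and normal families\<close>

lemma mholomorphic_on_continuous_on: "mholomorphic_on f \<Omega> \<Longrightarrow> continuous_on \<Omega> f"
  unfolding mholomorphic_on_def
  by (metis continuous_at_imp_continuous_on has_derivative_continuous)

text \<open>The chain rule with complex linearity of the derivative. Through this restriction the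
  one-variable theory (Cauchy's formula and inequality) becomes available.\<close>

lemma mholomorphic_on_line:
  assumes f: "mholomorphic_on f \<Omega>" and A: "\<And>\<zeta>. \<zeta> \<in> A \<Longrightarrow> z + \<zeta> *s v \<in> \<Omega>"
  shows "(\<lambda>\<zeta>. f (z + \<zeta> *s v)) holomorphic_on A"
  unfolding holomorphic_on_def
proof
  fix \<zeta> assume "\<zeta> \<in> A"
  then obtain D where D: "(f has_derivative D) (at (z + \<zeta> *s v))" "\<And>c v. D (c *s v) = c * D v"
    using f A unfolding mholomorphic_on_def by meson
  have "((\<lambda>\<zeta>. f (z + \<zeta> *s v)) has_derivative (\<lambda>c. D (c *s v))) (at \<zeta>)"
    by (rule has_derivative_compose[OF has_derivative_complex_line D(1)])
  then have "((\<lambda>\<zeta>. f (z + \<zeta> *s v)) has_field_derivative D v) (at \<zeta>)"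
    unfolding has_field_derivative_def D(2) by (simp add: mult.commute[of _ "D v"])
  then show "(\<lambda>\<zeta>. f (z + \<zeta> *s v)) field_differentiable at \<zeta> within A"
    using field_differentiable_at_within field_differentiable_def by blast
qed

text \<open>The one-variable Cauchy inequality on the line through \<open>z\<close> in direction
  \<open>v\<close>. The line maps the disc of radius \<open>r / norm v\<close> into
  \<open>cball z r\<close>, and this radius produces the factor \<open>norm v / r\<close>.\<close>

lemma mholomorphic_Cauchy_estimate:
  assumes f: "mholomorphic_on f \<Omega>" and sub: "cball z r \<subseteq> \<Omega>" and r: "r > 0"
    and M: "\<And>w. w \<in> cball z r \<Longrightarrow> norm (f w) \<le> M"
    and D: "(f has_derivative D) (at z)" "\<And>c v. D (c *s v) = c * D v"
  shows "norm (D v) \<le> M / r * norm v"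
proof (cases "v = 0")
  case True
  then show ?thesis using has_derivative_linear[OF D(1)] linear_0 by auto
next
  case False
  define \<rho> where "\<rho> = r / norm v"
  have \<rho>: "\<rho> > 0" using False r by (simp add: \<rho>_def)
  let ?h = "\<lambda>\<zeta>. f (z + \<zeta> *s v)"
  have in_cball: "z + \<zeta> *s v \<in> cball z r" if "\<zeta> \<in> cball 0 \<rho>" for \<zeta>
    using that False by (simp add: dist_norm norm_vector_smult \<rho>_def pos_le_divide_eq)
  have hol: "?h holomorphic_on cball 0 \<rho>"
    by (rule mholomorphic_on_line[OF f]) (use in_cball sub in auto)
  have "norm ((deriv ^^ 1) ?h 0) \<le> fact 1 * M / \<rho> ^ 1"
  proof (rule Cauchy_inequality)
    show "?h holomorphic_on ball 0 \<rho>" using hol holomorphic_on_subset ball_subset_cball by blast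
    show "continuous_on (cball 0 \<rho>) ?h" using hol holomorphic_on_imp_continuous_on by blast
    show "norm (?h x) \<le> M" if "norm (0 - x) = \<rho>" for x
      by (rule M, rule in_cball) (use that in auto)
  qed (rule \<rho>)
  moreover have "(?h has_field_derivative D v) (at 0)"
  proof -
    have "(?h has_derivative (\<lambda>c. D (c *s v))) (at 0)"
      by (rule has_derivative_compose[OF has_derivative_complex_line]) (simp add: D(1))
    then show ?thesis
      unfolding has_field_derivative_def D(2) by (simp add: mult.commute[of _ "D v"])
  qed
  ultimately show ?thesis
    by (simp add: DERIV_imp_deriv \<rho>_def)
qed

text \<open>Around each point of the smaller ball a ball of radius \<open>r\<close> still fits into
  \<open>cball z (2 * r)\<close>, so the Cauchy estimate bounds the derivative by
  \<open>M / r\<close>, and the mean value inequality applies on the convex ball.\<close>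

lemma mholomorphic_Lipschitz:
  assumes f: "mholomorphic_on f \<Omega>" and sub: "cball z (2 * r) \<subseteq> \<Omega>" and r: "r > 0"
    and M: "\<And>w. w \<in> cball z (2 * r) \<Longrightarrow> norm (f w) \<le> M"
    and x: "x \<in> ball z r" and y: "y \<in> ball z r"
  shows "norm (f x - f y) \<le> M / r * norm (x - y)"
proof -
  obtain D where D: "\<And>z. z \<in> \<Omega> \<Longrightarrow> (f has_derivative D z) (at z)"
      "\<And>z c v. z \<in> \<Omega> \<Longrightarrow> D z (c *s v) = c * D z v"
    using f by (auto elim!: mholomorphic_onE)
  have sub': "cball w r \<subseteq> cball z (2 * r)" if "w \<in> ball z r" for w
  proof
    fix u assume "u \<in> cball w r"
    then show "u \<in> cball z (2 * r)"
      using that dist_triangle[of z u w] by simp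
  qed
  have inO: "w \<in> \<Omega>" if "w \<in> ball z r" for w
    using sub'[OF that] sub r centre_in_cball[of w r] by (meson less_imp_le subsetD)
  show ?thesis
  proof (rule differentiable_bound[where S = "ball z r" and f' = D])
    show "(f has_derivative D w) (at w within ball z r)" if "w \<in> ball z r" for w
      using D(1)[OF inO[OF that]] has_derivative_at_withinI by blast
    show "onorm (D w) \<le> M / r" if w: "w \<in> ball z r" for w
    proof (rule onorm_le)
      show "norm (D w v) \<le> M / r * norm v" for v
        by (rule mholomorphic_Cauchy_estimate[OF f _ r _ D(1) D(2)])
          (use sub'[OF w] sub M inO[OF w] in auto)
    qed
  qed (use x y in auto)
qed

text \<open>Cauchy estimates for the differences \<open>f m - f n\<close> make the derivatives
  uniformly Cauchy near each point. The limit can then be differentiated termwise, and complex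
  linearity survives pointwise limits.\<close>

lemma mholomorphic_on_uniform_limit:
  fixes f :: "nat \<Rightarrow> complex ^ 'n \<Rightarrow> complex"
  assumes "open \<Omega>" and f: "\<And>k. mholomorphic_on (f k) \<Omega>"
    and lim: "\<And>K. compact K \<Longrightarrow> K \<subseteq> \<Omega> \<Longrightarrow> uniform_limit K f g sequentially"
  shows "mholomorphic_on g \<Omega>"
  unfolding mholomorphic_on_def
proof
  fix z assume z: "z \<in> \<Omega>"
  obtain r0 where "r0 > 0" "cball z r0 \<subseteq> \<Omega>"
    using z \<open>open \<Omega>\<close> open_contains_cball by blast
  then obtain r where r: "r > 0" "cball z (2 * r) \<subseteq> \<Omega>"
    by (metis field_sum_of_halves half_gt_zero mult_2)
  obtain D where D: "\<And>k z. z \<in> \<Omega> \<Longrightarrow> (f k has_derivative D k z) (at z)"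
      "\<And>k z c v. z \<in> \<Omega> \<Longrightarrow> D k z (c *s v) = c * D k z v"
    using f unfolding mholomorphic_on_def by metis
  have sub': "cball w r \<subseteq> cball z (2 * r)" if "w \<in> ball z r" for w
  proof
    fix u assume "u \<in> cball w r"
    then show "u \<in> cball z (2 * r)"
      using that dist_triangle[of z u w] by simp
  qed
  have inO: "w \<in> \<Omega>" if "w \<in> ball z r" for w
    using sub'[OF that] r centre_in_cball[of w r] by (meson less_imp_le subsetD)
  have UL: "uniform_limit (cball z (2 * r)) f g sequentially"
    using lim r by simp
  have Cau: "\<exists>N. \<forall>m\<ge>N. \<forall>n\<ge>N. \<forall>w\<in>ball z r. \<forall>h. norm (D m w h - D n w h) \<le> e * norm h" if e: "e > 0" for e
  proof -
    \<comment> \<open>Two functions within \<open>e * r / 2\<close> of the limit differ by at most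
      \<open>e * r\<close>, and the Cauchy estimate divides by \<open>r\<close>.\<close>
    have "e * r / 2 > 0" using e r by simp
    then obtain N where N: "\<And>n w. n \<ge> N \<Longrightarrow> w \<in> cball z (2 * r) \<Longrightarrow> dist (f n w) (g w) < e * r / 2"
      using UL unfolding uniform_limit_iff eventually_sequentially by meson
    have "norm (D m w h - D n w h) \<le> e * norm h" if mn: "m \<ge> N" "n \<ge> N" and w: "w \<in> ball z r" for m n w h
    proof -
      have "norm (D m w h - D n w h) \<le> e * r / r * norm h"
      proof (rule mholomorphic_Cauchy_estimate[where f = "\<lambda>u. f m u - f n u" and \<Omega> = \<Omega> and z = w])
        show "mholomorphic_on (\<lambda>u. f m u - f n u) \<Omega>"
          by (intro mholomorphic_on_diff f)
        show "cball w r \<subseteq> \<Omega>" using sub'[OF w] r by auto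
        show "norm (f m u - f n u) \<le> e * r" if "u \<in> cball w r" for u
        proof -
          have "u \<in> cball z (2 * r)" using that sub'[OF w] by auto
          then have "dist (f m u) (g u) < e * r / 2" "dist (f n u) (g u) < e * r / 2"
            using N mn by auto
          then show ?thesis
            using dist_triangle2[of "f m u" "f n u" "g u"] by (simp add: dist_norm)
        qed
        show "((\<lambda>u. f m u - f n u) has_derivative (\<lambda>v. D m w v - D n w v)) (at w)"
          by (intro has_derivative_diff D inO[OF w])
        show "D m w (c *s v) - D n w (c *s v) = c * (D m w v - D n w v)" for c v
          by (simp add: D inO[OF w] algebra_simps)
      qed (rule r)
      then show ?thesis using r by simp
    qed
    then show ?thesis by blast
  qed
  have "\<exists>l. (\<lambda>k. D k w h) \<longlonglongrightarrow> l" if w: "w \<in> ball z r" for w h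
  proof -
    have "Cauchy (\<lambda>k. D k w h)"
    proof (rule metric_CauchyI)
      fix e :: real assume e: "e > 0"
      define e' where "e' = e / (norm h + 1)"
      have e': "e' > 0" using e by (simp add: e'_def add_nonneg_pos)
      obtain N where N: "\<forall>m\<ge>N. \<forall>n\<ge>N. \<forall>w\<in>ball z r. \<forall>h. norm (D m w h - D n w h) \<le> e' * norm h"
        using Cau[OF e'] by blast
      have "e' * norm h < e"
      proof -
        have "e' * norm h < e' * (norm h + 1)" using e' by (intro mult_strict_left_mono) auto
        also have "\<dots> = e" by (simp add: e'_def add_nonneg_eq_0_iff)
        finally show ?thesis .
      qed
      then show "\<exists>M. \<forall>m\<ge>M. \<forall>n\<ge>M. dist (D m w h) (D n w h) < e"
        using N w unfolding dist_norm by (meson le_less_trans)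
    qed
    then show ?thesis using Cauchy_convergent convergent_def by blast
  qed
  then obtain G where G: "\<And>w h. w \<in> ball z r \<Longrightarrow> (\<lambda>k. D k w h) \<longlonglongrightarrow> G w h"
    by metis
  have "\<exists>g'. \<forall>x\<in>ball z r. (\<lambda>n. f n x) \<longlonglongrightarrow> g' x \<and> (g' has_derivative G x) (at x within ball z r)"
  proof (rule has_derivative_sequence[where f' = D and ?x0.0 = z and l = "g z"])
    show "(f n has_derivative D n x) (at x within ball z r)" if "x \<in> ball z r" for n x
      using D(1)[OF inO[OF that]] has_derivative_at_withinI by blast
    show "\<forall>\<^sub>F n in sequentially. \<forall>x\<in>ball z r. \<forall>h. norm (D n x h - G x h) \<le> e * norm h" if e: "e > 0" for e
    proof -
      obtain N where N: "\<forall>m\<ge>N. \<forall>n\<ge>N. \<forall>w\<in>ball z r. \<forall>h. norm (D m w h - D n w h) \<le> e * norm h"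
        using Cau[OF e] by blast
      have "norm (D n x h - G x h) \<le> e * norm h" if n: "n \<ge> N" and x: "x \<in> ball z r" for n x h
      proof (rule LIMSEQ_le_const2)
        show "(\<lambda>m. norm (D n x h - D m x h)) \<longlonglongrightarrow> norm (D n x h - G x h)"
          by (intro tendsto_intros G x)
        show "\<exists>N. \<forall>m\<ge>N. norm (D n x h - D m x h) \<le> e * norm h"
          using N n x by blast
      qed
      then show ?thesis unfolding eventually_sequentially by blast
    qed
    show "(\<lambda>n. f n z) \<longlonglongrightarrow> g z"
      using tendsto_uniform_limitI[OF UL, of z] r by simp
  qed (use r in auto)
  then obtain g' where g': "\<And>x. x \<in> ball z r \<Longrightarrow> (\<lambda>n. f n x) \<longlonglongrightarrow> g' x"
      "\<And>x. x \<in> ball z r \<Longrightarrow> (g' has_derivative G x) (at x within ball z r)"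
    by blast
  have eq: "g' x = g x" if "x \<in> ball z r" for x
    using LIMSEQ_unique[OF g'(1)[OF that] tendsto_uniform_limitI[OF UL, of x]] that r by simp
  have "(g' has_derivative G z) (at z within ball z r)"
    using g'(2)[of z] r by simp
  then have "(g' has_derivative G z) (at z)"
    using at_within_open[of z "ball z r"] r by simp
  then have "(g has_derivative G z) (at z)"
    by (rule has_derivative_transform_within_open[OF _ open_ball[of z r]]) (use r eq in auto)
  moreover have "G z (c *s v) = c * G z v" for c v
  proof (rule LIMSEQ_unique)
    show "(\<lambda>k. D k z (c *s v)) \<longlonglongrightarrow> G z (c *s v)" using G r by simp
    show "(\<lambda>k. D k z (c *s v)) \<longlonglongrightarrow> c * G z v"
      unfolding D(2)[OF z] using G r by (intro tendsto_intros) auto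
  qed
  ultimately show "\<exists>D. (g has_derivative D) (at z) \<and> (\<forall>c v. D (c *s v) = c * D v)"
    by blast
qed

text \<open>The Lipschitz bound gives equicontinuity, Arzela-Ascoli a subsequence on each member of
  a compact exhaustion, and diagonalisation a common one. The diagonalised property is being
  uniformly Cauchy, because it mentions no limit function and is inherited by subsequences.\<close>

lemma mholomorphic_Montel:
  fixes f :: "nat \<Rightarrow> complex ^ 'n \<Rightarrow> complex"
  assumes "open \<Omega>" and f: "\<And>k. mholomorphic_on (f k) \<Omega>"
    and bdd: "\<And>K. compact K \<Longrightarrow> K \<subseteq> \<Omega> \<Longrightarrow> \<exists>B. \<forall>k. \<forall>z\<in>K. norm (f k z) \<le> B"
  obtains g r where "strict_mono (r :: nat \<Rightarrow> nat)" "mholomorphic_on g \<Omega>"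
    "\<And>K. compact K \<Longrightarrow> K \<subseteq> \<Omega> \<Longrightarrow> uniform_limit K (\<lambda>k. f (r k)) g sequentially"
proof -
  obtain C :: "nat \<Rightarrow> (complex ^ 'n) set" where C: "\<And>n. compact (C n)" "\<And>n. C n \<subseteq> \<Omega>"
    and sub: "\<And>K. \<lbrakk>compact K; K \<subseteq> \<Omega>\<rbrakk> \<Longrightarrow> \<exists>N. \<forall>n\<ge>N. K \<subseteq> C n"
    using open_Union_compact_subsets[OF \<open>open \<Omega>\<close>] by metis
  define P where "P i s = uniformly_Cauchy_on (C i) (\<lambda>k. f (s k))" for i and s :: "nat \<Rightarrow> nat"
  obtain r :: "nat \<Rightarrow> nat" where r: "strict_mono r" "\<And>i. P i (id \<circ> r)"
  proof (rule subsequence_diagonalization_lemma[of P id])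
    fix i and s :: "nat \<Rightarrow> nat"
    obtain B where B: "\<And>k z. z \<in> C i \<Longrightarrow> norm (f k z) \<le> B"
      using bdd[OF C] by metis
    obtain g k where k: "strict_mono (k :: nat \<Rightarrow> nat)"
      and g: "\<And>e. 0 < e \<Longrightarrow> \<exists>N. \<forall>n x. n \<ge> N \<and> x \<in> C i \<longrightarrow> norm (f (s (k n)) x - g x) < e"
    proof (rule Arzela_Ascoli[of "C i" "\<lambda>n. f (s n)" B])
      fix x e assume x: "x \<in> C i" and e: "0 < (e::real)"
      obtain r0 where "r0 > 0" "cball x r0 \<subseteq> \<Omega>"
        using x C \<open>open \<Omega>\<close> open_contains_cball by blast
      then obtain r where r: "r > 0" "cball x (2 * r) \<subseteq> \<Omega>"
        by (metis field_sum_of_halves half_gt_zero mult_2)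
      obtain M0 where M0: "\<And>k z. z \<in> cball x (2 * r) \<Longrightarrow> norm (f k z) \<le> M0"
        using bdd[OF compact_cball r(2)] by metis
      \<comment> \<open>The maximum with 1 keeps \<open>M\<close> positive, so that
        \<open>e * r / M\<close> is a genuine radius.\<close>
      define M where "M = max M0 1"
      have M: "\<And>k z. z \<in> cball x (2 * r) \<Longrightarrow> norm (f k z) \<le> M" and "M > 0"
        using M0 unfolding M_def by (meson max.coboundedI1, simp)
      have "norm (f (s n) x - f (s n) y) < e" if y: "norm (x - y) < min r (e * r / M)" for n y
      proof -
        have "norm (f (s n) x - f (s n) y) \<le> M / r * norm (x - y)"
          by (rule mholomorphic_Lipschitz[OF f r(2,1) M]) (use r y in \<open>auto simp: dist_norm\<close>)
        also have "\<dots> < M / r * (e * r / M)"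
          using y r \<open>M > 0\<close> by (intro mult_strict_left_mono) auto
        finally show ?thesis using r \<open>M > 0\<close> by simp
      qed
      then show "\<exists>d>0. \<forall>n y. y \<in> C i \<and> norm (x - y) < d \<longrightarrow> norm (f (s n) x - f (s n) y) < e"
        using r e \<open>M > 0\<close> by (intro exI[of _ "min r (e * r / M)"]) simp
    qed (use C B in auto)
    have "uniform_limit (C i) (\<lambda>n. f (s (k n))) g sequentially"
      unfolding uniform_limit_iff eventually_sequentially dist_norm using g by meson
    then have "uniformly_Cauchy_on (C i) (\<lambda>n. f (s (k n)))"
      using uniformly_convergent_Cauchy uniformly_convergent_on_def by blast
    then show "\<exists>k. strict_mono k \<and> P i (s \<circ> k)"
      using k unfolding P_def by auto
  next
    fix i s N and k1 k2 :: "nat \<Rightarrow> nat"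
    assume P: "P i (s \<circ> k1)" and k: "\<And>j. N \<le> j \<Longrightarrow> \<exists>j'\<ge>j. k2 j = k1 j'"
    show "P i (s \<circ> k2)" unfolding P_def
    proof (rule uniformly_Cauchy_onI)
      fix e :: real assume "e > 0"
      then obtain M where M: "\<And>x m n. x \<in> C i \<Longrightarrow> m \<ge> M \<Longrightarrow> n \<ge> M \<Longrightarrow> dist (f (s (k1 m)) x) (f (s (k1 n)) x) < e"
        using P unfolding P_def uniformly_Cauchy_on_def comp_def by meson
      have "dist (f (s (k2 m)) x) (f (s (k2 n)) x) < e" if "x \<in> C i" "m \<ge> max M N" "n \<ge> max M N" for x m n
        using k[of m] k[of n] M that by (metis dual_order.trans max.bounded_iff)
      then show "\<exists>M. \<forall>x\<in>C i. \<forall>m\<ge>M. \<forall>n\<ge>M. dist (f ((s \<circ> k2) m) x) (f ((s \<circ> k2) n) x) < e"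
        unfolding comp_def by blast
    qed
  qed blast
  define g where "g z = lim (\<lambda>k. f (r k) z)" for z
  have UL: "uniform_limit K (\<lambda>k. f (r k)) g sequentially" if K: "compact K" "K \<subseteq> \<Omega>" for K
  proof -
    obtain N where N: "K \<subseteq> C N" using sub[OF K] by auto
    have "uniformly_convergent_on (C N) (\<lambda>k. f (r k))"
      using r(2)[of N] unfolding P_def by (intro Cauchy_uniformly_convergent) simp
    then obtain l where l: "uniform_limit (C N) (\<lambda>k. f (r k)) l sequentially"
      unfolding uniformly_convergent_on_def by blast
    have "l z = g z" if "z \<in> C N" for z
      unfolding g_def using tendsto_uniform_limitI[OF l that] by (simp add: limI)
    then have "uniform_limit (C N) (\<lambda>k. f (r k)) g sequentially"
      using l unfolding uniform_limit_iff by (simp cong: ball_cong)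
    then show ?thesis using N uniform_limit_on_subset by blast
  qed
  have "mholomorphic_on g \<Omega>"
    by (rule mholomorphic_on_uniform_limit[OF \<open>open \<Omega>\<close> f UL])
  then show thesis using that r(1) UL by blast
qed

section \<open>Holomorphic dependence of integrals on parameters\<close>

lemma Riemann_sum_bound:
  fixes F :: "real \<Rightarrow> complex"
  assumes F: "continuous_on {0..1} F" and m: "m > 0"
    and osc: "\<And>s t. s \<in> {0..1} \<Longrightarrow> t \<in> {0..1} \<Longrightarrow> \<bar>s - t\<bar> \<le> 1 / real m \<Longrightarrow> norm (F s - F t) \<le> e"
  shows "norm ((\<Sum>s<m. F (real s / real m)) / of_nat m - integral {0..1} F) \<le> e"
proof -
  have int: "F integrable_on {a..b}" if "0 \<le> a" "b \<le> 1" for a b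
    using that F by (intro integrable_continuous_interval continuous_on_subset[OF F]) auto
  \<comment> \<open>Stated for the integral up to \<open>k / m\<close>, with an error allowance
    proportional to the length, so that an induction over the pieces closes.\<close>
  have *: "norm ((\<Sum>s<k. F (real s / real m)) / of_nat m - integral {0..real k / real m} F) \<le> e * (real k / real m)"
    if "k \<le> m" for k
    using that
  proof (induction k)
    case (Suc k)
    let ?a = "real k / real m" and ?b = "real (Suc k) / real m"
    have ab: "0 \<le> ?a" "?a \<le> ?b" "?b \<le> 1" "?b - ?a = 1 / real m"
      using Suc.prems m by (auto simp: field_simps)
    have "((\<lambda>t. F ?a) has_integral (?b - ?a) *\<^sub>R F ?a) {?a..?b}"
      using has_integral_const_real[of "F ?a" ?a ?b] ab by simp
    moreover have "(F has_integral integral {?a..?b} F) {?a..?b}"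
      using int[of ?a ?b] ab by (simp add: has_integral_integral)
    ultimately have "((\<lambda>t. F ?a - F t) has_integral (?b - ?a) *\<^sub>R F ?a - integral {?a..?b} F) {?a..?b}"
      by (rule has_integral_diff)
    then have "norm ((?b - ?a) *\<^sub>R F ?a - integral {?a..?b} F) \<le> e * (?b - ?a)"
    proof -
      assume hi: "((\<lambda>t. F ?a - F t) has_integral (?b - ?a) *\<^sub>R F ?a - integral {?a..?b} F) {?a..?b}"
      have "norm ((?b - ?a) *\<^sub>R F ?a - integral {?a..?b} F) \<le> e * measure lborel (cbox ?a ?b)"
      proof (rule has_integral_bound)
        show "((\<lambda>t. F ?a - F t) has_integral (?b - ?a) *\<^sub>R F ?a - integral {?a..?b} F) (cbox ?a ?b)"
          using hi by simp
        show "0 \<le> e" using osc[of 0 0] m by simp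
        show "norm (F ?a - F x) \<le> e" if "x \<in> cbox ?a ?b" for x
        proof (rule osc)
          show "?a \<in> {0..1}" "x \<in> {0..1}" "\<bar>?a - x\<bar> \<le> 1 / real m"
            using that ab unfolding cbox_interval atLeastAtMost_iff by linarith+
        qed
      qed
      then show ?thesis using ab by simp
    qed
    moreover have "integral {0..?a} F + integral {?a..?b} F = integral {0..?b} F"
      by (rule Henstock_Kurzweil_Integration.integral_combine) (use ab int[of 0 ?b] in auto)
    moreover have "(\<Sum>s<Suc k. F (real s / real m)) / of_nat m = (\<Sum>s<k. F (real s / real m)) / of_nat m + (?b - ?a) *\<^sub>R F ?a"
      using m by (simp add: ab(4) add_divide_distrib scaleR_conv_of_real)
    moreover note norm_diff_triangle_ineq[of "(\<Sum>s<k. F (real s / real m)) / of_nat m" "(?b - ?a) *\<^sub>R F ?a"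
        "integral {0..?a} F" "integral {?a..?b} F"]
    ultimately have "norm ((\<Sum>s<Suc k. F (real s / real m)) / of_nat m - integral {0..?b} F)
        \<le> norm ((\<Sum>s<k. F (real s / real m)) / of_nat m - integral {0..?a} F) + e * (?b - ?a)"
      by (simp only:)
    then show ?case using Suc by (simp add: algebra_simps)
  qed simp
  from *[of m] show ?thesis using m by simp
qed

text \<open>Riemann sums are finite sums of holomorphic functions. Uniform continuity on
  \<open>{0..1} \<times> K\<close> makes the sums converge uniformly on \<open>K\<close>, so the
  statement reduces to the theorem on locally uniform limits.\<close>

lemma mholomorphic_on_integral:
  fixes F :: "real \<Rightarrow> complex ^ 'n \<Rightarrow> complex"
  assumes "open \<Omega>" and cont: "continuous_on ({0..1} \<times> \<Omega>) (\<lambda>(\<theta>, z). F \<theta> z)"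
    and F: "\<And>\<theta>. \<theta> \<in> {0..1} \<Longrightarrow> mholomorphic_on (F \<theta>) \<Omega>"
  shows "mholomorphic_on (\<lambda>z. integral {0..1} (\<lambda>\<theta>. F \<theta> z)) \<Omega>"
proof (rule mholomorphic_on_uniform_limit[OF \<open>open \<Omega>\<close>])
  let ?f = "\<lambda>k z. (1 / of_nat (Suc k)) * (\<Sum>s<Suc k. F (real s / real (Suc k)) z)"
  show "mholomorphic_on (?f k) \<Omega>" for k
    by (intro mholomorphic_on_cmult mholomorphic_on_sum F) auto
  fix K assume K: "compact K" "K \<subseteq> \<Omega>"
  have "uniformly_continuous_on ({0..1} \<times> K) (\<lambda>(\<theta>, z). F \<theta> z)"
    using K by (intro compact_uniformly_continuous compact_Times continuous_on_subset[OF cont]) auto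
  show "uniform_limit K ?f (\<lambda>z. integral {0..1} (\<lambda>\<theta>. F \<theta> z)) sequentially"
    unfolding uniform_limit_iff
  proof (intro allI impI)
    fix e :: real assume e: "e > 0"
    then obtain d where d: "d > 0"
      and uc: "\<And>x y. x \<in> {0..1} \<times> K \<Longrightarrow> y \<in> {0..1} \<times> K \<Longrightarrow> dist y x < d \<Longrightarrow> dist (case y of (\<theta>, z) \<Rightarrow> F \<theta> z) (case x of (\<theta>, z) \<Rightarrow> F \<theta> z) < e / 2"
      using \<open>uniformly_continuous_on _ _\<close> unfolding uniformly_continuous_on_def by (metis half_gt_zero)
    obtain N where N: "inverse (real (Suc N)) < d" using reals_Archimedean[OF d] by blast
    have "dist (?f k z) (integral {0..1} (\<lambda>\<theta>. F \<theta> z)) < e" if k: "k \<ge> N" and z: "z \<in> K" for k z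
    proof -
      have "norm ((\<Sum>s<Suc k. F (real s / real (Suc k)) z) / of_nat (Suc k) - integral {0..1} (\<lambda>\<theta>. F \<theta> z)) \<le> e / 2"
      proof (rule Riemann_sum_bound)
        have "continuous_on {0..1} ((\<lambda>(\<theta>, z). F \<theta> z) \<circ> (\<lambda>\<theta>. (\<theta>, z)))"
          using z K by (intro continuous_on_compose continuous_intros continuous_on_subset[OF cont]) auto
        then show "continuous_on {0..1} (\<lambda>\<theta>. F \<theta> z)" by (simp add: comp_def)
        have "1 / real (Suc k) \<le> inverse (real (Suc N))"
          using k by (simp add: field_simps)
        then have "1 / real (Suc k) < d" using N by linarith
        then show "norm (F s z - F t z) \<le> e / 2" if "s \<in> {0..1}" "t \<in> {0..1}" "\<bar>s - t\<bar> \<le> 1 / real (Suc k)" for s t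
          using uc[of "(t, z)" "(s, z)"] that z by (auto simp: dist_Pair_Pair dist_real_def dist_norm)
      qed simp
      then show ?thesis using e by (simp add: dist_norm)
    qed
    then show "\<forall>\<^sub>F k in sequentially. \<forall>z\<in>K. dist (?f k z) (integral {0..1} (\<lambda>\<theta>. F \<theta> z)) < e"
      unfolding eventually_sequentially by blast
  qed
qed

section \<open>Square integrable functions\<close>

lemma L2_measurable: "f \<in> L2 \<Omega> \<Longrightarrow> f \<in> borel_measurable (lebesgue_on \<Omega>)"
  by (simp add: L2_def)

lemma L2_iff:
  "f \<in> L2 \<Omega> \<longleftrightarrow> f \<in> borel_measurable (lebesgue_on \<Omega>) \<and>
     (\<integral>\<^sup>+z. ennreal ((norm (f z))\<^sup>2) \<partial>lebesgue_on \<Omega>) < \<infinity>"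
  unfolding L2_def by (auto simp: integrable_iff_bounded)

lemma L2_norm_nonneg [simp]: "0 \<le> L2_norm \<Omega> f"
  by (simp add: L2_norm_def)

lemma L2_norm_power2: "(L2_norm \<Omega> f)\<^sup>2 = (LINT z|lebesgue_on \<Omega>. (norm (f z))\<^sup>2)"
  by (simp add: L2_norm_def)

lemma L2_norm_nn:
  assumes "f \<in> L2 \<Omega>"
  shows "ennreal ((L2_norm \<Omega> f)\<^sup>2) = (\<integral>\<^sup>+z. ennreal ((norm (f z))\<^sup>2) \<partial>lebesgue_on \<Omega>)"
  using assms unfolding L2_norm_power2 L2_def by (intro nn_integral_eq_integral[symmetric]) auto

lemma L2_norm_le_nn:
  assumes "f \<in> L2 \<Omega>" "(\<integral>\<^sup>+z. ennreal ((norm (f z))\<^sup>2) \<partial>lebesgue_on \<Omega>) \<le> ennreal (c\<^sup>2)" "c \<ge> 0"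
  shows "L2_norm \<Omega> f \<le> c"
proof -
  have "(L2_norm \<Omega> f)\<^sup>2 \<le> c\<^sup>2"
    using assms(2) unfolding L2_norm_nn[OF assms(1), symmetric] by (simp add: ennreal_le_iff)
  then show ?thesis using assms(3) power2_le_imp_le by blast
qed

lemma L2_dominated:
  assumes "f \<in> L2 \<Omega>" "g \<in> borel_measurable (lebesgue_on \<Omega>)" "c \<ge> 0"
    and le: "\<And>z. z \<in> \<Omega> \<Longrightarrow> norm (g z) \<le> c * norm (f z)"
  shows "g \<in> L2 \<Omega>" "L2_norm \<Omega> g \<le> c * L2_norm \<Omega> f"
proof -
  have [measurable]: "f \<in> borel_measurable (lebesgue_on \<Omega>)" using assms by (simp add: L2_def)
  have "(\<integral>\<^sup>+z. ennreal ((norm (g z))\<^sup>2) \<partial>lebesgue_on \<Omega>) \<le> (\<integral>\<^sup>+z. ennreal (c\<^sup>2) * ennreal ((norm (f z))\<^sup>2) \<partial>lebesgue_on \<Omega>)"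
  proof (rule nn_integral_mono)
    fix z assume "z \<in> space (lebesgue_on \<Omega>)"
    then have "(norm (g z))\<^sup>2 \<le> (c * norm (f z))\<^sup>2"
      using le by (intro power_mono) auto
    then show "ennreal ((norm (g z))\<^sup>2) \<le> ennreal (c\<^sup>2) * ennreal ((norm (f z))\<^sup>2)"
      by (simp add: ennreal_mult[symmetric] power_mult_distrib)
  qed
  also have "\<dots> = ennreal (c\<^sup>2) * ennreal ((L2_norm \<Omega> f)\<^sup>2)"
    unfolding L2_norm_nn[OF assms(1)] by (rule nn_integral_cmult) measurable
  also have "\<dots> = ennreal ((c * L2_norm \<Omega> f)\<^sup>2)"
    by (simp add: ennreal_mult[symmetric] power_mult_distrib)
  finally have *: "(\<integral>\<^sup>+z. ennreal ((norm (g z))\<^sup>2) \<partial>lebesgue_on \<Omega>) \<le> ennreal ((c * L2_norm \<Omega> f)\<^sup>2)" .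
  then show "g \<in> L2 \<Omega>" unfolding L2_iff using assms(2) ennreal_less_top le_less_trans by fastforce
  then show "L2_norm \<Omega> g \<le> c * L2_norm \<Omega> f"
    by (rule L2_norm_le_nn[OF _ *]) (use assms in auto)
qed

lemma L2_mult_bounded:
  assumes "f \<in> L2 \<Omega>" "a \<in> borel_measurable (lebesgue_on \<Omega>)" "\<And>z. z \<in> \<Omega> \<Longrightarrow> norm (a z) \<le> B" "B \<ge> 0"
  shows "(\<lambda>z. a z * f z) \<in> L2 \<Omega>" "L2_norm \<Omega> (\<lambda>z. a z * f z) \<le> B * L2_norm \<Omega> f"
proof -
  have m: "(\<lambda>z. a z * f z) \<in> borel_measurable (lebesgue_on \<Omega>)"
    using assms L2_measurable by (intro borel_measurable_times) auto
  have le: "norm (a z * f z) \<le> B * norm (f z)" if "z \<in> \<Omega>" for z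
    using assms(3)[OF that] by (simp add: norm_mult mult_right_mono)
  show "(\<lambda>z. a z * f z) \<in> L2 \<Omega>" "L2_norm \<Omega> (\<lambda>z. a z * f z) \<le> B * L2_norm \<Omega> f"
    using L2_dominated[OF assms(1) m assms(4) le] by auto
qed

lemma L2_cmult: "f \<in> L2 \<Omega> \<Longrightarrow> (\<lambda>z. c * f z) \<in> L2 \<Omega>"
  using L2_mult_bounded(1)[of f \<Omega> "\<lambda>_. c" "norm c"] by simp

lemma L2_zero [simp]: "(\<lambda>z. 0) \<in> L2 \<Omega>" "L2_norm \<Omega> (\<lambda>z. 0) = 0"
  by (simp_all add: L2_def L2_norm_def)

lemma L2_norm_cmult: "L2_norm \<Omega> (\<lambda>z. c * f z) = norm c * L2_norm \<Omega> f"
  by (simp add: L2_norm_def norm_mult power_mult_distrib real_sqrt_mult)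

lemma L2_norm_minus_commute: "L2_norm \<Omega> (\<lambda>z. f z - g z) = L2_norm \<Omega> (\<lambda>z. g z - f z)"
  by (simp add: L2_norm_def norm_minus_commute)

lemma L2_add:
  assumes "f \<in> L2 \<Omega>" "g \<in> L2 \<Omega>"
  shows "(\<lambda>z. f z + g z) \<in> L2 \<Omega>"
proof -
  have [measurable]: "f \<in> borel_measurable (lebesgue_on \<Omega>)" "g \<in> borel_measurable (lebesgue_on \<Omega>)"
    using assms by (auto simp: L2_def)
  have "integrable (lebesgue_on \<Omega>) (\<lambda>z. 2 * (norm (f z))\<^sup>2 + 2 * (norm (g z))\<^sup>2)"
    using assms by (auto simp: L2_def)
  then have "integrable (lebesgue_on \<Omega>) (\<lambda>z. (norm (f z + g z))\<^sup>2)"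
  proof (rule Bochner_Integration.integrable_bound)
    have "(norm (f z + g z))\<^sup>2 \<le> 2 * (norm (f z))\<^sup>2 + 2 * (norm (g z))\<^sup>2" for z
    proof -
      have "(norm (f z + g z))\<^sup>2 \<le> (norm (f z) + norm (g z))\<^sup>2"
        by (intro power_mono norm_triangle_ineq) auto
      also have "\<dots> \<le> 2 * (norm (f z))\<^sup>2 + 2 * (norm (g z))\<^sup>2"
        using sum_squares_bound[of "norm (f z)" "norm (g z)"] by (simp add: power2_sum)
      finally show ?thesis .
    qed
    then show "AE z in lebesgue_on \<Omega>. norm ((norm (f z + g z))\<^sup>2) \<le> norm (2 * (norm (f z))\<^sup>2 + 2 * (norm (g z))\<^sup>2)"
      by auto
  qed measurable
  then show ?thesis by (simp add: L2_def)
qed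

lemma L2_diff: "f \<in> L2 \<Omega> \<Longrightarrow> g \<in> L2 \<Omega> \<Longrightarrow> (\<lambda>z. f z - g z) \<in> L2 \<Omega>"
  using L2_add[of f \<Omega> "\<lambda>z. - 1 * g z"] L2_cmult[of g \<Omega> "-1"] by simp

lemma L2_sum: "(\<And>a. a \<in> A \<Longrightarrow> f a \<in> L2 \<Omega>) \<Longrightarrow> (\<lambda>z. \<Sum>a\<in>A. f a z) \<in> L2 \<Omega>"
  by (induction A rule: infinite_finite_induct) (auto intro: L2_add)

section \<open>Inner product, Cauchy-Schwarz and the triangle inequality\<close>

lemma borel_measurable_cnj [measurable (raw)]:
  "f \<in> borel_measurable M \<Longrightarrow> (\<lambda>x. cnj (f x)) \<in> borel_measurable M"
  by (rule measurable_compose[of f M borel cnj]) (auto intro!: borel_measurable_continuous_onI continuous_intros)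

lemma L2_inner_integrable:
  assumes "f \<in> L2 \<Omega>" "g \<in> L2 \<Omega>"
  shows "integrable (lebesgue_on \<Omega>) (\<lambda>z. f z * cnj (g z))"
proof -
  have [measurable]: "f \<in> borel_measurable (lebesgue_on \<Omega>)" "g \<in> borel_measurable (lebesgue_on \<Omega>)"
    using assms by (auto simp: L2_def)
  have "integrable (lebesgue_on \<Omega>) (\<lambda>z. (norm (f z))\<^sup>2 + (norm (g z))\<^sup>2)"
    using assms by (auto simp: L2_def)
  then show ?thesis
  proof (rule Bochner_Integration.integrable_bound)
    have "norm (f z * cnj (g z)) \<le> (norm (f z))\<^sup>2 + (norm (g z))\<^sup>2" for z
      using sum_squares_bound[of "norm (f z)" "norm (g z)"] mult_nonneg_nonneg[OF norm_ge_zero norm_ge_zero, of "f z" "g z"]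
      unfolding norm_mult complex_mod_cnj by linarith
    then show "AE z in lebesgue_on \<Omega>. norm (f z * cnj (g z)) \<le> norm ((norm (f z))\<^sup>2 + (norm (g z))\<^sup>2)"
      by auto
  qed measurable
qed

lemma L2_inner_add_left:
  "f \<in> L2 \<Omega> \<Longrightarrow> g \<in> L2 \<Omega> \<Longrightarrow> h \<in> L2 \<Omega> \<Longrightarrow>
    L2_inner \<Omega> (\<lambda>z. f z + g z) h = L2_inner \<Omega> f h + L2_inner \<Omega> g h"
  unfolding L2_inner_def by (simp add: distrib_right L2_inner_integrable)

lemma L2_inner_cmult_left: "L2_inner \<Omega> (\<lambda>z. c * f z) h = c * L2_inner \<Omega> f h"
  unfolding L2_inner_def by (simp add: mult.assoc)

lemma L2_inner_diff_left:
  "f \<in> L2 \<Omega> \<Longrightarrow> g \<in> L2 \<Omega> \<Longrightarrow> h \<in> L2 \<Omega> \<Longrightarrow>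
    L2_inner \<Omega> (\<lambda>z. f z - g z) h = L2_inner \<Omega> f h - L2_inner \<Omega> g h"
  unfolding L2_inner_def by (simp add: left_diff_distrib L2_inner_integrable)

lemma L2_inner_commute: "L2_inner \<Omega> f g = cnj (L2_inner \<Omega> g f)"
  unfolding L2_inner_def Bochner_Integration.integral_cnj[symmetric] by (simp add: mult.commute)

lemma L2_inner_add_right:
  "f \<in> L2 \<Omega> \<Longrightarrow> g \<in> L2 \<Omega> \<Longrightarrow> h \<in> L2 \<Omega> \<Longrightarrow>
    L2_inner \<Omega> h (\<lambda>z. f z + g z) = L2_inner \<Omega> h f + L2_inner \<Omega> h g"
  by (subst (1 2 3) L2_inner_commute) (simp add: L2_inner_add_left)

lemma L2_inner_diff_right:
  "f \<in> L2 \<Omega> \<Longrightarrow> g \<in> L2 \<Omega> \<Longrightarrow> h \<in> L2 \<Omega> \<Longrightarrow>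
    L2_inner \<Omega> h (\<lambda>z. f z - g z) = L2_inner \<Omega> h f - L2_inner \<Omega> h g"
  by (subst (1 2 3) L2_inner_commute) (simp add: L2_inner_diff_left)

lemma L2_inner_cmult_right: "L2_inner \<Omega> h (\<lambda>z. c * f z) = cnj c * L2_inner \<Omega> h f"
  by (subst (1 2) L2_inner_commute) (simp add: L2_inner_cmult_left)

lemma L2_inner_mult_left: "L2_inner \<Omega> (\<lambda>z. a z * f z) g = L2_inner \<Omega> f (\<lambda>z. cnj (a z) * g z)"
  unfolding L2_inner_def by (simp add: mult_ac)

lemma L2_inner_self: "L2_inner \<Omega> f f = of_real ((L2_norm \<Omega> f)\<^sup>2)"
  unfolding L2_inner_def L2_norm_power2 complex_norm_square[symmetric] by (rule integral_complex_of_real)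

lemma L2_norm_add_power2:
  assumes "f \<in> L2 \<Omega>" "g \<in> L2 \<Omega>"
  shows "(L2_norm \<Omega> (\<lambda>z. f z + g z))\<^sup>2 = (L2_norm \<Omega> f)\<^sup>2 + 2 * Re (L2_inner \<Omega> f g) + (L2_norm \<Omega> g)\<^sup>2"
proof -
  have "L2_inner \<Omega> (\<lambda>z. f z + g z) (\<lambda>z. f z + g z) = L2_inner \<Omega> f f + L2_inner \<Omega> f g + cnj (L2_inner \<Omega> f g) + L2_inner \<Omega> g g"
    using assms by (simp add: L2_inner_add_left L2_inner_add_right L2_add L2_inner_commute[of \<Omega> g f])
  then have "Re (L2_inner \<Omega> (\<lambda>z. f z + g z) (\<lambda>z. f z + g z)) = Re (L2_inner \<Omega> f f) + 2 * Re (L2_inner \<Omega> f g) + Re (L2_inner \<Omega> g g)"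
    by simp
  then show ?thesis by (simp add: L2_inner_self)
qed

lemma L2_Cauchy_Schwarz:
  assumes "f \<in> L2 \<Omega>" "g \<in> L2 \<Omega>"
  shows "norm (L2_inner \<Omega> f g) \<le> L2_norm \<Omega> f * L2_norm \<Omega> g"
proof -
  have [measurable]: "f \<in> borel_measurable (lebesgue_on \<Omega>)" "g \<in> borel_measurable (lebesgue_on \<Omega>)"
    using assms by (auto simp: L2_def)
  have "ennreal ((norm (L2_inner \<Omega> f g))\<^sup>2) = (ennreal (norm (L2_inner \<Omega> f g)))\<^sup>2"
    by (simp add: ennreal_power)
  also have "\<dots> \<le> (\<integral>\<^sup>+z. ennreal (norm (f z * cnj (g z))) \<partial>lebesgue_on \<Omega>)\<^sup>2"
    unfolding L2_inner_def by (intro power_mono integral_norm_bound_ennreal L2_inner_integrable assms) auto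
  also have "\<dots> = (\<integral>\<^sup>+z. ennreal (norm (f z)) * ennreal (norm (g z)) \<partial>lebesgue_on \<Omega>)\<^sup>2"
    by (simp add: norm_mult ennreal_mult)
  also have "\<dots> \<le> (\<integral>\<^sup>+z. (ennreal (norm (f z)))\<^sup>2 \<partial>lebesgue_on \<Omega>) * (\<integral>\<^sup>+z. (ennreal (norm (g z)))\<^sup>2 \<partial>lebesgue_on \<Omega>)"
    by (rule Cauchy_Schwarz_nn_integral) measurable
  also have "\<dots> = ennreal ((L2_norm \<Omega> f * L2_norm \<Omega> g)\<^sup>2)"
    using assms by (simp add: ennreal_power L2_norm_nn[symmetric] ennreal_mult[symmetric] power_mult_distrib)
  finally have "(norm (L2_inner \<Omega> f g))\<^sup>2 \<le> (L2_norm \<Omega> f * L2_norm \<Omega> g)\<^sup>2"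
    by (simp add: ennreal_le_iff)
  then show ?thesis by (rule power2_le_imp_le) simp
qed

lemma L2_triangle:
  assumes "f \<in> L2 \<Omega>" "g \<in> L2 \<Omega>"
  shows "L2_norm \<Omega> (\<lambda>z. f z + g z) \<le> L2_norm \<Omega> f + L2_norm \<Omega> g"
proof (rule power2_le_imp_le)
  have "Re (L2_inner \<Omega> f g) \<le> L2_norm \<Omega> f * L2_norm \<Omega> g"
    using L2_Cauchy_Schwarz[OF assms] complex_Re_le_cmod[of "L2_inner \<Omega> f g"] by linarith
  then show "(L2_norm \<Omega> (\<lambda>z. f z + g z))\<^sup>2 \<le> (L2_norm \<Omega> f + L2_norm \<Omega> g)\<^sup>2"
    using L2_norm_add_power2[OF assms] by (simp add: power2_sum)
qed simp

lemma L2_triangle_diff: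
  assumes "f \<in> L2 \<Omega>" "g \<in> L2 \<Omega>"
  shows "L2_norm \<Omega> (\<lambda>z. f z - g z) \<le> L2_norm \<Omega> f + L2_norm \<Omega> g"
  using L2_triangle[OF assms(1) L2_cmult[OF assms(2), of "-1"]] L2_norm_cmult[of \<Omega> "-1" g] by simp

section \<open>The polydisk\<close>

definition upd :: "'n \<Rightarrow> complex \<Rightarrow> complex ^ 'n \<Rightarrow> complex ^ 'n" where
  "upd i w z = (\<chi> j. if j = i then w else z $ j)"

text \<open>A rotation of one coordinate for \<open>norm c = 1\<close> and a contraction towards
  \<open>z_i = 0\<close> for \<open>0 \<le> c < 1\<close>. All estimates in the single variable
  \<open>z_i\<close> are made with these maps on the full space, in place of a product
  decomposition.\<close>

definition sc :: "'n \<Rightarrow> complex \<Rightarrow> complex ^ 'n \<Rightarrow> complex ^ 'n" where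
  "sc i c z = upd i (c * z $ i) z"

lemma upd_nth [simp]: "upd i w z $ j = (if j = i then w else z $ j)"
  by (simp add: upd_def)

lemma sc_nth [simp]: "sc i c z $ j = (if j = i then c * z $ i else z $ j)"
  by (simp add: sc_def)

lemma upd_self [simp]: "upd i (z $ i) z = z"
  by (simp add: vec_eq_iff)

lemma sc_sc [simp]: "sc i c (sc i d z) = sc i (c * d) z"
  by (simp add: vec_eq_iff)

lemma sc_1 [simp]: "sc i 1 z = z"
  by (simp add: vec_eq_iff)

lemma continuous_on_upd [continuous_intros]:
  assumes "continuous_on A f" "continuous_on A g"
  shows "continuous_on A (\<lambda>x. upd i (f x) (g x))"
  unfolding upd_def
proof (rule continuous_on_vec_lambda)
  fix j show "continuous_on A (\<lambda>x. if j = i then f x else g x $ j)"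
    using assms by (cases "j = i") (auto intro!: continuous_intros)
qed

lemma continuous_on_sc [continuous_intros]:
  "continuous_on A f \<Longrightarrow> continuous_on A g \<Longrightarrow> continuous_on A (\<lambda>x. sc i (f x) (g x))"
  unfolding sc_def by (intro continuous_intros)

lemma linear_sc: "linear (sc i c)"
  by (rule linearI) (simp_all add: vec_eq_iff algebra_simps)

lemma linear_upd0: "linear (upd i 0)"
  by (rule linearI) (simp_all add: vec_eq_iff algebra_simps)

lemma sc_smult: "sc i c (a *s v) = a *s sc i c v"
  by (simp add: vec_eq_iff)

lemma upd0_smult: "upd i 0 (a *s v) = a *s upd i 0 v"
  by (simp add: vec_eq_iff)

lemma has_derivative_sc: "(sc i c has_derivative sc i c) (at z within A)"
  using linear_sc[of i c] by (simp add: bounded_linear_imp_has_derivative linear_conv_bounded_linear)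

lemma has_derivative_upd: "(upd i w has_derivative upd i 0) (at z within A)"
proof -
  have "upd i w = (\<lambda>z. axis i w + upd i 0 z)"
    by (auto simp: fun_eq_iff vec_eq_iff axis_def)
  moreover have "((\<lambda>z. axis i w + upd i 0 z) has_derivative (\<lambda>v. 0 + upd i 0 v)) (at z within A)"
    using linear_upd0[of i]
    by (intro has_derivative_add has_derivative_const) (simp add: bounded_linear_imp_has_derivative linear_conv_bounded_linear)
  ultimately show ?thesis by simp
qed

lemma orthogonal_transformation_sc: "norm c = 1 \<Longrightarrow> orthogonal_transformation (sc i c)"
proof -
  assume c: "norm c = 1"
  have "norm (sc i c z) = norm z" for z
  proof -
    have "norm (sc i c z $ j) = norm (z $ j)" for j using c by (simp add: norm_mult)
    then show ?thesis by (simp add: norm_vec_def L2_set_def)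
  qed
  then show ?thesis unfolding orthogonal_transformation using linear_sc by blast
qed

lemma orthogonal_transformation_smult: "norm c = 1 \<Longrightarrow> orthogonal_transformation (\<lambda>v :: complex ^ 'n. c *s v)"
  unfolding orthogonal_transformation
  by (auto intro!: linearI simp: vec_eq_iff algebra_simps norm_vector_smult)

text \<open>The change of variables for a diagonal linear map. One complex coordinate is two real
  ones, hence the Jacobian \<open>t^2\<close>.\<close>

lemma nn_integral_sc:
  fixes g :: "complex ^ 'n \<Rightarrow> ennreal"
  assumes [measurable]: "g \<in> borel_measurable borel" and t: "t > 0"
  shows "(\<integral>\<^sup>+z. g z \<partial>lborel) = ennreal (t\<^sup>2) * (\<integral>\<^sup>+z. g (sc i (of_real t) z) \<partial>lborel)"
proof -
  define c :: "complex ^ 'n \<Rightarrow> real" where "c b = (if b $ i = 0 then 1 else t)" for b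
  have [measurable]: "sc i (of_real t) \<in> borel_measurable borel"
    by (intro borel_measurable_continuous_onI continuous_intros)
  have T: "0 + (\<Sum>b\<in>Basis. (c b * (z \<bullet> b)) *\<^sub>R b) = sc i (of_real t) z" for z :: "complex ^ 'n"
  proof (rule euclidean_eqI)
    fix b :: "complex ^ 'n" assume b: "b \<in> Basis"
    then obtain k u where ku: "b = axis k u" "u \<in> Basis"
      unfolding Basis_vec_def by blast
    then have "u \<noteq> 0" by auto
    then have cb: "c b = (if k = i then t else 1)"
      by (simp add: ku(1) c_def axis_def)
    have "sc i (of_real t) z \<bullet> b = c b * (z \<bullet> b)"
      unfolding cb by (simp add: ku(1) inner_axis scaleR_conv_of_real[symmetric])
    then show "(0 + (\<Sum>b\<in>Basis. (c b * (z \<bullet> b)) *\<^sub>R b)) \<bullet> b = sc i (of_real t) z \<bullet> b"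
      using b by simp
  qed
  \<comment> \<open>The two real basis vectors of coordinate \<open>i\<close> contribute
    \<open>t\<close> each and all others contribute 1.\<close>
  have "(\<Prod>b\<in>Basis. \<bar>c b\<bar>) = (\<Prod>b\<in>{axis i 1, axis i \<i>}. \<bar>c b\<bar>)"
  proof (rule prod.mono_neutral_right)
    show "{axis i 1, axis i \<i>} \<subseteq> (Basis :: (complex ^ 'n) set)"
      by (auto simp: Basis_vec_def Basis_complex_def)
    show "\<forall>b\<in>Basis - {axis i 1, axis i \<i>}. \<bar>c b\<bar> = 1"
    proof
      fix b :: "complex ^ 'n" assume b: "b \<in> Basis - {axis i 1, axis i \<i>}"
      then obtain k u where ku: "b = axis k u" "u \<in> {1, \<i>}"
        unfolding Basis_vec_def Basis_complex_def by blast
      then have "k \<noteq> i" using b by auto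
      then show "\<bar>c b\<bar> = 1" by (simp add: c_def ku(1) axis_def)
    qed
  qed auto
  also have "\<dots> = t\<^sup>2"
    using t by (simp add: c_def axis_eq_axis power2_eq_square)
  finally have prd: "(\<Prod>b\<in>Basis. \<bar>c b\<bar>) = t\<^sup>2" .
  have "(lborel :: (complex ^ 'n) measure) = density (distr lborel borel (sc i (of_real t))) (\<lambda>_. ennreal (t\<^sup>2))"
    using lborel_affine_euclidean[of c 0] t unfolding T prd by (simp add: c_def)
  then have "(\<integral>\<^sup>+z. g z \<partial>lborel) = (\<integral>\<^sup>+z. g z \<partial>density (distr lborel borel (sc i (of_real t))) (\<lambda>_. ennreal (t\<^sup>2)))"
    by simp
  also have "\<dots> = ennreal (t\<^sup>2) * (\<integral>\<^sup>+z. g (sc i (of_real t) z) \<partial>lborel)"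
    by (simp add: nn_integral_density nn_integral_distr nn_integral_cmult)
  finally show ?thesis .
qed

lemma polydisk_iff: "z \<in> polydisk \<longleftrightarrow> (\<forall>j. norm (z $ j) < 1)"
  by (simp add: polydisk_def)

lemma open_polydisk: "open (polydisk :: (complex ^ 'n) set)"
proof -
  have "polydisk = (\<Inter>j. {z :: complex ^ 'n. norm (z $ j) < 1})"
    by (auto simp: polydisk_def)
  moreover have "open {z :: complex ^ 'n. norm (z $ j) < 1}" for j
    by (intro open_Collect_less continuous_intros)
  ultimately show ?thesis using open_INT[of UNIV "\<lambda>j. {z :: complex ^ 'n. norm (z $ j) < 1}"] by simp
qed

lemma borel_polydisk [measurable]: "(polydisk :: (complex ^ 'n) set) \<in> sets borel"
  by (rule borel_open[OF open_polydisk])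

lemma convex_polydisk: "convex (polydisk :: (complex ^ 'n) set)"
proof (rule convexI)
  fix x y :: "complex ^ 'n" and u v :: real
  assume xy: "x \<in> polydisk" "y \<in> polydisk" and uv: "0 \<le> u" "0 \<le> v" "u + v = 1"
  have "norm ((u *\<^sub>R x + v *\<^sub>R y) $ j) < 1" for j
  proof -
    have "u *\<^sub>R (x $ j) + v *\<^sub>R (y $ j) \<in> ball 0 1"
      using xy uv by (intro convexD[OF convex_ball]) (auto simp: polydisk_def)
    then show ?thesis by simp
  qed
  then show "u *\<^sub>R x + v *\<^sub>R y \<in> polydisk" by (simp add: polydisk_def)
qed

lemma closure_polydisk: "closure (polydisk :: (complex ^ 'n) set) = {z. \<forall>j. norm (z $ j) \<le> 1}"
proof
  have "{z :: complex ^ 'n. \<forall>j. norm (z $ j) \<le> 1} = (\<Inter>j. {z. norm (z $ j) \<le> 1})" by auto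
  moreover have "closed {z :: complex ^ 'n. norm (z $ j) \<le> 1}" for j
    by (intro closed_Collect_le continuous_intros)
  ultimately have "closed {z :: complex ^ 'n. \<forall>j. norm (z $ j) \<le> 1}" by (auto intro: closed_INT)
  then show "closure polydisk \<subseteq> {z :: complex ^ 'n. \<forall>j. norm (z $ j) \<le> 1}"
    by (rule closure_minimal[rotated]) (auto simp: polydisk_def less_imp_le)
  show "{z. \<forall>j. norm (z $ j) \<le> 1} \<subseteq> closure (polydisk :: (complex ^ 'n) set)"
  proof
    fix z :: "complex ^ 'n" assume z: "z \<in> {z. \<forall>j. norm (z $ j) \<le> 1}"
    define r where "r n = 1 - 1 / real (Suc n)" for n
    have r: "0 \<le> r n" "r n < 1" for n by (auto simp: r_def field_simps)
    have "(\<lambda>n. r n *\<^sub>R z) \<longlonglongrightarrow> 1 *\<^sub>R z"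
    proof (intro tendsto_intros)
      show "r \<longlonglongrightarrow> 1" unfolding r_def using LIMSEQ_inverse_real_of_nat_add_minus[of 1] by (simp add: divide_inverse)
    qed
    moreover have "r n *\<^sub>R z \<in> polydisk" for n
    proof -
      have "norm (r n *\<^sub>R (z $ j)) < 1" for j
      proof -
        have "norm (r n *\<^sub>R (z $ j)) \<le> r n * 1"
          unfolding norm_scaleR using z r[of n] by (intro mult_mono) auto
        then show ?thesis using r[of n] by linarith
      qed
      then show ?thesis by (simp add: polydisk_def)
    qed
    ultimately show "z \<in> closure polydisk"
      unfolding closure_sequential by (intro exI[of _ "\<lambda>n. r n *\<^sub>R z"]) auto
  qed
qed

lemma compact_closure_polydisk: "compact (closure (polydisk :: (complex ^ 'n) set))"
proof -
  have "norm z \<le> sqrt (real CARD('n))" if "z \<in> polydisk" for z :: "complex ^ 'n"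
  proof -
    have "(\<Sum>j\<in>UNIV. (norm (z $ j))\<^sup>2) \<le> (\<Sum>j\<in>(UNIV :: 'n set). 1)"
      using that by (intro sum_mono) (auto simp: polydisk_def abs_square_le_1 less_imp_le)
    then show ?thesis by (simp add: norm_vec_def L2_set_def)
  qed
  then have "bounded (polydisk :: (complex ^ 'n) set)" unfolding bounded_iff by blast
  then show ?thesis by simp
qed

lemma frontier_polydisk_iff:
  "z \<in> frontier (polydisk :: (complex ^ 'n) set) \<longleftrightarrow> (\<forall>j. norm (z $ j) \<le> 1) \<and> z \<notin> polydisk"
  by (simp add: frontier_def closure_polydisk interior_open[OF open_polydisk])

lemma sc_in_polydisk: "z \<in> polydisk \<Longrightarrow> norm c \<le> 1 \<Longrightarrow> sc i c z \<in> polydisk"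
  unfolding polydisk_iff
proof
  fix j assume z: "\<forall>j. norm (z $ j) < 1" and c: "norm c \<le> 1"
  have "norm (c * z $ i) \<le> norm (z $ i)"
    using c by (simp add: norm_mult mult_left_le_one_le)
  then have "norm (c * z $ i) < 1" using z le_less_trans by blast
  then show "norm (sc i c z $ j) < 1" using z by simp
qed

lemma sc_in_polydisk_iff: "norm c = 1 \<Longrightarrow> sc i c z \<in> polydisk \<longleftrightarrow> z \<in> polydisk"
  by (auto simp: polydisk_iff norm_mult)

lemma upd_in_polydisk: "z \<in> polydisk \<Longrightarrow> norm w < 1 \<Longrightarrow> upd i w z \<in> polydisk"
  by (simp add: polydisk_iff)

lemma mholomorphic_sc:
  assumes "mholomorphic_on f polydisk" "norm c \<le> 1"
  shows "mholomorphic_on (\<lambda>z. f (sc i c z)) polydisk"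
proof (rule mholomorphic_on_compose[OF assms(1)])
  show "sc i c z \<in> polydisk" if "z \<in> polydisk" for z using sc_in_polydisk that assms by blast
  show "\<exists>L. (sc i c has_derivative L) (at z) \<and> (\<forall>a v. L (a *s v) = a *s L v)" for z
    using has_derivative_sc sc_smult by blast
qed

lemma mholomorphic_upd:
  assumes "mholomorphic_on f \<Omega>" "\<And>z. z \<in> A \<Longrightarrow> upd i w z \<in> \<Omega>"
  shows "mholomorphic_on (\<lambda>z. f (upd i w z)) A"
proof (rule mholomorphic_on_compose[OF assms(1)])
  show "upd i w z \<in> \<Omega>" if "z \<in> A" for z using that assms by blast
  show "\<exists>L. (upd i w has_derivative L) (at z) \<and> (\<forall>a v. L (a *s v) = a *s L v)" for z
    using has_derivative_upd upd0_smult by blast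
qed

lemma mholomorphic_nth: "mholomorphic_on (\<lambda>z. z $ i) \<Omega>"
  unfolding mholomorphic_on_def
proof
  fix z assume "z \<in> \<Omega>"
  have "((\<lambda>z. z $ i) has_derivative (\<lambda>z. z $ i)) (at z)"
    by (rule bounded_linear_imp_has_derivative[OF bounded_linear_vec_nth])
  then show "\<exists>D. ((\<lambda>z. z $ i) has_derivative D) (at z) \<and> (\<forall>c v. D (c *s v) = c * D v)" by auto
qed

section \<open>Bergman spaces and the Bergman projection\<close>

lemma nn_integral_lebesgue_on_borel:
  fixes g :: "'a::euclidean_space \<Rightarrow> ennreal"
  assumes [measurable]: "g \<in> borel_measurable borel" "\<Omega> \<in> sets borel"
  shows "(\<integral>\<^sup>+z. g z \<partial>lebesgue_on \<Omega>) = (\<integral>\<^sup>+z. g z * indicator \<Omega> z \<partial>lborel)"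
proof -
  have "(\<integral>\<^sup>+z. g z \<partial>lebesgue_on \<Omega>) = (\<integral>\<^sup>+z. g z * indicator \<Omega> z \<partial>lebesgue)"
    by (rule nn_integral_restrict_space) auto
  also have "\<dots> = (\<integral>\<^sup>+z. g z * indicator \<Omega> z \<partial>lborel)"
    by (rule nn_integral_completion) measurable
  finally show ?thesis .
qed

lemma borel_measurable_lebesgue_on: "f \<in> borel_measurable borel \<Longrightarrow> f \<in> borel_measurable (lebesgue_on \<Omega>)"
  by (intro measurable_restrict_space1 measurable_completion) simp

lemma bergman_L2: "f \<in> bergman \<Omega> \<Longrightarrow> f \<in> L2 \<Omega>"
  and bergman_mholomorphic: "f \<in> bergman \<Omega> \<Longrightarrow> mholomorphic_on f \<Omega>"
  and bergman_off: "f \<in> bergman \<Omega> \<Longrightarrow> z \<notin> \<Omega> \<Longrightarrow> f z = 0"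
  by (auto simp: bergman_def)

text \<open>Vanishing off \<open>\<Omega>\<close> turns continuity on an open set into Borel
  measurability on the whole space, so Tonelli and the change of variables for \<open>lborel\<close>
  apply to Bergman functions directly.\<close>

lemma borel_extension:
  fixes f :: "complex ^ 'n \<Rightarrow> complex"
  assumes "open \<Omega>" "mholomorphic_on f \<Omega>" "\<And>z. z \<notin> \<Omega> \<Longrightarrow> f z = 0"
  shows "f \<in> borel_measurable borel"
proof -
  have "(\<lambda>z. indicat_real \<Omega> z *\<^sub>R f z) \<in> borel_measurable borel"
    using assms by (intro borel_measurable_continuous_on_indicator mholomorphic_on_continuous_on) auto
  moreover have "(\<lambda>z. indicat_real \<Omega> z *\<^sub>R f z) = f"
    using assms(3) by (auto simp: fun_eq_iff indicator_def)
  ultimately show ?thesis by simp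
qed

lemma bergman_borel: "f \<in> bergman \<Omega> \<Longrightarrow> open \<Omega> \<Longrightarrow> f \<in> borel_measurable borel"
  using borel_extension bergman_mholomorphic bergman_off by metis

lemma bergman_zero [simp]: "(\<lambda>z. 0) \<in> bergman \<Omega>"
  by (simp add: bergman_def mholomorphic_on_const)

lemma bergman_add: "f \<in> bergman \<Omega> \<Longrightarrow> g \<in> bergman \<Omega> \<Longrightarrow> (\<lambda>z. f z + g z) \<in> bergman \<Omega>"
  by (simp add: bergman_def mholomorphic_on_add L2_add)

lemma bergman_cmult: "f \<in> bergman \<Omega> \<Longrightarrow> (\<lambda>z. c * f z) \<in> bergman \<Omega>"
  by (simp add: bergman_def mholomorphic_on_cmult L2_cmult)

lemma bergman_diff: "f \<in> bergman \<Omega> \<Longrightarrow> g \<in> bergman \<Omega> \<Longrightarrow> (\<lambda>z. f z - g z) \<in> bergman \<Omega>"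
  by (simp add: bergman_def mholomorphic_on_diff L2_diff)

lemma bergman_mult:
  assumes "f \<in> bergman \<Omega>" "mholomorphic_on a \<Omega>" "\<And>z. z \<in> \<Omega> \<Longrightarrow> norm (a z) \<le> B" "open \<Omega>" "B \<ge> 0"
  shows "(\<lambda>z. a z * f z) \<in> bergman \<Omega>"
proof -
  have "continuous_on \<Omega> a" using assms mholomorphic_on_continuous_on by blast
  then have "a \<in> borel_measurable (lebesgue_on \<Omega>)"
    using assms(4) by (intro continuous_imp_measurable_on_sets_lebesgue) auto
  then have "(\<lambda>z. a z * f z) \<in> L2 \<Omega>"
    using assms L2_mult_bounded(1)[of f \<Omega> a B] by (auto simp: bergman_def)
  then show ?thesis using assms by (auto simp: bergman_def mholomorphic_on_mult)
qed

section \<open>Point evaluations and normal families in the Bergman space\<close>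

lemma I01_power2_bound:
  assumes g: "g \<in> borel_measurable borel" "integrable I01 (\<lambda>\<theta>. g \<theta> * k \<theta> :: complex)"
    and k: "\<And>\<theta>. norm (k \<theta>) \<le> B"
  shows "ennreal ((norm (LINT \<theta>|I01. g \<theta> * k \<theta>))\<^sup>2) \<le> ennreal (B\<^sup>2) * (\<integral>\<^sup>+\<theta>. ennreal ((norm (g \<theta>))\<^sup>2) \<partial>I01)"
proof -
  have [measurable]: "g \<in> borel_measurable I01" using g(1) by (rule borel_I01)
  have B: "B \<ge> 0" using k[of 0] norm_ge_zero order_trans by blast
  have "ennreal ((norm (LINT \<theta>|I01. g \<theta> * k \<theta>))\<^sup>2) = (ennreal (norm (LINT \<theta>|I01. g \<theta> * k \<theta>)))\<^sup>2"
    by (simp add: ennreal_power)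
  also have "\<dots> \<le> (\<integral>\<^sup>+\<theta>. ennreal (norm (g \<theta> * k \<theta>)) \<partial>I01)\<^sup>2"
    using g(2) by (intro power_mono integral_norm_bound_ennreal) auto
  also have "\<dots> \<le> (\<integral>\<^sup>+\<theta>. ennreal (norm (g \<theta>)) * ennreal B \<partial>I01)\<^sup>2"
    using k B by (intro power_mono nn_integral_mono) (auto simp: norm_mult ennreal_mult[symmetric] intro!: ennreal_leI mult_left_mono)
  also have "\<dots> \<le> (\<integral>\<^sup>+\<theta>. (ennreal (norm (g \<theta>)))\<^sup>2 \<partial>I01) * (\<integral>\<^sup>+\<theta>. (ennreal B)\<^sup>2 \<partial>I01)"
    by (rule Cauchy_Schwarz_nn_integral) measurable
  also have "\<dots> = ennreal (B\<^sup>2) * (\<integral>\<^sup>+\<theta>. ennreal ((norm (g \<theta>))\<^sup>2) \<partial>I01)"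
    unfolding nn_integral_const prob_I01 using B by (simp add: ennreal_power mult.commute)
  finally show ?thesis .
qed

text \<open>Subharmonicity of \<open>|f|^2\<close>: on every circle
  \<open>z0 + e1 \<theta> *s v\<close> the mean value property and Cauchy-Schwarz bound
  \<open>|f z0|^2\<close> by the circle average, and integrating over \<open>v\<close> in the ball
  replaces these averages by the volume integral.\<close>

lemma bergman_mean_bound:
  fixes f :: "complex ^ 'n \<Rightarrow> complex"
  assumes f: "f \<in> bergman \<Omega>" and "open \<Omega>" and sub: "ball z0 r \<subseteq> \<Omega>"
  shows "ennreal ((norm (f z0))\<^sup>2) * emeasure lborel (ball (0 :: complex ^ 'n) r) \<le> ennreal ((L2_norm \<Omega> f)\<^sup>2)"
proof -
  have [measurable]: "f \<in> borel_measurable borel" using f \<open>open \<Omega>\<close> bergman_borel by blast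
  have [measurable]: "\<Omega> \<in> sets borel" using \<open>open \<Omega>\<close> by simp
  have [measurable]: "ball (0 :: complex ^ 'n) r \<in> sets borel" by simp
  \<comment> \<open>The square of \<open>f\<close>, recentred at \<open>z0\<close> and cut off to a
    ball. The cut-off is invariant under \<open>v \<mapsto> e1 \<theta> *s v\<close>, as the
    rotation average requires.\<close>
  define G :: "complex ^ 'n \<Rightarrow> ennreal" where "G v = ennreal ((norm (f (z0 + v)))\<^sup>2) * indicator (ball 0 r) v" for v
  have [measurable]: "G \<in> borel_measurable borel" unfolding G_def by measurable
  have mean: "ennreal ((norm (f z0))\<^sup>2) * indicator (ball 0 r) v \<le> (\<integral>\<^sup>+\<theta>. G (e1 \<theta> *s v) \<partial>I01)" for v
  proof (cases "v \<in> ball 0 r")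
    case True
    have hol: "(\<lambda>\<zeta>. f (z0 + \<zeta> *s v)) holomorphic_on cball 0 1"
    proof (rule mholomorphic_on_line[OF bergman_mholomorphic[OF f]])
      fix \<zeta> :: complex assume "\<zeta> \<in> cball 0 1"
      then have "norm (\<zeta> *s v) \<le> norm v" by (simp add: norm_vector_smult mult_left_le_one_le)
      then have "z0 + \<zeta> *s v \<in> ball z0 r" using True by (simp add: dist_norm)
      then show "z0 + \<zeta> *s v \<in> \<Omega>" using sub by blast
    qed
    have me: "(LINT \<theta>|I01. f (z0 + e1 \<theta> *s v) * 1) = f z0"
      using circle_mean_Cauchy(1)[OF hol, of 0] by simp
    have "continuous_on {0..1} (\<lambda>\<theta>. f (z0 + e1 \<theta> *s v) * 1)"
      using circle_mean_Cauchy(2)[OF hol, of 0] by simp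
    then have int: "integrable I01 (\<lambda>\<theta>. f (z0 + e1 \<theta> *s v) * 1)"
      by (rule integral_I01(1))
    have [measurable]: "(\<lambda>\<theta>. z0 + e1 \<theta> *s v) \<in> borel_measurable borel"
      unfolding vector_scalar_mult_def by (intro borel_measurable_continuous_onI continuous_intros continuous_on_vec_lambda)
    have "ennreal ((norm (LINT \<theta>|I01. f (z0 + e1 \<theta> *s v) * 1))\<^sup>2) \<le> ennreal (1\<^sup>2) * (\<integral>\<^sup>+\<theta>. ennreal ((norm (f (z0 + e1 \<theta> *s v)))\<^sup>2) \<partial>I01)"
      by (rule I01_power2_bound[OF _ int]) auto
    then have "ennreal ((norm (f z0))\<^sup>2) \<le> (\<integral>\<^sup>+\<theta>. ennreal ((norm (f (z0 + e1 \<theta> *s v)))\<^sup>2) \<partial>I01)"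
      unfolding me by simp
    then show ?thesis using True by (simp add: G_def norm_vector_smult)
  qed simp
  have R: "(\<lambda>x. e1 (fst x) *s (snd x :: complex ^ 'n)) \<in> borel_measurable (borel \<Otimes>\<^sub>M borel)"
    unfolding borel_prod vector_scalar_mult_def
    by (intro borel_measurable_continuous_onI continuous_on_vec_lambda continuous_intros continuous_on_compose2[OF continuous_e1]) auto
  have "ennreal ((norm (f z0))\<^sup>2) * emeasure lborel (ball (0 :: complex ^ 'n) r) = (\<integral>\<^sup>+v. ennreal ((norm (f z0))\<^sup>2) * indicator (ball (0 :: complex ^ 'n) r) v \<partial>lborel)"
    by (simp add: nn_integral_cmult)
  also have "\<dots> \<le> (\<integral>\<^sup>+v. \<integral>\<^sup>+\<theta>. G (e1 \<theta> *s v) \<partial>I01 \<partial>lborel)"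
    by (intro nn_integral_mono mean)
  also have "\<dots> = (\<integral>\<^sup>+v. G v \<partial>lborel)"
    by (rule nn_integral_rotation_mean[OF orthogonal_transformation_smult R]) auto
  also have "\<dots> = (\<integral>\<^sup>+v. G (- z0 + v) \<partial>lborel)"
  proof -
    have "(\<integral>\<^sup>+x. G x \<partial>lborel) = (\<integral>\<^sup>+x. G x \<partial>distr lborel borel ((+) (- z0)))"
      by (simp only: lborel_distr_plus)
    also have "\<dots> = (\<integral>\<^sup>+x. G (- z0 + x) \<partial>lborel)"
      by (rule nn_integral_distr) auto
    finally show ?thesis .
  qed
  also have "\<dots> \<le> (\<integral>\<^sup>+z. ennreal ((norm (f z))\<^sup>2) * indicator \<Omega> z \<partial>lborel)"
  proof (rule nn_integral_mono)
    fix z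
    have "z \<in> ball z0 r" if "- z0 + z \<in> ball 0 r" using that by (simp add: dist_norm norm_minus_commute)
    then show "G (- z0 + z) \<le> ennreal ((norm (f z))\<^sup>2) * indicator \<Omega> z"
      using sub by (auto simp: G_def indicator_def)
  qed
  also have "\<dots> = ennreal ((L2_norm \<Omega> f)\<^sup>2)"
    unfolding L2_norm_nn[OF bergman_L2[OF f]] by (subst nn_integral_lebesgue_on_borel) auto
  finally show ?thesis .
qed

text \<open>A ball of one fixed radius about every point of \<open>K\<close> lies in
  \<open>\<Omega>\<close>. The constant is the inverse square root of its volume.\<close>

lemma bergman_compact_bound:
  fixes \<Omega> :: "(complex ^ 'n) set"
  assumes "open \<Omega>" "compact K" "K \<subseteq> \<Omega>"
  obtains C where "C \<ge> 0" "\<And>f z. f \<in> bergman \<Omega> \<Longrightarrow> z \<in> K \<Longrightarrow> norm (f z) \<le> C * L2_norm \<Omega> f"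
proof (cases "K = {}")
  case False
  obtain r where r: "r > 0" "{x. infdist x K \<le> r} \<subseteq> \<Omega>"
    using compact_in_open_separated[OF False assms(2,1,3)] by metis
  have sub: "ball z r \<subseteq> \<Omega>" if "z \<in> K" for z
  proof
    fix x assume "x \<in> ball z r"
    then have "infdist x K \<le> r" using infdist_le[OF that, of x] by (simp add: dist_commute)
    then show "x \<in> \<Omega>" using r by blast
  qed
  define c where "c = measure lborel (ball (0 :: complex ^ 'n) r)"
  have c: "c > 0" "emeasure lborel (ball (0 :: complex ^ 'n) r) = ennreal c"
  proof -
    show "c > 0" unfolding c_def using r by (simp add: content_ball_pos)
    show "emeasure lborel (ball (0 :: complex ^ 'n) r) = ennreal c"
      unfolding c_def by (rule emeasure_eq_ennreal_measure) (use emeasure_lborel_ball_finite[of "0 :: complex ^ 'n" r] in \<open>simp add: less_top\<close>)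
  qed
  have "norm (f z) \<le> (1 / sqrt c) * L2_norm \<Omega> f" if f: "f \<in> bergman \<Omega>" and z: "z \<in> K" for f z
  proof (rule power2_le_imp_le)
    have "ennreal ((norm (f z))\<^sup>2) * ennreal c \<le> ennreal ((L2_norm \<Omega> f)\<^sup>2)"
      using bergman_mean_bound[OF f \<open>open \<Omega>\<close> sub[OF z]] c by simp
    then have "(norm (f z))\<^sup>2 * c \<le> (L2_norm \<Omega> f)\<^sup>2"
      using c by (simp add: ennreal_mult[symmetric] ennreal_le_iff)
    then show "(norm (f z))\<^sup>2 \<le> ((1 / sqrt c) * L2_norm \<Omega> f)\<^sup>2"
      using c by (simp add: power_mult_distrib power_divide pos_le_divide_eq)
    show "0 \<le> 1 / sqrt c * L2_norm \<Omega> f" using c by simp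
  qed
  then show thesis using that[of "1 / sqrt c"] c by simp
qed (use that[of 0] in auto)

text \<open>Point values are controlled by the norm and values off \<open>\<Omega>\<close> are zero
  by normalisation, so the equality holds everywhere and not only almost everywhere.\<close>

lemma bergman_norm_0:
  assumes "open \<Omega>" "f \<in> bergman \<Omega>" "L2_norm \<Omega> f = 0"
  shows "f = (\<lambda>z. 0)"
proof
  fix z show "f z = 0"
  proof (cases "z \<in> \<Omega>")
    case True
    then have "compact {z}" "{z} \<subseteq> \<Omega>" by auto
    obtain C where "C \<ge> 0"
      and C: "\<And>f w. f \<in> bergman \<Omega> \<Longrightarrow> w \<in> {z} \<Longrightarrow> norm (f w) \<le> C * L2_norm \<Omega> f"
      by (rule bergman_compact_bound[OF assms(1) \<open>compact {z}\<close> \<open>{z} \<subseteq> \<Omega>\<close>]) (rule that)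
    then show ?thesis using C[OF assms(2), of z] assms(3) by simp
  qed (use assms bergman_off in auto)
qed

text \<open>Fatou's lemma for \<open>|u k|^2\<close>. Combined with Montel it takes the place of
  weak compactness when limits of bounded sequences are formed.\<close>

lemma L2_Fatou:
  assumes u: "\<And>k. u k \<in> L2 \<Omega>" "\<And>k. L2_norm \<Omega> (u k) \<le> c" and "c \<ge> 0"
    and lim: "\<And>z. z \<in> \<Omega> \<Longrightarrow> (\<lambda>k. u k z) \<longlonglongrightarrow> v z"
  shows "v \<in> L2 \<Omega>" "L2_norm \<Omega> v \<le> c"
proof -
  have [measurable]: "u k \<in> borel_measurable (lebesgue_on \<Omega>)" for k using u L2_measurable by blast
  have v: "v \<in> borel_measurable (lebesgue_on \<Omega>)"
    by (rule borel_measurable_LIMSEQ_metric[of u]) (use lim in auto)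
  have "(\<integral>\<^sup>+z. ennreal ((norm (v z))\<^sup>2) \<partial>lebesgue_on \<Omega>) = (\<integral>\<^sup>+z. liminf (\<lambda>k. ennreal ((norm (u k z))\<^sup>2)) \<partial>lebesgue_on \<Omega>)"
  proof (rule nn_integral_cong)
    fix z assume "z \<in> space (lebesgue_on \<Omega>)"
    then have "(\<lambda>k. ennreal ((norm (u k z))\<^sup>2)) \<longlonglongrightarrow> ennreal ((norm (v z))\<^sup>2)"
      using lim by (intro tendsto_intros tendsto_ennrealI) auto
    then show "ennreal ((norm (v z))\<^sup>2) = liminf (\<lambda>k. ennreal ((norm (u k z))\<^sup>2))"
      by (rule lim_imp_Liminf[symmetric, rotated]) simp
  qed
  also have "\<dots> \<le> liminf (\<lambda>k. \<integral>\<^sup>+z. ennreal ((norm (u k z))\<^sup>2) \<partial>lebesgue_on \<Omega>)"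
    by (rule nn_integral_liminf) measurable
  also have "\<dots> \<le> ennreal (c\<^sup>2)"
  proof (rule order_trans[OF Liminf_mono])
    show "\<forall>\<^sub>F k in sequentially. (\<integral>\<^sup>+z. ennreal ((norm (u k z))\<^sup>2) \<partial>lebesgue_on \<Omega>) \<le> ennreal (c\<^sup>2)"
      using u by (auto simp: L2_norm_nn[symmetric] intro!: always_eventually ennreal_leI power_mono)
  qed (simp add: Liminf_const)
  finally have *: "(\<integral>\<^sup>+z. ennreal ((norm (v z))\<^sup>2) \<partial>lebesgue_on \<Omega>) \<le> ennreal (c\<^sup>2)" .
  then show "v \<in> L2 \<Omega>" unfolding L2_iff using v ennreal_less_top le_less_trans by fastforce
  then show "L2_norm \<Omega> v \<le> c" using L2_norm_le_nn * \<open>c \<ge> 0\<close> by blast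
qed

text \<open>Point evaluations make a norm-bounded sequence locally bounded, so Montel applies, and
  Fatou keeps the limit in the space with the same norm bound.\<close>

lemma bergman_Montel:
  fixes \<Omega> :: "(complex ^ 'n) set"
  assumes "open \<Omega>" and F: "\<And>k. F k \<in> bergman \<Omega>" "\<And>k. L2_norm \<Omega> (F k) \<le> B"
  obtains r g where "strict_mono (r :: nat \<Rightarrow> nat)" "g \<in> bergman \<Omega>" "L2_norm \<Omega> g \<le> B"
    "\<And>K. compact K \<Longrightarrow> K \<subseteq> \<Omega> \<Longrightarrow> uniform_limit K (\<lambda>k. F (r k)) g sequentially"
proof -
  have B: "B \<ge> 0" using F(2)[of 0] L2_norm_nonneg order_trans by blast
  obtain r g where r: "strict_mono (r :: nat \<Rightarrow> nat)" and g: "mholomorphic_on g \<Omega>"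
    and ul: "\<And>K. compact K \<Longrightarrow> K \<subseteq> \<Omega> \<Longrightarrow> uniform_limit K (\<lambda>k. F (r k)) g sequentially"
  proof (rule mholomorphic_Montel[OF \<open>open \<Omega>\<close>, of F])
    show "mholomorphic_on (F k) \<Omega>" for k using F bergman_mholomorphic by blast
    show "\<exists>B. \<forall>k. \<forall>z\<in>K. norm (F k z) \<le> B" if "compact K" "K \<subseteq> \<Omega>" for K
    proof -
      obtain C where C: "C \<ge> 0" "\<And>f z. f \<in> bergman \<Omega> \<Longrightarrow> z \<in> K \<Longrightarrow> norm (f z) \<le> C * L2_norm \<Omega> f"
        using bergman_compact_bound[OF \<open>open \<Omega>\<close> \<open>compact K\<close> \<open>K \<subseteq> \<Omega>\<close>] by metis
      then have "norm (F k z) \<le> C * B" if "z \<in> K" for k z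
        using F that by (meson mult_left_mono order_trans)
      then show ?thesis by blast
    qed
  qed blast
  \<comment> \<open>Montel determines the limit on \<open>\<Omega>\<close>. It is reset to 0
    elsewhere to obtain the normalised representative.\<close>
  define h where "h z = (if z \<in> \<Omega> then g z else 0)" for z
  have hol: "mholomorphic_on h \<Omega>"
    by (rule mholomorphic_on_cong[OF \<open>open \<Omega>\<close> _ g]) (simp add: h_def)
  have ulh: "uniform_limit K (\<lambda>k. F (r k)) h sequentially" if "compact K" "K \<subseteq> \<Omega>" for K
    using ul[OF that] that unfolding uniform_limit_iff h_def by (simp add: subset_iff cong: ball_cong)
  have lim: "(\<lambda>k. F (r k) z) \<longlonglongrightarrow> h z" if "z \<in> \<Omega>" for z
    using tendsto_uniform_limitI[OF ulh[of "{z}"]] that by auto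
  have "h \<in> L2 \<Omega>" "L2_norm \<Omega> h \<le> B"
    using L2_Fatou[of "\<lambda>k. F (r k)" \<Omega> B h] F bergman_L2 B lim by blast+
  moreover have "h \<in> bergman \<Omega>"
    using \<open>h \<in> L2 \<Omega>\<close> hol by (simp add: bergman_def h_def)
  ultimately show thesis using that r ulh by blast
qed

text \<open>The direct method: a minimising sequence for the distance from \<open>f\<close> to the
  Bergman space is bounded, a subsequence converges locally uniformly, and lower semicontinuity of
  the norm makes the limit a minimiser. Minimality forces orthogonality.\<close>

lemma bergman_proj_exists:
  fixes \<Omega> :: "(complex ^ 'n) set"
  assumes "open \<Omega>" and f: "f \<in> L2 \<Omega>"
  shows "\<exists>h. h \<in> bergman \<Omega> \<and> (\<lambda>z. f z - h z) \<in> bergman_perp \<Omega>"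
proof -
  define N where "N h = L2_norm \<Omega> (\<lambda>z. f z - h z)" for h
  define d where "d = Inf (N ` bergman \<Omega>)"
  have ne: "N ` bergman \<Omega> \<noteq> {}" using bergman_zero by blast
  have bdd: "bdd_below (N ` bergman \<Omega>)" by (rule bdd_belowI[of _ 0]) (auto simp: N_def)
  have dle: "d \<le> N h" if "h \<in> bergman \<Omega>" for h
    unfolding d_def using that bdd by (intro cInf_lower) auto
  have d0: "d \<ge> 0" unfolding d_def using ne by (intro cInf_greatest) (auto simp: N_def)
  have "\<exists>h\<in>bergman \<Omega>. N h < d + 1 / real (Suc k)" for k
    using cInf_lessD[OF ne, of "d + 1 / real (Suc k)"] unfolding d_def by auto
  then obtain H where H: "\<And>k. H k \<in> bergman \<Omega>" "\<And>k. N (H k) < d + 1 / real (Suc k)" by metis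
  have bound: "L2_norm \<Omega> (H k) \<le> L2_norm \<Omega> f + (d + 1)" for k
  proof -
    have "L2_norm \<Omega> (\<lambda>z. f z - (f z - H k z)) \<le> L2_norm \<Omega> f + N (H k)"
      unfolding N_def by (intro L2_triangle_diff L2_diff f bergman_L2 H)
    then have "L2_norm \<Omega> (H k) \<le> L2_norm \<Omega> f + N (H k)" by simp
    moreover have "1 / real (Suc k) \<le> 1" by simp
    ultimately show ?thesis using H(2)[of k] by linarith
  qed
  obtain r h where r: "strict_mono r" and h: "h \<in> bergman \<Omega>"
    and ul: "\<And>K. compact K \<Longrightarrow> K \<subseteq> \<Omega> \<Longrightarrow> uniform_limit K (\<lambda>k. H (r k)) h sequentially"
    by (rule bergman_Montel[where F = H, OF \<open>open \<Omega>\<close> H(1) bound]) blast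
  have lim: "(\<lambda>k. H (r k) z) \<longlonglongrightarrow> h z" if "z \<in> \<Omega>" for z
    using tendsto_uniform_limitI[OF ul[of "{z}"]] that by auto
  \<comment> \<open>Fatou is applied to a tail of the subsequence, on which all distances are
    already at most \<open>d + e\<close>.\<close>
  have "N h \<le> d + e" if e: "e > 0" for e
  proof -
    obtain m where m: "1 / real (Suc m) < e" using nat_approx_posE[OF e] by blast
    have "N (H (r (k + m))) \<le> d + e" for k
    proof -
      have "m \<le> r (k + m)" using seq_suble[OF r, of "k + m"] by linarith
      then have "1 / real (Suc (r (k + m))) \<le> 1 / real (Suc m)" by (simp add: field_simps)
      then show ?thesis using H(2)[of "r (k + m)"] m by linarith
    qed
    moreover have "(\<lambda>k. f z - H (r (k + m)) z) \<longlonglongrightarrow> f z - h z" if "z \<in> \<Omega>" for z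
      using LIMSEQ_ignore_initial_segment[OF lim[OF that], of m] by (intro tendsto_intros)
    ultimately show ?thesis
      using L2_Fatou(2)[of "\<lambda>k z. f z - H (r (k + m)) z" \<Omega> "d + e" "\<lambda>z. f z - h z"] f H(1) d0 e
      by (simp add: N_def L2_diff bergman_L2)
  qed
  then have Nh: "N h = d" using dle[OF h] by (meson field_le_epsilon order_antisym)
  define u where "u z = f z - h z" for z
  have u: "u \<in> L2 \<Omega>" unfolding u_def by (rule L2_diff[OF f bergman_L2[OF h]])
  have "L2_inner \<Omega> g u = 0" if g: "g \<in> bergman \<Omega>" for g
  proof -
    define a where "a = L2_inner \<Omega> u g"
    \<comment> \<open>The competitor \<open>h + s * a * g\<close> changes the squared distance by
      \<open>s * |a|^2 * (s * ||g||^2 - 2)\<close>. The choice of \<open>s\<close> makes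
      \<open>s * ||g||^2 < 1\<close>, so this is negative unless \<open>a = 0\<close>.\<close>
    define s where "s = 1 / ((L2_norm \<Omega> g)\<^sup>2 + 1)"
    have s: "s > 0" "s * (L2_norm \<Omega> g)\<^sup>2 < 1"
      by (auto simp: s_def field_simps add_nonneg_pos add_pos_nonneg)
    have g2: "g \<in> L2 \<Omega>" using g bergman_L2 by blast
    define c where "c = - (of_real s * a)"
    have Nu: "L2_norm \<Omega> u = d" using Nh by (simp add: N_def u_def[abs_def])
    have "d\<^sup>2 \<le> (L2_norm \<Omega> (\<lambda>z. u z + c * g z))\<^sup>2"
    proof (rule power_mono[OF _ d0])
      have "d \<le> N (\<lambda>z. h z + (of_real s * a) * g z)"
        by (intro dle bergman_add bergman_cmult h g)
      also have "\<dots> = L2_norm \<Omega> (\<lambda>z. u z + c * g z)"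
        unfolding N_def u_def c_def by (simp add: algebra_simps)
      finally show "d \<le> L2_norm \<Omega> (\<lambda>z. u z + c * g z)" .
    qed
    also have "\<dots> = d\<^sup>2 + 2 * Re (cnj c * a) + (norm c * L2_norm \<Omega> g)\<^sup>2"
      unfolding L2_norm_add_power2[OF u L2_cmult[OF g2, of c]] Nu L2_inner_cmult_right a_def[symmetric] L2_norm_cmult ..
    also have "Re (cnj c * a) = - s * (norm a)\<^sup>2"
      unfolding cmod_power2 by (simp add: c_def algebra_simps power2_eq_square)
    also have "(norm c * L2_norm \<Omega> g)\<^sup>2 = s * (norm a)\<^sup>2 * (s * (L2_norm \<Omega> g)\<^sup>2)"
      using s by (simp add: c_def norm_mult power_mult_distrib power2_eq_square)
    finally have "2 * (s * (norm a)\<^sup>2) \<le> s * (norm a)\<^sup>2 * (s * (L2_norm \<Omega> g)\<^sup>2)" by simp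
    also have "\<dots> \<le> s * (norm a)\<^sup>2 * 1"
      using s by (intro mult_left_mono) auto
    finally have "a = 0" using s by (auto simp: mult_le_0_iff zero_less_mult_iff not_less)
    then show ?thesis using L2_inner_commute[of \<Omega> g u] by (simp add: a_def)
  qed
  then show ?thesis using h u unfolding bergman_perp_def u_def by auto
qed

text \<open>The difference of two candidates lies both in the Bergman space and in its orthogonal
  complement. This evaluates the definite description in \<open>bergman_proj\<close>.\<close>

lemma bergman_proj_unique:
  fixes \<Omega> :: "(complex ^ 'n) set"
  assumes "open \<Omega>" "f \<in> L2 \<Omega>" "h \<in> bergman \<Omega>" "(\<lambda>z. f z - h z) \<in> bergman_perp \<Omega>"
  shows "bergman_proj \<Omega> f = h"
  unfolding bergman_proj_def
proof (rule the_equality)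
  show "h \<in> bergman \<Omega> \<and> (\<lambda>z. f z - h z) \<in> bergman_perp \<Omega>" using assms by simp
  fix k assume k: "k \<in> bergman \<Omega> \<and> (\<lambda>z. f z - k z) \<in> bergman_perp \<Omega>"
  define w where "w z = h z - k z" for z
  have w: "w \<in> bergman \<Omega>" unfolding w_def using assms k by (intro bergman_diff) auto
  have "L2_inner \<Omega> w (\<lambda>z. (f z - k z) - (f z - h z)) = L2_inner \<Omega> w (\<lambda>z. f z - k z) - L2_inner \<Omega> w (\<lambda>z. f z - h z)"
    using assms k w by (intro L2_inner_diff_right) (auto simp: bergman_perp_def bergman_def)
  also have "\<dots> = 0" using assms k w by (auto simp: bergman_perp_def)
  also have "(\<lambda>z. (f z - k z) - (f z - h z)) = w" by (auto simp: w_def)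
  finally have "L2_norm \<Omega> w = 0" by (simp add: L2_inner_self)
  then have "w = (\<lambda>z. 0)" using bergman_norm_0 assms(1) w by blast
  then have "h z = k z" for z using fun_cong[of w "\<lambda>z. 0" z] unfolding w_def by simp
  then show "k = h" by (simp add: fun_eq_iff)
qed

section \<open>Linearity, orthogonality and norm bounds of the projection\<close>

context
  fixes \<Omega> :: "(complex ^ 'n) set"
  assumes \<Omega>: "open \<Omega>"
begin

lemma bergman_proj_in: "f \<in> L2 \<Omega> \<Longrightarrow> bergman_proj \<Omega> f \<in> bergman \<Omega>"
  and bergman_proj_perp: "f \<in> L2 \<Omega> \<Longrightarrow> (\<lambda>z. f z - bergman_proj \<Omega> f z) \<in> bergman_perp \<Omega>"
  using bergman_proj_exists[OF \<Omega>, of f] bergman_proj_unique[OF \<Omega>, of f] by auto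

lemma bergman_proj_L2: "f \<in> L2 \<Omega> \<Longrightarrow> bergman_proj \<Omega> f \<in> L2 \<Omega>"
  by (rule bergman_L2[OF bergman_proj_in])

lemma bergman_perp_L2: "u \<in> bergman_perp \<Omega> \<Longrightarrow> u \<in> L2 \<Omega>"
  by (simp add: bergman_perp_def)

lemma bergman_perp_inner: "u \<in> bergman_perp \<Omega> \<Longrightarrow> g \<in> bergman \<Omega> \<Longrightarrow> L2_inner \<Omega> g u = 0"
  by (simp add: bergman_perp_def)

lemma bergman_perp_inner': "u \<in> bergman_perp \<Omega> \<Longrightarrow> g \<in> bergman \<Omega> \<Longrightarrow> L2_inner \<Omega> u g = 0"
  by (subst L2_inner_commute) (simp add: bergman_perp_inner)

lemma bergman_perp_lincomb:
  assumes "u \<in> bergman_perp \<Omega>" "v \<in> bergman_perp \<Omega>"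
  shows "(\<lambda>z. a * u z + b * v z) \<in> bergman_perp \<Omega>"
proof -
  have "(\<lambda>z. a * u z + b * v z) \<in> L2 \<Omega>"
    using assms by (intro L2_add L2_cmult bergman_perp_L2)
  moreover have "L2_inner \<Omega> g (\<lambda>z. a * u z + b * v z) = 0" if "g \<in> bergman \<Omega>" for g
    using assms that by (simp add: L2_inner_add_right L2_cmult bergman_perp_L2 bergman_L2 L2_inner_cmult_right bergman_perp_inner)
  ultimately show ?thesis by (simp add: bergman_perp_def)
qed

lemma bergman_proj_lincomb:
  assumes f: "f \<in> L2 \<Omega>" and g: "g \<in> L2 \<Omega>"
  shows "bergman_proj \<Omega> (\<lambda>z. a * f z + b * g z) = (\<lambda>z. a * bergman_proj \<Omega> f z + b * bergman_proj \<Omega> g z)"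
proof (rule bergman_proj_unique[OF \<Omega>])
  show "(\<lambda>z. a * f z + b * g z) \<in> L2 \<Omega>" using f g by (intro L2_add L2_cmult)
  show "(\<lambda>z. a * bergman_proj \<Omega> f z + b * bergman_proj \<Omega> g z) \<in> bergman \<Omega>"
    using f g by (intro bergman_add bergman_cmult bergman_proj_in)
  have "(\<lambda>z. a * (f z - bergman_proj \<Omega> f z) + b * (g z - bergman_proj \<Omega> g z)) \<in> bergman_perp \<Omega>"
    using f g by (intro bergman_perp_lincomb bergman_proj_perp)
  then show "(\<lambda>z. a * f z + b * g z - (a * bergman_proj \<Omega> f z + b * bergman_proj \<Omega> g z)) \<in> bergman_perp \<Omega>"
    by (simp add: algebra_simps)
qed

lemma bergman_proj_add:
  "f \<in> L2 \<Omega> \<Longrightarrow> g \<in> L2 \<Omega> \<Longrightarrow> bergman_proj \<Omega> (\<lambda>z. f z + g z) = (\<lambda>z. bergman_proj \<Omega> f z + bergman_proj \<Omega> g z)"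
  using bergman_proj_lincomb[of f g 1 1] by simp

lemma bergman_proj_diff:
  "f \<in> L2 \<Omega> \<Longrightarrow> g \<in> L2 \<Omega> \<Longrightarrow> bergman_proj \<Omega> (\<lambda>z. f z - g z) = (\<lambda>z. bergman_proj \<Omega> f z - bergman_proj \<Omega> g z)"
  using bergman_proj_lincomb[of f g 1 "-1"] by simp

lemma bergman_proj_cmult:
  "f \<in> L2 \<Omega> \<Longrightarrow> bergman_proj \<Omega> (\<lambda>z. c * f z) = (\<lambda>z. c * bergman_proj \<Omega> f z)"
  using bergman_proj_lincomb[of f "\<lambda>_. 0" c 0] by simp

lemma bergman_perp_zero: "(\<lambda>z. 0) \<in> bergman_perp \<Omega>"
  by (simp add: bergman_perp_def L2_inner_def)

lemma bergman_proj_id: "f \<in> bergman \<Omega> \<Longrightarrow> bergman_proj \<Omega> f = f"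
  by (rule bergman_proj_unique[OF \<Omega>]) (auto simp: bergman_perp_zero bergman_L2)

lemma bergman_proj_of_perp: "f \<in> bergman_perp \<Omega> \<Longrightarrow> bergman_proj \<Omega> f = (\<lambda>z. 0)"
  by (rule bergman_proj_unique[OF \<Omega>]) (auto simp: bergman_perp_L2)

lemma bergman_proj_sum:
  "finite A \<Longrightarrow> (\<And>a. a \<in> A \<Longrightarrow> f a \<in> L2 \<Omega>) \<Longrightarrow>
    bergman_proj \<Omega> (\<lambda>z. \<Sum>a\<in>A. f a z) = (\<lambda>z. \<Sum>a\<in>A. bergman_proj \<Omega> (f a) z)"
proof (induction A rule: finite_induct)
  case empty
  show ?case by (simp add: bergman_proj_id)
next
  case (insert x F)
  then show ?case using bergman_proj_add[of "f x" "\<lambda>z. \<Sum>a\<in>F. f a z"] L2_sum[of F f \<Omega>] by simp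
qed

lemma bergman_proj_inner:
  assumes "f \<in> L2 \<Omega>" "g \<in> bergman \<Omega>"
  shows "L2_inner \<Omega> (bergman_proj \<Omega> f) g = L2_inner \<Omega> f g"
  using L2_inner_diff_left[of f \<Omega> "bergman_proj \<Omega> f" g] bergman_perp_inner'[OF bergman_proj_perp[OF assms(1)] assms(2)] assms
  by (simp add: bergman_proj_L2 bergman_L2)

lemma bergman_proj_norm_le:
  assumes "f \<in> L2 \<Omega>"
  shows "L2_norm \<Omega> (bergman_proj \<Omega> f) \<le> L2_norm \<Omega> f"
proof -
  let ?p = "bergman_proj \<Omega> f"
  have "of_real ((L2_norm \<Omega> ?p)\<^sup>2) = L2_inner \<Omega> f ?p"
    using bergman_proj_inner[OF assms bergman_proj_in[OF assms]] by (simp add: L2_inner_self)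
  then have "(L2_norm \<Omega> ?p)\<^sup>2 = norm (L2_inner \<Omega> f ?p)"
    by (metis norm_of_real abs_of_nonneg zero_le_power2)
  also have "\<dots> \<le> L2_norm \<Omega> f * L2_norm \<Omega> ?p"
    using assms by (intro L2_Cauchy_Schwarz bergman_proj_L2)
  finally show ?thesis
    by (metis L2_norm_nonneg mult_right_le_imp_le order_le_less power2_eq_square)
qed

text \<open>The error \<open>u\<close> is orthogonal to \<open>P f - q\<close>, so
  \<open>||u||^2\<close> equals the inner product of \<open>u\<close> with \<open>f - q\<close>, and
  Cauchy-Schwarz finishes. Hankel operators are estimated below by exhibiting a holomorphic
  competitor \<open>q\<close>.\<close>

lemma bergman_proj_compl_le:
  assumes f: "f \<in> L2 \<Omega>" and q: "q \<in> bergman \<Omega>"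
  shows "L2_norm \<Omega> (\<lambda>z. f z - bergman_proj \<Omega> f z) \<le> L2_norm \<Omega> (\<lambda>z. f z - q z)"
proof -
  define u where "u z = f z - bergman_proj \<Omega> f z" for z
  define v where "v z = f z - q z" for z
  have u: "u \<in> bergman_perp \<Omega>" unfolding u_def by (rule bergman_proj_perp[OF f])
  have v: "v \<in> L2 \<Omega>" unfolding v_def by (rule L2_diff[OF f bergman_L2[OF q]])
  define w where "w z = bergman_proj \<Omega> f z - q z" for z
  have w: "w \<in> bergman \<Omega>" unfolding w_def by (rule bergman_diff[OF bergman_proj_in[OF f] q])
  have "L2_inner \<Omega> u (\<lambda>z. u z + w z) = L2_inner \<Omega> u u + L2_inner \<Omega> u w"
    using u w by (intro L2_inner_add_right bergman_perp_L2 bergman_L2) auto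
  also have "L2_inner \<Omega> u w = 0" using u w by (rule bergman_perp_inner')
  also have "(\<lambda>z. u z + w z) = v" by (auto simp: u_def v_def w_def)
  finally have "of_real ((L2_norm \<Omega> u)\<^sup>2) = L2_inner \<Omega> u v" by (simp add: L2_inner_self)
  then have "(L2_norm \<Omega> u)\<^sup>2 = norm (L2_inner \<Omega> u v)"
    by (metis norm_of_real abs_of_nonneg zero_le_power2)
  also have "\<dots> \<le> L2_norm \<Omega> v * L2_norm \<Omega> u"
    using L2_Cauchy_Schwarz[OF bergman_perp_L2[OF u] v] by (simp add: mult.commute)
  finally have "L2_norm \<Omega> u \<le> L2_norm \<Omega> v"
    by (metis L2_norm_nonneg mult_right_le_imp_le order_le_less power2_eq_square)
  then show ?thesis by (simp add: u_def[abs_def] v_def[abs_def])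
qed

lemma bergman_proj_compl_norm_le:
  "f \<in> L2 \<Omega> \<Longrightarrow> L2_norm \<Omega> (\<lambda>z. f z - bergman_proj \<Omega> f z) \<le> L2_norm \<Omega> f"
  using bergman_proj_compl_le[of f "\<lambda>z. 0"] by simp

text \<open>The adjoint form of the invariance of the Bergman space under bounded holomorphic
  multipliers: move \<open>cnj a\<close> to the other side of the inner product.\<close>

lemma bergman_perp_cnj_mult:
  assumes u: "u \<in> bergman_perp \<Omega>" and a: "mholomorphic_on a \<Omega>" "\<And>z. z \<in> \<Omega> \<Longrightarrow> norm (a z) \<le> B" "B \<ge> 0"
  shows "(\<lambda>z. cnj (a z) * u z) \<in> bergman_perp \<Omega>"
proof -
  have "a \<in> borel_measurable (lebesgue_on \<Omega>)"
    using \<Omega> mholomorphic_on_continuous_on[OF a(1)] by (intro continuous_imp_measurable_on_sets_lebesgue) auto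
  then have "(\<lambda>z. cnj (a z)) \<in> borel_measurable (lebesgue_on \<Omega>)" by (rule borel_measurable_cnj)
  then have "(\<lambda>z. cnj (a z) * u z) \<in> L2 \<Omega>"
    using a(2,3) by (intro L2_mult_bounded(1)[OF bergman_perp_L2[OF u], where B = B]) auto
  moreover have "L2_inner \<Omega> g (\<lambda>z. cnj (a z) * u z) = 0" if "g \<in> bergman \<Omega>" for g
  proof -
    have "L2_inner \<Omega> g (\<lambda>z. cnj (a z) * u z) = L2_inner \<Omega> (\<lambda>z. a z * g z) u"
      by (simp add: L2_inner_mult_left)
    also have "\<dots> = 0"
      using bergman_mult[OF that a(1) a(2) \<Omega> a(3)] u by (intro bergman_perp_inner) auto
    finally show ?thesis .
  qed
  ultimately show ?thesis by (simp add: bergman_perp_def)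
qed

end

lemma lborel_distr_isometry:
  fixes f :: "'a::euclidean_space \<Rightarrow> 'a"
  assumes f: "orthogonal_transformation f"
  shows "distr lborel borel f = lborel"
proof (rule measure_eqI)
  have [measurable]: "f \<in> borel_measurable borel"
    using orthogonal_transformation_linear[OF f]
    by (intro borel_measurable_continuous_onI linear_continuous_on) (simp add: linear_conv_bounded_linear)
  fix A assume "A \<in> sets (distr lborel borel f)"
  then have [measurable]: "A \<in> sets borel" by simp
  have "emeasure (distr lborel borel f) A = (\<integral>\<^sup>+x. indicator A x \<partial>distr lborel borel f)" by simp
  also have "\<dots> = (\<integral>\<^sup>+x. indicator A (f x) \<partial>lborel)" by (rule nn_integral_distr) measurable
  also have "\<dots> = (\<integral>\<^sup>+x. indicator A x \<partial>lborel)" by (rule nn_integral_lborel_isometry[OF f]) measurable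
  finally show "emeasure (distr lborel borel f) A = emeasure lborel A" by simp
qed simp

lemma integral_lebesgue_on_borel:
  fixes u :: "'a::euclidean_space \<Rightarrow> complex"
  assumes [measurable]: "u \<in> borel_measurable borel" "\<Omega> \<in> sets borel"
  shows "(LINT z|lebesgue_on \<Omega>. u z) = (LINT z|lborel. indicat_real \<Omega> z *\<^sub>R u z)"
proof -
  have "(LINT z|lebesgue_on \<Omega>. u z) = (LINT z|lebesgue. indicat_real \<Omega> z *\<^sub>R u z)"
    by (rule integral_restrict_space) auto
  also have "\<dots> = (LINT z|lborel. indicat_real \<Omega> z *\<^sub>R u z)"
    by (rule integral_completion) measurable
  finally show ?thesis .
qed

lemma integral_polydisk_sc:
  fixes u :: "complex ^ 'n \<Rightarrow> complex"
  assumes [measurable]: "u \<in> borel_measurable borel" and c: "norm c = 1"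
  shows "(LINT z|lebesgue_on polydisk. u (sc i c z)) = (LINT z|lebesgue_on polydisk. u z)"
proof -
  have [measurable]: "sc i c \<in> borel_measurable borel"
    by (intro borel_measurable_continuous_onI continuous_intros)
  have "(LINT z|lebesgue_on polydisk. u z) = (LINT z|distr lborel borel (sc i c). indicat_real polydisk z *\<^sub>R u z)"
    unfolding lborel_distr_isometry[OF orthogonal_transformation_sc[OF c]] by (rule integral_lebesgue_on_borel) auto
  also have "\<dots> = (LINT z|lborel. indicat_real polydisk (sc i c z) *\<^sub>R u (sc i c z))"
    by (rule integral_distr) measurable
  also have "\<dots> = (LINT z|lborel. indicat_real polydisk z *\<^sub>R u (sc i c z))"
    by (simp add: indicator_def sc_in_polydisk_iff[OF c])
  also have "\<dots> = (LINT z|lebesgue_on polydisk. u (sc i c z))"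
    by (rule integral_lebesgue_on_borel[symmetric]) auto
  finally show ?thesis ..
qed

section \<open>Dilations in one coordinate\<close>

text \<open>The Cauchy kernel on the unit circle parametrised by \<open>e1\<close>.\<close>

definition ck :: "real \<Rightarrow> real \<Rightarrow> complex" where
  "ck t \<theta> = e1 \<theta> / (e1 \<theta> - of_real t)"

lemma norm_ck: "0 \<le> t \<Longrightarrow> t < 1 \<Longrightarrow> norm (ck t \<theta>) \<le> 1 / (1 - t)"
proof -
  assume t: "0 \<le> t" "t < 1"
  have "1 - t \<le> norm (e1 \<theta> - of_real t)"
    using norm_triangle_ineq2[of "e1 \<theta>" "of_real t"] t by simp
  then show ?thesis using t by (simp add: ck_def norm_divide frac_le)
qed

lemma borel_ck [measurable]: "ck t \<in> borel_measurable borel"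
  unfolding ck_def by measurable

lemma ck_reflect: "ck t (1 - \<theta>) = cnj (ck t \<theta>)"
  by (simp add: ck_def e1_minus)

lemma I01_reflect: "(LINT \<theta>|I01. G (1 - \<theta>)) = (LINT \<theta>|I01. G \<theta>)" for G :: "real \<Rightarrow> complex"
proof -
  have "(LINT \<theta>|I01. G \<theta>) = (LINT \<theta>|lborel. indicat_real {0..1} \<theta> *\<^sub>R G \<theta>)"
    by (rule integral_restrict_space) auto
  also have "\<dots> = (LINT \<theta>|lborel. indicat_real {0..1} (1 - \<theta>) *\<^sub>R G (1 - \<theta>))"
    using lborel_integral_real_affine[of "-1" "\<lambda>\<theta>. indicat_real {0..1} \<theta> *\<^sub>R G \<theta>" 1] by simp
  also have "\<dots> = (LINT \<theta>|lborel. indicat_real {0..1} \<theta> *\<^sub>R G (1 - \<theta>))"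
    by (intro Bochner_Integration.integral_cong) (auto simp: indicator_def)
  also have "\<dots> = (LINT \<theta>|I01. G (1 - \<theta>))"
    by (rule integral_restrict_space[symmetric]) auto
  finally show ?thesis ..
qed

lemma sc_eq_line: "sc i c z = upd i 0 z + c *s axis i (z $ i)"
  by (simp add: vec_eq_iff axis_def)

text \<open>For fixed \<open>z\<close> the function
  \<open>\<zeta> \<mapsto> f (sc i \<zeta> z)\<close> is holomorphic on the closed unit disc. A
  contraction of one coordinate is thus an average of rotations of it.\<close>

lemma Cauchy_sc:
  fixes f :: "complex ^ 'n \<Rightarrow> complex"
  assumes f: "mholomorphic_on f polydisk" and z: "z \<in> polydisk" and t: "0 \<le> t" "t < 1"
  shows "(LINT \<theta>|I01. f (sc i (e1 \<theta>) z) * ck t \<theta>) = f (sc i (of_real t) z)"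
    and "integrable I01 (\<lambda>\<theta>. f (sc i (e1 \<theta>) z) * ck t \<theta>)"
proof -
  have "(\<lambda>\<zeta>. f (upd i 0 z + \<zeta> *s axis i (z $ i))) holomorphic_on cball 0 1"
  proof (rule mholomorphic_on_line[OF f])
    fix \<zeta> :: complex assume "\<zeta> \<in> cball 0 1"
    then show "upd i 0 z + \<zeta> *s axis i (z $ i) \<in> polydisk"
      using sc_in_polydisk[OF z, of \<zeta>] by (simp add: sc_eq_line[symmetric])
  qed
  then have hol: "(\<lambda>\<zeta>. f (sc i \<zeta> z)) holomorphic_on cball 0 1"
    by (simp add: sc_eq_line[symmetric])
  have t': "norm (of_real t :: complex) < 1" using t by simp
  show "(LINT \<theta>|I01. f (sc i (e1 \<theta>) z) * ck t \<theta>) = f (sc i (of_real t) z)"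
    unfolding ck_def using circle_mean_Cauchy(1)[OF hol t'] .
  show "integrable I01 (\<lambda>\<theta>. f (sc i (e1 \<theta>) z) * ck t \<theta>)"
    unfolding ck_def by (rule integral_I01(1)[OF circle_mean_Cauchy(2)[OF hol t']])
qed

lemma borel_sc_e1:
  "(\<lambda>x. sc i (e1 (fst x)) (snd x :: complex ^ 'n)) \<in> borel_measurable (borel \<Otimes>\<^sub>M borel)"
  unfolding borel_prod
  by (intro borel_measurable_continuous_onI continuous_intros continuous_on_compose2[OF continuous_e1]) auto

text \<open>A dilation averages rotations against a kernel of modulus at most
  \<open>1 / (1 - t)\<close>; Cauchy-Schwarz and rotation invariance of \<open>S\<close> give the
  bound. Although the dilation evaluates \<open>f\<close> at smaller \<open>|z_i|\<close>, only the
  mass of \<open>f\<close> on the same set \<open>S\<close> is needed, which makes estimates on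
  shells possible.\<close>

lemma nn_integral_dilation_bound:
  fixes f :: "complex ^ 'n \<Rightarrow> complex"
  assumes f: "mholomorphic_on f polydisk" and fb [measurable]: "f \<in> borel_measurable borel"
    and t: "0 \<le> t" "t < 1" and S [measurable]: "S \<in> sets borel" and "S \<subseteq> polydisk"
    and rot: "\<And>z c. norm c = 1 \<Longrightarrow> sc i c z \<in> S \<longleftrightarrow> z \<in> S"
  shows "(\<integral>\<^sup>+z. ennreal ((norm (f (sc i (of_real t) z)))\<^sup>2) * indicator S z \<partial>lborel)
    \<le> ennreal ((1 / (1 - t))\<^sup>2) * (\<integral>\<^sup>+z. ennreal ((norm (f z))\<^sup>2) * indicator S z \<partial>lborel)"
proof -
  define G :: "complex ^ 'n \<Rightarrow> ennreal" where "G z = ennreal ((norm (f z))\<^sup>2) * indicator S z" for z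
  have [measurable]: "G \<in> borel_measurable borel" unfolding G_def by measurable
  have pw: "ennreal ((norm (f (sc i (of_real t) z)))\<^sup>2) * indicator S z
      \<le> ennreal ((1 / (1 - t))\<^sup>2) * (\<integral>\<^sup>+\<theta>. G (sc i (e1 \<theta>) z) \<partial>I01)" for z
  proof (cases "z \<in> S")
    case True
    then have z: "z \<in> polydisk" using \<open>S \<subseteq> polydisk\<close> by blast
    have m: "(\<lambda>\<theta>. sc i (e1 \<theta>) z) \<in> borel_measurable borel"
      by (intro borel_measurable_continuous_onI continuous_intros)
    have "ennreal ((norm (LINT \<theta>|I01. f (sc i (e1 \<theta>) z) * ck t \<theta>))\<^sup>2)
        \<le> ennreal ((1 / (1 - t))\<^sup>2) * (\<integral>\<^sup>+\<theta>. ennreal ((norm (f (sc i (e1 \<theta>) z)))\<^sup>2) \<partial>I01)"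
      by (rule I01_power2_bound[OF measurable_compose[OF m fb] Cauchy_sc(2)[OF f z t] norm_ck[OF t]])
    then show ?thesis unfolding Cauchy_sc(1)[OF f z t] using True rot by (simp add: G_def)
  qed simp
  have "(\<integral>\<^sup>+z. ennreal ((norm (f (sc i (of_real t) z)))\<^sup>2) * indicator S z \<partial>lborel)
      \<le> (\<integral>\<^sup>+z. ennreal ((1 / (1 - t))\<^sup>2) * (\<integral>\<^sup>+\<theta>. G (sc i (e1 \<theta>) z) \<partial>I01) \<partial>lborel)"
    by (intro nn_integral_mono pw)
  also have "\<dots> = ennreal ((1 / (1 - t))\<^sup>2) * (\<integral>\<^sup>+z. (\<integral>\<^sup>+\<theta>. G (sc i (e1 \<theta>) z) \<partial>I01) \<partial>lborel)"
  proof (rule nn_integral_cmult)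
    interpret I: finite_measure I01 by (rule finite_I01)
    have "(\<lambda>x. x) \<in> measurable I01 borel" by (rule borel_I01) simp
    then have "(\<lambda>x. (snd x, fst x)) \<in> measurable ((lborel :: (complex ^ 'n) measure) \<Otimes>\<^sub>M I01) (borel \<Otimes>\<^sub>M borel)"
      by (intro measurable_Pair measurable_compose[OF measurable_snd] measurable_compose[OF measurable_fst]) auto
    from measurable_compose[OF measurable_compose[OF this borel_sc_e1] \<open>G \<in> borel_measurable borel\<close>]
    show "(\<lambda>z. \<integral>\<^sup>+\<theta>. G (sc i (e1 \<theta>) z) \<partial>I01) \<in> borel_measurable lborel"
      by (intro I.borel_measurable_nn_integral) (simp add: split_beta')
  qed
  also have "(\<integral>\<^sup>+z. (\<integral>\<^sup>+\<theta>. G (sc i (e1 \<theta>) z) \<partial>I01) \<partial>lborel) = (\<integral>\<^sup>+z. G z \<partial>lborel)"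
    by (rule nn_integral_rotation_mean[OF orthogonal_transformation_sc borel_sc_e1]) auto
  finally show ?thesis unfolding G_def .
qed

text \<open>Cut off outside the polydisk so that Bergman functions keep their normalised
  representative. The case \<open>t = 0\<close> is restriction to \<open>z_i = 0\<close>, extended
  constantly in \<open>z_i\<close>.\<close>

definition dil :: "'n \<Rightarrow> real \<Rightarrow> (complex ^ 'n \<Rightarrow> complex) \<Rightarrow> complex ^ 'n \<Rightarrow> complex" where
  "dil i t f z = (if z \<in> polydisk then f (sc i (of_real t) z) else 0)"

section \<open>Boundedness and self-adjointness of dilations\<close>

lemma L2_norm_nn_polydisk:
  fixes f :: "complex ^ 'n \<Rightarrow> complex"
  assumes "f \<in> L2 polydisk" "f \<in> borel_measurable borel"
  shows "ennreal ((L2_norm polydisk f)\<^sup>2) = (\<integral>\<^sup>+z. ennreal ((norm (f z))\<^sup>2) * indicator polydisk z \<partial>lborel)"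
  unfolding L2_norm_nn[OF assms(1)] using assms(2) by (subst nn_integral_lebesgue_on_borel) auto

lemma dil_mholomorphic:
  fixes f :: "complex ^ 'n \<Rightarrow> complex"
  assumes "mholomorphic_on f polydisk" "0 \<le> t" "t \<le> 1"
  shows "mholomorphic_on (dil i t f) polydisk"
  by (rule mholomorphic_on_cong[OF open_polydisk _ mholomorphic_sc[OF assms(1), of "of_real t" i]])
    (use assms in \<open>auto simp: dil_def\<close>)

lemma dil_bergman:
  fixes f :: "complex ^ 'n \<Rightarrow> complex"
  assumes f: "f \<in> bergman polydisk" and t: "0 \<le> t" "t < 1"
  shows "dil i t f \<in> bergman polydisk" "L2_norm polydisk (dil i t f) \<le> 1 / (1 - t) * L2_norm polydisk f"
proof -
  note fb = bergman_borel[OF f open_polydisk]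
  have hol: "mholomorphic_on (dil i t f) polydisk"
    using dil_mholomorphic[OF bergman_mholomorphic[OF f]] t by simp
  have b: "dil i t f \<in> borel_measurable borel"
    by (rule borel_extension[OF open_polydisk hol]) (simp add: dil_def)
  have "(\<integral>\<^sup>+z. ennreal ((norm (dil i t f z))\<^sup>2) \<partial>lebesgue_on polydisk)
      = (\<integral>\<^sup>+z. ennreal ((norm (dil i t f z))\<^sup>2) * indicator polydisk z \<partial>lborel)"
    using b by (intro nn_integral_lebesgue_on_borel) auto
  also have "\<dots> = (\<integral>\<^sup>+z. ennreal ((norm (f (sc i (of_real t) z)))\<^sup>2) * indicator polydisk z \<partial>lborel)"
    by (intro nn_integral_cong) (simp add: dil_def indicator_def)
  also have "\<dots> \<le> ennreal ((1 / (1 - t))\<^sup>2) * (\<integral>\<^sup>+z. ennreal ((norm (f z))\<^sup>2) * indicator polydisk z \<partial>lborel)"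
    by (rule nn_integral_dilation_bound[OF bergman_mholomorphic[OF f] fb t]) (auto simp: sc_in_polydisk_iff)
  also have "\<dots> = ennreal ((1 / (1 - t) * L2_norm polydisk f)\<^sup>2)"
    unfolding L2_norm_nn_polydisk[OF bergman_L2[OF f] fb, symmetric]
    by (simp add: ennreal_mult[symmetric] power_mult_distrib power_divide)
  finally have *: "(\<integral>\<^sup>+z. ennreal ((norm (dil i t f z))\<^sup>2) \<partial>lebesgue_on polydisk) \<le> ennreal ((1 / (1 - t) * L2_norm polydisk f)\<^sup>2)" .
  have "dil i t f \<in> L2 polydisk"
    unfolding L2_iff using borel_measurable_lebesgue_on[OF b] * ennreal_less_top le_less_trans by fastforce
  then show "dil i t f \<in> bergman polydisk" using hol by (simp add: bergman_def dil_def)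
  show "L2_norm polydisk (dil i t f) \<le> 1 / (1 - t) * L2_norm polydisk f"
    using L2_norm_le_nn[OF \<open>dil i t f \<in> L2 polydisk\<close> *] t by simp
qed

lemma dil_dil:
  assumes "0 \<le> t" "t \<le> 1"
  shows "dil i t (dil i s f) = dil i (t * s) f"
  using sc_in_polydisk[of _ "of_real t" i] assms by (auto simp: fun_eq_iff dil_def mult.commute)

lemma lmeasurable_polydisk: "(polydisk :: (complex ^ 'n) set) \<in> lmeasurable"
proof (rule lmeasurable_open)
  show "bounded (polydisk :: (complex ^ 'n) set)"
    by (rule bounded_subset[OF compact_imp_bounded[OF compact_closure_polydisk] closure_subset])
qed (rule open_polydisk)

text \<open>Fubini for the Cauchy representation. Absolute integrability follows because the kernel
  is bounded and rotations preserve the norm of \<open>f\<close>.\<close>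

lemma dil_inner_eq:
  fixes f g :: "complex ^ 'n \<Rightarrow> complex"
  assumes f: "f \<in> bergman polydisk" and g: "g \<in> bergman polydisk" and t: "0 \<le> t" "t < 1"
  shows "L2_inner polydisk (dil i t f) g
    = (LINT \<theta>|I01. ck t \<theta> * L2_inner polydisk (\<lambda>z. f (sc i (e1 \<theta>) z)) g)"
proof -
  let ?M = "lebesgue_on (polydisk :: (complex ^ 'n) set)"
  have fb [measurable]: "f \<in> borel_measurable borel" and gb [measurable]: "g \<in> borel_measurable borel"
    using f g bergman_borel open_polydisk by auto
  interpret I: finite_measure I01 by (rule finite_I01)
  interpret M: finite_measure ?M by (rule finite_measure_lebesgue_on[OF lmeasurable_polydisk])
  interpret pair_sigma_finite I01 ?M ..
  define F where "F \<theta> z = f (sc i (e1 \<theta>) z) * ck t \<theta> * cnj (g z)" for \<theta> z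
  have id1: "(\<lambda>x. x) \<in> measurable I01 borel" by (rule borel_I01) simp
  have id2: "(\<lambda>x. x) \<in> measurable ?M borel" by (rule borel_measurable_lebesgue_on) simp
  have fst': "fst \<in> measurable (I01 \<Otimes>\<^sub>M ?M) borel"
    by (rule measurable_compose[OF measurable_fst id1])
  have snd': "snd \<in> measurable (I01 \<Otimes>\<^sub>M ?M) borel"
    by (rule measurable_compose[OF measurable_snd id2])
  have prd: "(\<lambda>x. (fst x, snd x)) \<in> measurable (I01 \<Otimes>\<^sub>M ?M) (borel \<Otimes>\<^sub>M borel)"
    by (rule measurable_Pair[OF fst' snd'])
  have F_meas: "(\<lambda>(\<theta>, z). F \<theta> z) \<in> borel_measurable (I01 \<Otimes>\<^sub>M ?M)"
    unfolding F_def split_beta'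
    using measurable_compose[OF measurable_compose[OF prd borel_sc_e1] fb]
      measurable_compose[OF fst' borel_ck] borel_measurable_cnj[OF measurable_compose[OF snd' gb]]
    by (intro borel_measurable_times) simp_all
  have rotf: "(\<integral>\<^sup>+z. ennreal ((norm (f (sc i c z)))\<^sup>2) \<partial>?M) = ennreal ((L2_norm polydisk f)\<^sup>2)" if c: "norm c = 1" for c
  proof -
    have [measurable]: "sc i c \<in> borel_measurable borel"
      by (intro borel_measurable_continuous_onI continuous_intros)
    have "(\<integral>\<^sup>+z. ennreal ((norm (f (sc i c z)))\<^sup>2) \<partial>?M)
      = (\<integral>\<^sup>+z. ennreal ((norm (f (sc i c z)))\<^sup>2) * indicator polydisk (sc i c z) \<partial>lborel)"
      by (subst nn_integral_lebesgue_on_borel) (auto simp: indicator_def sc_in_polydisk_iff[OF c])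
    also have "\<dots> = (\<integral>\<^sup>+z. ennreal ((norm (f z))\<^sup>2) * indicator polydisk z \<partial>lborel)"
      by (rule nn_integral_lborel_isometry[OF orthogonal_transformation_sc[OF c]]) measurable
    finally show ?thesis using L2_norm_nn_polydisk[OF bergman_L2[OF f] fb] by simp
  qed
  have F_int: "integrable (I01 \<Otimes>\<^sub>M ?M) (\<lambda>(\<theta>, z). F \<theta> z)"
  proof (rule integrableI_bounded[OF F_meas])
    let ?C = "1 / (1 - t)"
    have "(\<integral>\<^sup>+x. ennreal (norm (case x of (\<theta>, z) \<Rightarrow> F \<theta> z)) \<partial>(I01 \<Otimes>\<^sub>M ?M))
      = (\<integral>\<^sup>+\<theta>. \<integral>\<^sup>+z. ennreal (norm (F \<theta> z)) \<partial>?M \<partial>I01)"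
      using F_meas by (subst M.nn_integral_fst[symmetric]) auto
    also have "\<dots> \<le> (\<integral>\<^sup>+\<theta>. ennreal (?C * ((L2_norm polydisk f)\<^sup>2 + (L2_norm polydisk g)\<^sup>2)) \<partial>I01)"
    proof (rule nn_integral_mono)
      fix \<theta>
      have [measurable]: "sc i (e1 \<theta>) \<in> borel_measurable borel"
        by (intro borel_measurable_continuous_onI continuous_intros)
      have [measurable]: "(\<lambda>z. f (sc i (e1 \<theta>) z)) \<in> borel_measurable ?M" "g \<in> borel_measurable ?M"
        by (intro borel_measurable_lebesgue_on; measurable)+
      have "(\<integral>\<^sup>+z. ennreal (norm (F \<theta> z)) \<partial>?M)
        \<le> (\<integral>\<^sup>+z. ennreal ?C * (ennreal ((norm (f (sc i (e1 \<theta>) z)))\<^sup>2) + ennreal ((norm (g z))\<^sup>2)) \<partial>?M)"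
      proof (rule nn_integral_mono)
        fix z
        let ?a = "norm (f (sc i (e1 \<theta>) z))" and ?b = "norm (g z)"
        have "?a * ?b \<le> ?a\<^sup>2 + ?b\<^sup>2"
          using sum_squares_bound[of ?a ?b] mult_nonneg_nonneg[OF norm_ge_zero norm_ge_zero, of "f (sc i (e1 \<theta>) z)" "g z"]
          by linarith
        then have "norm (ck t \<theta>) * (?a * ?b) \<le> ?C * (?a\<^sup>2 + ?b\<^sup>2)"
          using norm_ck[OF t, of \<theta>] t by (intro mult_mono) auto
        then have "norm (F \<theta> z) \<le> ?C * (?a\<^sup>2 + ?b\<^sup>2)"
          by (simp add: F_def norm_mult mult_ac)
        then show "ennreal (norm (F \<theta> z)) \<le> ennreal ?C * (ennreal (?a\<^sup>2) + ennreal (?b\<^sup>2))"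
          using t by (simp add: ennreal_mult[symmetric] ennreal_plus[symmetric] del: ennreal_plus)
      qed
      also have "\<dots> = ennreal ?C * ((\<integral>\<^sup>+z. ennreal ((norm (f (sc i (e1 \<theta>) z)))\<^sup>2) \<partial>?M) + (\<integral>\<^sup>+z. ennreal ((norm (g z))\<^sup>2) \<partial>?M))"
        by (subst nn_integral_cmult) (auto simp: nn_integral_add)
      also have "\<dots> = ennreal (?C * ((L2_norm polydisk f)\<^sup>2 + (L2_norm polydisk g)\<^sup>2))"
        unfolding rotf[OF norm_e1] L2_norm_nn[OF bergman_L2[OF g], symmetric]
        using t by (simp add: ennreal_mult[symmetric] ennreal_plus[symmetric] del: ennreal_plus)
      finally show "(\<integral>\<^sup>+z. ennreal (norm (F \<theta> z)) \<partial>?M) \<le> ennreal (?C * ((L2_norm polydisk f)\<^sup>2 + (L2_norm polydisk g)\<^sup>2))" .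
    qed
    also have "\<dots> < \<infinity>" unfolding nn_integral_const prob_I01 by simp
    finally show "(\<integral>\<^sup>+x. ennreal (norm (case x of (\<theta>, z) \<Rightarrow> F \<theta> z)) \<partial>(I01 \<Otimes>\<^sub>M ?M)) < \<infinity>" .
  qed
  have "L2_inner polydisk (dil i t f) g = (LINT z|?M. (LINT \<theta>|I01. F \<theta> z))"
    unfolding L2_inner_def
  proof (rule Bochner_Integration.integral_cong[OF refl])
    fix z assume "z \<in> space ?M"
    then have z: "z \<in> polydisk" by simp
    have "(LINT \<theta>|I01. F \<theta> z) = f (sc i (of_real t) z) * cnj (g z)"
      unfolding F_def using Cauchy_sc[OF bergman_mholomorphic[OF f] z t] by simp
    then show "dil i t f z * cnj (g z) = (LINT \<theta>|I01. F \<theta> z)"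
      using z by (simp add: dil_def)
  qed
  also have "\<dots> = (LINT \<theta>|I01. (LINT z|?M. F \<theta> z))"
    by (rule Fubini_integral[OF F_int])
  also have "\<dots> = (LINT \<theta>|I01. ck t \<theta> * L2_inner polydisk (\<lambda>z. f (sc i (e1 \<theta>) z)) g)"
  proof (rule Bochner_Integration.integral_cong[OF refl])
    fix \<theta>
    have "(LINT z|?M. F \<theta> z) = (LINT z|?M. ck t \<theta> * (f (sc i (e1 \<theta>) z) * cnj (g z)))"
      by (simp add: F_def mult_ac)
    then show "(LINT z|?M. F \<theta> z) = ck t \<theta> * L2_inner polydisk (\<lambda>z. f (sc i (e1 \<theta>) z)) g"
      unfolding L2_inner_def by simp
  qed
  finally show ?thesis .
qed

text \<open>Rotation invariance moves a rotation from one factor to the other as its inverse. The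
  inverse rotation and the conjugate kernel both come from
  \<open>\<theta> \<mapsto> 1 - \<theta>\<close>, under which the circle average is
  invariant.\<close>

lemma dil_selfadjoint:
  fixes f g :: "complex ^ 'n \<Rightarrow> complex"
  assumes f: "f \<in> bergman polydisk" and g: "g \<in> bergman polydisk" and t: "0 \<le> t" "t < 1"
  shows "L2_inner polydisk (dil i t f) g = L2_inner polydisk f (dil i t g)"
proof -
  have fb [measurable]: "f \<in> borel_measurable borel" and gb [measurable]: "g \<in> borel_measurable borel"
    using f g bergman_borel open_polydisk by auto
  define K where "K \<theta> = ck t \<theta> * L2_inner polydisk (\<lambda>z. f (sc i (e1 \<theta>) z)) g" for \<theta>
  have rot: "L2_inner polydisk (\<lambda>z. g (sc i (cnj c) z)) f = cnj (L2_inner polydisk (\<lambda>z. f (sc i c z)) g)" if c: "norm c = 1" for c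
  proof -
    have cc: "cnj c * c = 1" using c complex_norm_square[of c] by (simp add: mult.commute)
    have [measurable]: "sc i d \<in> borel_measurable (borel :: (complex ^ 'n) measure)" for d
      by (intro borel_measurable_continuous_onI continuous_intros)
    have "L2_inner polydisk (\<lambda>z. g (sc i (cnj c) z)) f
      = (LINT z|lebesgue_on polydisk. g (sc i (cnj c) (sc i c z)) * cnj (f (sc i c z)))"
      unfolding L2_inner_def
      by (rule integral_polydisk_sc[where u = "\<lambda>z. g (sc i (cnj c) z) * cnj (f z)", OF _ c, symmetric]) measurable
    also have "\<dots> = L2_inner polydisk g (\<lambda>z. f (sc i c z))"
      by (simp add: L2_inner_def cc)
    finally show ?thesis by (simp add: L2_inner_commute[of polydisk g])
  qed
  have "L2_inner polydisk f (dil i t g) = cnj (LINT \<theta>|I01. ck t \<theta> * L2_inner polydisk (\<lambda>z. g (sc i (e1 \<theta>) z)) f)"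
    by (subst L2_inner_commute) (simp add: dil_inner_eq[OF g f t])
  also have "\<dots> = cnj (LINT \<theta>|I01. cnj (K (1 - \<theta>)))"
    by (simp add: K_def ck_reflect e1_minus rot[of "cnj (e1 _)", simplified, symmetric])
  also have "\<dots> = (LINT \<theta>|I01. K (1 - \<theta>))" by simp
  also have "\<dots> = (LINT \<theta>|I01. K \<theta>)" by (rule I01_reflect)
  also have "\<dots> = L2_inner polydisk (dil i t f) g"
    unfolding K_def by (rule dil_inner_eq[OF f g t, symmetric])
  finally show ?thesis ..
qed

text \<open>Contraction by \<open>t\<close> maps the polydisk onto its part
  \<open>|z_i| < t\<close>. The Jacobian \<open>t^2\<close> of the squared norms becomes the factor
  \<open>t\<close>.\<close>

lemma dil_norm_disc:
  fixes f :: "complex ^ 'n \<Rightarrow> complex"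
  assumes f: "f \<in> bergman polydisk" and t: "0 < t" "t < 1"
  shows "L2_norm polydisk (\<lambda>z. (if norm (z $ i) < t then 1 else 0) * f z) = t * L2_norm polydisk (dil i t f)"
proof -
  have fb [measurable]: "f \<in> borel_measurable borel" using f bergman_borel open_polydisk by auto
  let ?h = "\<lambda>z. (if norm (z $ i) < t then 1 else 0) * f z"
  define A where "A = {z :: complex ^ 'n. norm (z $ i) < t}"
  have "open A" unfolding A_def by (intro open_Collect_less continuous_intros)
  then have A [measurable]: "A \<in> sets borel" by simp
  have h_eq: "?h = (\<lambda>z. indicator A z * f z)" by (auto simp: A_def indicator_def)
  have hb: "?h \<in> borel_measurable borel" unfolding h_eq by measurable
  have h2: "?h \<in> L2 polydisk"
    by (rule L2_dominated(1)[OF bergman_L2[OF f] borel_measurable_lebesgue_on[OF hb], of 1]) auto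
  note d = dil_bergman(1)[OF f, of t i] 
  have db: "dil i t f \<in> bergman polydisk" using t by (intro d) auto
  have "ennreal ((L2_norm polydisk ?h)\<^sup>2) = (\<integral>\<^sup>+z. ennreal ((norm (?h z))\<^sup>2) * indicator polydisk z \<partial>lborel)"
    by (rule L2_norm_nn_polydisk[OF h2 hb])
  also have "\<dots> = ennreal (t\<^sup>2) * (\<integral>\<^sup>+z. ennreal ((norm (?h (sc i (of_real t) z)))\<^sup>2) * indicator polydisk (sc i (of_real t) z) \<partial>lborel)"
    using hb t by (intro nn_integral_sc) auto
  also have "(\<integral>\<^sup>+z. ennreal ((norm (?h (sc i (of_real t) z)))\<^sup>2) * indicator polydisk (sc i (of_real t) z) \<partial>lborel)
    = (\<integral>\<^sup>+z. ennreal ((norm (dil i t f z))\<^sup>2) * indicator polydisk z \<partial>lborel)"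
  proof (rule nn_integral_cong)
    fix z :: "complex ^ 'n"
    have "norm (sc i (of_real t) z $ i) < t \<and> sc i (of_real t) z \<in> polydisk \<longleftrightarrow> z \<in> polydisk"
    proof
      assume *: "norm (sc i (of_real t) z $ i) < t \<and> sc i (of_real t) z \<in> polydisk"
      then have "norm (z $ i) < 1" using t by (simp add: norm_mult)
      moreover have "norm (z $ j) < 1" if "j \<noteq> i" for j
        using * that unfolding polydisk_iff by (metis sc_nth)
      ultimately show "z \<in> polydisk" unfolding polydisk_iff by metis
    next
      assume z: "z \<in> polydisk"
      then show "norm (sc i (of_real t) z $ i) < t \<and> sc i (of_real t) z \<in> polydisk"
        using t sc_in_polydisk[OF z, of "of_real t" i] by (simp add: norm_mult polydisk_iff)
    qed
    then show "ennreal ((norm (?h (sc i (of_real t) z)))\<^sup>2) * indicator polydisk (sc i (of_real t) z)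
      = ennreal ((norm (dil i t f z))\<^sup>2) * indicator polydisk z"
      by (auto simp: dil_def indicator_def)
  qed
  also have "\<dots> = ennreal ((L2_norm polydisk (dil i t f))\<^sup>2)"
    by (rule L2_norm_nn_polydisk[OF bergman_L2[OF db] bergman_borel[OF db open_polydisk], symmetric])
  also have "ennreal (t\<^sup>2) * \<dots> = ennreal ((t * L2_norm polydisk (dil i t f))\<^sup>2)"
    by (simp add: ennreal_mult[symmetric] power_mult_distrib)
  finally show ?thesis using t by (simp add: power2_eq_iff_nonneg)
qed

section \<open>Null sequences, and mass of dilations in shells\<close>

lemma tendsto_zero_approx:
  fixes a :: "nat \<Rightarrow> real"
  assumes "\<And>e. e > 0 \<Longrightarrow> \<exists>b. b \<longlonglongrightarrow> 0 \<and> (\<forall>k. \<bar>a k\<bar> \<le> e + b k)"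
  shows "a \<longlonglongrightarrow> 0"
proof (rule LIMSEQ_I)
  fix e :: real assume "e > 0"
  then obtain b where b: "b \<longlonglongrightarrow> 0" "\<And>k. \<bar>a k\<bar> \<le> e / 2 + b k"
    using assms[of "e / 2"] by auto
  then obtain N where "\<And>k. k \<ge> N \<Longrightarrow> norm (b k - 0) < e / 2"
    using LIMSEQ_D[OF b(1), of "e / 2"] \<open>e > 0\<close> by auto
  then have "norm (a k - 0) < e" if "k \<ge> N" for k
    using b(2)[of k] that by (fastforce simp: abs_less_iff)
  then show "\<exists>N. \<forall>k\<ge>N. norm (a k - 0) < e" by blast
qed

lemma tendsto_zero_le:
  fixes a b :: "nat \<Rightarrow> real"
  assumes "b \<longlonglongrightarrow> 0" "\<And>k. 0 \<le> a k" "\<And>k. a k \<le> b k"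
  shows "a \<longlonglongrightarrow> 0"
  by (rule tendsto_sandwich[of "\<lambda>_. 0" a _ b]) (use assms in auto)

lemma sc_shell_iff:
  fixes z :: "complex ^ 'n"
  assumes \<sigma>: "0 < \<sigma>" "\<sigma> \<le> 1"
  shows "z \<in> polydisk \<and> s \<le> norm (z $ i) \<longleftrightarrow>
    sc i (of_real \<sigma>) z \<in> polydisk \<and> \<sigma> * s \<le> norm (sc i (of_real \<sigma>) z $ i) \<and> norm (sc i (of_real \<sigma>) z $ i) < \<sigma>"
  (is "?L \<longleftrightarrow> ?R")
proof
  assume z: ?L
  then show ?R using \<sigma> sc_in_polydisk[of z "of_real \<sigma>" i] by (simp add: norm_mult polydisk_iff)
next
  assume R: ?R
  then have "norm (z $ i) < 1" "s \<le> norm (z $ i)" using \<sigma> by (auto simp: norm_mult)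
  moreover have "norm (z $ j) < 1" if "j \<noteq> i" for j
    using R that unfolding polydisk_iff by (metis sc_nth)
  ultimately show ?L unfolding polydisk_iff by metis
qed

text \<open>The \<open>L\<^sup>2\<close> mass of \<open>f\<close> over each of the \<open>J\<close> disjoint shells \<open>s^(j+1) \<le> \<bar>z\<^sub>i\<bar> < s^j\<close>
  controls the mass of the dilation of \<open>f\<close> near \<open>\<bar>z\<^sub>i\<bar> = 1\<close>.\<close>

lemma dil_shell_bound:
  fixes f :: "complex ^ 'n \<Rightarrow> complex"
  assumes f: "f \<in> bergman polydisk" and q: "0 < q" "q < 1" and s: "0 < s" "s < 1" "q \<le> s ^ J" and J: "J > 0"
  shows "L2_norm polydisk (\<lambda>z. (if norm (z $ i) < s then 0 else 1) * dil i (q * q) f z)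
    \<le> 1 / ((1 - q) * q * sqrt (real J)) * L2_norm polydisk f"
proof -
  have fb [measurable]: "f \<in> borel_measurable borel" using f bergman_borel open_polydisk by auto
  let ?h = "\<lambda>z. (if norm (z $ i) < s then 0 else 1) * dil i (q * q) f z"
  define S where "S r = {z \<in> (polydisk :: (complex ^ 'n) set). r \<le> norm (z $ i)}" for r
  have S_borel [measurable]: "S r \<in> sets borel" for r
  proof -
    have "closed {z :: complex ^ 'n. r \<le> norm (z $ i)}" by (intro closed_Collect_le continuous_intros)
    moreover have "S r = polydisk \<inter> {z. r \<le> norm (z $ i)}" by (auto simp: S_def)
    ultimately show ?thesis using borel_polydisk by (metis borel_closed sets.Int)
  qed
  have rot: "sc i c z \<in> S r \<longleftrightarrow> z \<in> S r" if "norm c = 1" for c z r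
    using that by (simp add: S_def sc_in_polydisk_iff norm_mult)
  have qq: "0 \<le> q * q" "q * q < 1" using q mult_strict_mono[of q 1 q 1] by auto
  note db = dil_bergman[OF f qq, of i]
  have dbb [measurable]: "dil i (q * q) f \<in> borel_measurable borel" by (rule bergman_borel[OF db(1) open_polydisk])
  have h_eq: "?h z = indicator (S s) z * dil i (q * q) f z" for z
    by (auto simp: S_def indicator_def dil_def)
  have hb: "?h \<in> borel_measurable borel" unfolding h_eq by measurable
  have h2: "?h \<in> L2 polydisk"
    by (rule L2_dominated(1)[OF bergman_L2[OF db(1)] borel_measurable_lebesgue_on[OF hb], of 1]) auto
  define X where "X j = (\<integral>\<^sup>+z. ennreal ((norm (f z))\<^sup>2) * (indicator (S (s ^ Suc j)) z * indicator (- S (s ^ j)) z) \<partial>lborel)" for j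
  let ?C = "ennreal ((1 / ((1 - q) * q))\<^sup>2)"
  have step: "ennreal ((L2_norm polydisk ?h)\<^sup>2) \<le> ?C * X j" if j: "j < J" for j
  proof -
    define \<sigma> where "\<sigma> = s ^ j"
    have \<sigma>: "q \<le> \<sigma>" "0 < \<sigma>" "\<sigma> \<le> 1"
    proof -
      have "s ^ J \<le> s ^ j" using j s by (intro power_decreasing) auto
      then show "q \<le> \<sigma>" using s(3) unfolding \<sigma>_def by linarith
      show "0 < \<sigma>" "\<sigma> \<le> 1" using s by (auto simp: \<sigma>_def power_le_one)
    qed
    \<comment> \<open>Dilation by \<open>q * q\<close> is split into contraction by
      \<open>\<sigma> = s ^ j\<close> and dilation by \<open>t\<close>. Since
      \<open>\<sigma> \<ge> q\<close>, the parameter \<open>t\<close> stays at most \<open>q\<close>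
      and the constant \<open>1 / (1 - t)\<close> is uniform in \<open>j\<close>.\<close>
    define t where "t = q * q / \<sigma>"
    have tq: "t \<le> q"
      using \<sigma> q unfolding t_def by (simp add: pos_divide_le_eq)
    have t: "0 \<le> t" "t < 1" using tq q \<sigma> by (simp add: t_def, linarith)
    define F where "F z = f (sc i (of_real \<sigma>) z)" for z
    have hol: "mholomorphic_on F polydisk"
      unfolding F_def using \<sigma> by (intro mholomorphic_sc bergman_mholomorphic f) auto
    have [measurable]: "sc i (of_real \<sigma>) \<in> borel_measurable (borel :: (complex ^ 'n) measure)"
      by (intro borel_measurable_continuous_onI continuous_intros)
    have Fb: "F \<in> borel_measurable borel" unfolding F_def by measurable
    have Ft: "F (sc i (of_real t) z) = f (sc i (of_real (q * q)) z)" for z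
      using \<sigma> by (simp add: F_def t_def)
    have "ennreal ((L2_norm polydisk ?h)\<^sup>2) = (\<integral>\<^sup>+z. ennreal ((norm (?h z))\<^sup>2) * indicator polydisk z \<partial>lborel)"
      by (rule L2_norm_nn_polydisk[OF h2 hb])
    also have "\<dots> = (\<integral>\<^sup>+z. ennreal ((norm (F (sc i (of_real t) z)))\<^sup>2) * indicator (S s) z \<partial>lborel)"
      unfolding Ft by (intro nn_integral_cong) (auto simp: h_eq dil_def S_def indicator_def)
    also have "\<dots> \<le> ennreal ((1 / (1 - t))\<^sup>2) * (\<integral>\<^sup>+z. ennreal ((norm (F z))\<^sup>2) * indicator (S s) z \<partial>lborel)"
      by (rule nn_integral_dilation_bound[OF hol Fb t S_borel _ rot]) (auto simp: S_def)
    also have "\<dots> \<le> ennreal ((1 / (1 - q))\<^sup>2) * (\<integral>\<^sup>+z. ennreal ((norm (F z))\<^sup>2) * indicator (S s) z \<partial>lborel)"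
      using tq q t by (intro mult_right_mono ennreal_leI power_mono divide_left_mono) auto
    also have "(\<integral>\<^sup>+z. ennreal ((norm (F z))\<^sup>2) * indicator (S s) z \<partial>lborel) \<le> ennreal ((1 / q)\<^sup>2) * X j"
    proof -
      define G where "G z = ennreal ((norm (f z))\<^sup>2) * (indicator (S (s ^ Suc j)) z * indicator (- S (s ^ j)) z)" for z
      have [measurable]: "G \<in> borel_measurable borel" unfolding G_def by measurable
      have FG: "ennreal ((norm (F z))\<^sup>2) * indicator (S s) z = G (sc i (of_real \<sigma>) z)" for z
      proof -
        have "z \<in> S s \<longleftrightarrow> sc i (of_real \<sigma>) z \<in> S (s ^ Suc j) \<and> sc i (of_real \<sigma>) z \<notin> S (s ^ j)"
          using sc_shell_iff[OF \<sigma>(2,3), of z s i] by (auto simp: S_def \<sigma>_def not_le mult.commute)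
        then show ?thesis by (simp add: G_def F_def indicator_def)
      qed
      \<comment> \<open>Contraction by \<open>\<sigma>\<close> carries the outermost shell
        \<open>s \<le> |z_i| < 1\<close> onto shell number \<open>j\<close>. The Jacobian costs
        \<open>1 / \<sigma>^2\<close>, which is at most \<open>1 / q^2\<close>.\<close>
      have "X j = ennreal (\<sigma>\<^sup>2) * (\<integral>\<^sup>+z. G (sc i (of_real \<sigma>) z) \<partial>lborel)"
        unfolding X_def G_def[symmetric] using \<sigma> by (intro nn_integral_sc) auto
      then have "ennreal ((1 / \<sigma>)\<^sup>2) * X j = ennreal ((1 / \<sigma>)\<^sup>2 * \<sigma>\<^sup>2) * (\<integral>\<^sup>+z. G (sc i (of_real \<sigma>) z) \<partial>lborel)"
        by (simp add: ennreal_mult mult.assoc)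
      also have "(1 / \<sigma>)\<^sup>2 * \<sigma>\<^sup>2 = 1" using \<sigma> by (simp add: power_divide)
      finally have "(\<integral>\<^sup>+z. G (sc i (of_real \<sigma>) z) \<partial>lborel) = ennreal ((1 / \<sigma>)\<^sup>2) * X j" by simp
      also have "\<dots> \<le> ennreal ((1 / q)\<^sup>2) * X j"
        using \<sigma> q by (intro mult_right_mono ennreal_leI power_mono divide_left_mono) auto
      finally show ?thesis unfolding FG .
    qed
    finally have "ennreal ((L2_norm polydisk ?h)\<^sup>2) \<le> ennreal ((1 / (1 - q))\<^sup>2) * (ennreal ((1 / q)\<^sup>2) * X j)"
      by (simp add: mult_left_mono)
    also have "\<dots> = ?C * X j"
      by (simp add: ennreal_mult[symmetric] mult.assoc[symmetric] power_mult_distrib[symmetric])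
    finally show ?thesis .
  qed
  \<comment> \<open>The same quantity is bounded by the mass on each of \<open>J\<close> disjoint
    shells. Adding these bounds gains the factor \<open>1 / J\<close>.\<close>
  have "of_nat J * ennreal ((L2_norm polydisk ?h)\<^sup>2) = (\<Sum>j<J. ennreal ((L2_norm polydisk ?h)\<^sup>2))" by simp
  also have "\<dots> \<le> (\<Sum>j<J. ?C * X j)" using step by (intro sum_mono) auto
  also have "\<dots> = ?C * (\<integral>\<^sup>+z. ennreal ((norm (f z))\<^sup>2) * (\<Sum>j<J. indicator (S (s ^ Suc j)) z * indicator (- S (s ^ j)) z) \<partial>lborel)"
  proof -
    have "(\<Sum>j<J. X j) = (\<integral>\<^sup>+z. (\<Sum>j<J. ennreal ((norm (f z))\<^sup>2) * (indicator (S (s ^ Suc j)) z * indicator (- S (s ^ j)) z)) \<partial>lborel)"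
      unfolding X_def by (rule nn_integral_sum[symmetric]) measurable
    then show ?thesis by (simp only: sum_distrib_left[symmetric])
  qed
  also have "\<dots> \<le> ?C * (\<integral>\<^sup>+z. ennreal ((norm (f z))\<^sup>2) * indicator polydisk z \<partial>lborel)"
  proof (rule mult_left_mono[OF nn_integral_mono])
    fix z
    have "(\<Sum>j<J. indicator (S (s ^ Suc j)) z * indicator (- S (s ^ j)) z) \<le> (indicator polydisk z :: ennreal)"
    proof -
      have "(\<Sum>j<k. indicator (S (s ^ Suc j)) z * indicator (- S (s ^ j)) z) \<le> (indicator (S (s ^ k)) z :: ennreal)" for k
      proof (induction k)
        case (Suc k)
        have sub: "S (s ^ k) \<subseteq> S (s ^ Suc k)"
        proof -
          have "s ^ Suc k \<le> s ^ k" using s by (intro power_decreasing) auto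
          then show ?thesis by (auto simp: S_def simp del: power_Suc)
        qed
        have "(\<Sum>j<Suc k. indicator (S (s ^ Suc j)) z * indicator (- S (s ^ j)) z)
          \<le> (indicator (S (s ^ k)) z + indicator (S (s ^ Suc k)) z * indicator (- S (s ^ k)) z :: ennreal)"
          using Suc by (simp add: add_right_mono)
        also have "\<dots> \<le> indicator (S (s ^ Suc k)) z"
          using sub by (auto simp: indicator_def)
        finally show ?case .
      qed simp
      then show ?thesis by (rule order_trans) (auto simp: S_def indicator_def)
    qed
    then show "ennreal ((norm (f z))\<^sup>2) * (\<Sum>j<J. indicator (S (s ^ Suc j)) z * indicator (- S (s ^ j)) z)
      \<le> ennreal ((norm (f z))\<^sup>2) * indicator polydisk z"
      by (rule mult_left_mono) simp
  qed simp
  also have "\<dots> = ?C * ennreal ((L2_norm polydisk f)\<^sup>2)"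
    using L2_norm_nn_polydisk[OF bergman_L2[OF f] fb] by simp
  finally have "real J * (L2_norm polydisk ?h)\<^sup>2 \<le> (1 / ((1 - q) * q))\<^sup>2 * (L2_norm polydisk f)\<^sup>2"
    by (simp add: ennreal_mult[symmetric] ennreal_of_nat_eq_real_of_nat ennreal_le_iff del: ennreal_mult)
  then have "(L2_norm polydisk ?h)\<^sup>2 \<le> (1 / ((1 - q) * q))\<^sup>2 * (L2_norm polydisk f)\<^sup>2 / real J"
    using J by (simp add: pos_le_divide_eq mult.commute)
  also have "\<dots> = (1 / ((1 - q) * q * sqrt (real J)) * L2_norm polydisk f)\<^sup>2"
    by (simp add: power_mult_distrib power_divide)
  finally have "(L2_norm polydisk ?h)\<^sup>2 \<le> (1 / ((1 - q) * q * sqrt (real J)) * L2_norm polydisk f)\<^sup>2" .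
  then show ?thesis
    by (rule power2_le_imp_le) (use q in auto)
qed

section \<open>Sequences escaping to a face\<close>

text \<open>The weight vanishes exactly on the face \<open>|z_i| = 1\<close>, so smallness of the
  weighted norms says that the mass moves to this face. Holomorphy is not part of the notion,
  because products with symbols and cut-offs must be covered.\<close>

definition escaping :: "'n \<Rightarrow> (nat \<Rightarrow> complex ^ 'n \<Rightarrow> complex) \<Rightarrow> bool" where
  "escaping i v \<longleftrightarrow> (\<forall>k. v k \<in> L2 polydisk) \<and> (\<exists>B. \<forall>k. L2_norm polydisk (v k) \<le> B) \<and>
    (\<lambda>k. L2_norm polydisk (\<lambda>z. of_real (1 - (norm (z $ i))\<^sup>2) * v k z)) \<longlonglongrightarrow> 0"

lemma escaping_L2: "escaping i v \<Longrightarrow> v k \<in> L2 polydisk"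
  by (simp add: escaping_def)

lemma escaping_bound: "escaping i v \<Longrightarrow> \<exists>B\<ge>0. \<forall>k. L2_norm polydisk (v k) \<le> B"
  unfolding escaping_def by (meson L2_norm_nonneg order_trans)

lemma borel_weight: "(\<lambda>z :: complex ^ 'n. complex_of_real (1 - (norm (z $ i))\<^sup>2)) \<in> borel_measurable borel"
  by (intro borel_measurable_continuous_onI continuous_intros)

lemma weight_bounds:
  "z \<in> polydisk \<Longrightarrow> 0 \<le> 1 - (norm (z $ i))\<^sup>2" "1 - (norm (z $ i))\<^sup>2 \<le> 1" for z :: "complex ^ 'n"
  by (auto simp: polydisk_iff abs_square_le_1 less_imp_le)

lemma norm_weight_le: "z \<in> polydisk \<Longrightarrow> norm (complex_of_real (1 - (norm (z $ i))\<^sup>2)) \<le> 1" for z :: "complex ^ 'n"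
  unfolding norm_of_real using weight_bounds[of z i] by simp

lemma escaping_mult_le:
  fixes v :: "complex ^ 'n \<Rightarrow> complex"
  assumes v: "v \<in> L2 polydisk" and a: "a \<in> borel_measurable (lebesgue_on polydisk)"
    and e: "e \<ge> 0" "C \<ge> 0" and le: "\<And>z. z \<in> polydisk \<Longrightarrow> norm (a z) \<le> e + C * (1 - (norm (z $ i))\<^sup>2)"
  shows "(\<lambda>z. a z * v z) \<in> L2 polydisk"
    "L2_norm polydisk (\<lambda>z. a z * v z) \<le> e * L2_norm polydisk v
      + C * L2_norm polydisk (\<lambda>z. of_real (1 - (norm (z $ i))\<^sup>2) * v z)"
proof -
  let ?w = "\<lambda>z. complex_of_real (1 - (norm (z $ i))\<^sup>2) * v z"
  have w: "?w \<in> L2 polydisk"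
    by (rule L2_mult_bounded(1)[OF v borel_measurable_lebesgue_on[OF borel_weight], where B = 1])
      (simp_all only: norm_weight_le zero_le_one)
  let ?u = "\<lambda>z. of_real e * v z + of_real C * ?w z"
  have u: "?u \<in> L2 polydisk" by (intro L2_add L2_cmult v w)
  have m: "(\<lambda>z. a z * v z) \<in> borel_measurable (lebesgue_on polydisk)"
    using a L2_measurable[OF v] by (rule borel_measurable_times)
  have le': "norm (a z * v z) \<le> 1 * norm (?u z)" if z: "z \<in> polydisk" for z
  proof -
    have "?u z = of_real (e + C * (1 - (norm (z $ i))\<^sup>2)) * v z" by (simp add: algebra_simps)
    moreover have "0 \<le> e + C * (1 - (norm (z $ i))\<^sup>2)" using e weight_bounds(1)[OF z, of i] by simp
    ultimately have "norm (?u z) = (e + C * (1 - (norm (z $ i))\<^sup>2)) * norm (v z)" by (simp only: norm_mult norm_of_real abs_of_nonneg)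
    then show ?thesis using le[OF z] by (simp add: norm_mult mult_right_mono)
  qed
  show "(\<lambda>z. a z * v z) \<in> L2 polydisk" using L2_dominated(1)[OF u m _ le'] by simp
  have "L2_norm polydisk (\<lambda>z. a z * v z) \<le> L2_norm polydisk ?u" using L2_dominated(2)[OF u m _ le'] by simp
  also have "\<dots> \<le> L2_norm polydisk (\<lambda>z. of_real e * v z) + L2_norm polydisk (\<lambda>z. of_real C * ?w z)"
    by (intro L2_triangle L2_cmult v w)
  also have "\<dots> = e * L2_norm polydisk v + C * L2_norm polydisk ?w"
    unfolding L2_norm_cmult using e by simp
  finally show "L2_norm polydisk (\<lambda>z. a z * v z) \<le> e * L2_norm polydisk v + C * L2_norm polydisk ?w" .
qed

text \<open>The growth condition says that \<open>a\<close> tends to 0, uniformly, as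
  \<open>|z_i|\<close> tends to 1. The constant part \<open>e\<close> is paid by the norm bound and
  the rest by the weighted norms.\<close>

lemma escaping_mult_vanish:
  fixes v :: "nat \<Rightarrow> complex ^ 'n \<Rightarrow> complex"
  assumes v: "escaping i v" and a: "a \<in> borel_measurable (lebesgue_on polydisk)"
    and le: "\<And>e. e > 0 \<Longrightarrow> \<exists>C\<ge>0. \<forall>z\<in>polydisk. norm (a z) \<le> e + C * (1 - (norm (z $ i))\<^sup>2)"
  shows "(\<lambda>k. L2_norm polydisk (\<lambda>z. a z * v k z)) \<longlonglongrightarrow> 0"
proof (rule tendsto_zero_approx)
  fix e :: real assume e: "e > 0"
  obtain B where B: "B \<ge> 0" "\<And>k. L2_norm polydisk (v k) \<le> B" using escaping_bound[OF v] by blast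
  have e': "e / (B + 1) > 0" using e B by simp
  obtain C where C: "C \<ge> 0" "\<And>z. z \<in> polydisk \<Longrightarrow> norm (a z) \<le> e / (B + 1) + C * (1 - (norm (z $ i))\<^sup>2)"
    using le[OF e'] by blast
  let ?b = "\<lambda>k. C * L2_norm polydisk (\<lambda>z. of_real (1 - (norm (z $ i))\<^sup>2) * v k z)"
  have "L2_norm polydisk (\<lambda>z. a z * v k z) \<le> e + ?b k" for k
  proof -
    have "L2_norm polydisk (\<lambda>z. a z * v k z) \<le> e / (B + 1) * L2_norm polydisk (v k) + ?b k"
      by (rule escaping_mult_le(2)[OF escaping_L2[OF v] a _ C]) (use e' in auto)
    also have "e / (B + 1) * L2_norm polydisk (v k) \<le> e / (B + 1) * (B + 1)"
      using B(2)[of k] e' by (intro mult_left_mono) auto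
    also have "\<dots> = e" using B by simp
    finally show ?thesis by simp
  qed
  moreover have "?b \<longlonglongrightarrow> C * 0"
    using v unfolding escaping_def by (intro tendsto_mult tendsto_const) auto
  ultimately show "\<exists>b. b \<longlonglongrightarrow> 0 \<and> (\<forall>k. \<bar>L2_norm polydisk (\<lambda>z. a z * v k z)\<bar> \<le> e + b k)"
    by (intro exI[of _ ?b]) auto
qed

lemma borel_disc: "(\<lambda>z :: complex ^ 'n. if norm (z $ i) < s then a else b :: complex) \<in> borel_measurable borel"
proof -
  have "open {z :: complex ^ 'n. norm (z $ i) < s}" by (intro open_Collect_less continuous_intros)
  then show ?thesis by (intro measurable_If) auto
qed

text \<open>On \<open>|z_i| < s\<close> the weight is at least \<open>1 - s^2\<close>, so the
  indicator is at most the weight divided by this constant.\<close>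

lemma escaping_disc:
  fixes v :: "nat \<Rightarrow> complex ^ 'n \<Rightarrow> complex"
  assumes v: "escaping i v" and s: "0 < s" "s < 1"
  shows "(\<lambda>k. L2_norm polydisk (\<lambda>z. (if norm (z $ i) < s then 1 else 0) * v k z)) \<longlonglongrightarrow> 0"
proof (rule escaping_mult_vanish[OF v borel_measurable_lebesgue_on[OF borel_disc]])
  fix e :: real assume "e > 0"
  have s2: "s\<^sup>2 < 1" using s by (simp add: power_less_one_iff)
  show "\<exists>C\<ge>0. \<forall>z\<in>polydisk. norm (if norm (z $ i) < s then 1 else 0 :: complex) \<le> e + C * (1 - (norm (z $ i))\<^sup>2)"
  proof (intro exI[of _ "1 / (1 - s\<^sup>2)"] conjI ballI)
    fix z :: "complex ^ 'n" assume z: "z \<in> polydisk"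
    show "norm (if norm (z $ i) < s then 1 else 0 :: complex) \<le> e + 1 / (1 - s\<^sup>2) * (1 - (norm (z $ i))\<^sup>2)"
    proof (cases "norm (z $ i) < s")
      case True
      then have "(norm (z $ i))\<^sup>2 \<le> s\<^sup>2" by (intro power_mono) auto
      then have "1 \<le> 1 / (1 - s\<^sup>2) * (1 - (norm (z $ i))\<^sup>2)" using s2 by (simp add: pos_le_divide_eq)
      then show ?thesis using True \<open>e > 0\<close> by simp
    next
      case False
      then show ?thesis using weight_bounds(1)[OF z, of i] s2 \<open>e > 0\<close> by simp
    qed
  qed (use s2 in auto)
qed

lemma escaping_mult:
  fixes v :: "nat \<Rightarrow> complex ^ 'n \<Rightarrow> complex"
  assumes v: "escaping i v" and a: "a \<in> borel_measurable (lebesgue_on polydisk)"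
    and bd: "\<And>z. z \<in> polydisk \<Longrightarrow> norm (a z) \<le> A" "A \<ge> 0"
  shows "escaping i (\<lambda>k z. a z * v k z)"
proof -
  obtain B where B: "B \<ge> 0" "\<And>k. L2_norm polydisk (v k) \<le> B" using escaping_bound[OF v] by blast
  have 1: "(\<lambda>z. a z * v k z) \<in> L2 polydisk" for k
    by (rule L2_mult_bounded(1)[OF escaping_L2[OF v] a bd])
  have 2: "L2_norm polydisk (\<lambda>z. a z * v k z) \<le> A * B" for k
    using L2_mult_bounded(2)[OF escaping_L2[OF v] a bd] B(2)[of k] bd(2) by (meson mult_left_mono order_trans)
  let ?w = "\<lambda>z :: complex ^ 'n. complex_of_real (1 - (norm (z $ i))\<^sup>2)"
  have "(\<lambda>k. L2_norm polydisk (\<lambda>z. (?w z * a z) * v k z)) \<longlonglongrightarrow> 0"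
  proof (rule escaping_mult_vanish[OF v])
    show "(\<lambda>z. ?w z * a z) \<in> borel_measurable (lebesgue_on polydisk)"
      by (intro borel_measurable_times a borel_measurable_lebesgue_on borel_weight)
    show "\<exists>C\<ge>0. \<forall>z\<in>polydisk. norm (?w z * a z) \<le> e + C * (1 - (norm (z $ i))\<^sup>2)" if "e > 0" for e
    proof (intro exI[of _ A] conjI ballI)
      fix z :: "complex ^ 'n" assume z: "z \<in> polydisk"
      have "norm (?w z * a z) = (1 - (norm (z $ i))\<^sup>2) * norm (a z)"
        unfolding norm_mult norm_of_real using weight_bounds(1)[OF z, of i] by simp
      also have "\<dots> \<le> (1 - (norm (z $ i))\<^sup>2) * A"
        using weight_bounds(1)[OF z] bd(1)[OF z] by (intro mult_left_mono) auto
      finally show "norm (?w z * a z) \<le> e + A * (1 - (norm (z $ i))\<^sup>2)"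
        using that by (simp add: mult.commute)
    qed (rule bd(2))
  qed
  then show ?thesis using 1 2 unfolding escaping_def by (auto simp: mult.assoc)
qed

lemma escaping_add:
  fixes v w :: "nat \<Rightarrow> complex ^ 'n \<Rightarrow> complex"
  assumes v: "escaping i v" and w: "escaping i w"
  shows "escaping i (\<lambda>k z. v k z + w k z)"
proof -
  obtain A B where B: "\<And>k. L2_norm polydisk (v k) \<le> A" "\<And>k. L2_norm polydisk (w k) \<le> B"
    using escaping_bound[OF v] escaping_bound[OF w] by blast
  let ?W = "\<lambda>z :: complex ^ 'n. complex_of_real (1 - (norm (z $ i))\<^sup>2)"
  note L = escaping_L2[OF v] escaping_L2[OF w]
  have W: "(\<lambda>z. ?W z * u z) \<in> L2 polydisk" if "u \<in> L2 polydisk" for u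
    by (rule L2_mult_bounded(1)[OF that borel_measurable_lebesgue_on[OF borel_weight], where B = 1])
      (simp_all only: norm_weight_le zero_le_one)
  have "(\<lambda>k. L2_norm polydisk (\<lambda>z. ?W z * (v k z + w k z))) \<longlonglongrightarrow> 0"
  proof (rule tendsto_zero_le)
    show "(\<lambda>k. L2_norm polydisk (\<lambda>z. ?W z * v k z) + L2_norm polydisk (\<lambda>z. ?W z * w k z)) \<longlonglongrightarrow> 0"
      using v w unfolding escaping_def by (intro tendsto_add_zero) auto
    show "L2_norm polydisk (\<lambda>z. ?W z * (v k z + w k z)) \<le> L2_norm polydisk (\<lambda>z. ?W z * v k z) + L2_norm polydisk (\<lambda>z. ?W z * w k z)" for k
      unfolding distrib_left by (intro L2_triangle W L)
  qed simp
  moreover have "L2_norm polydisk (\<lambda>z. v k z + w k z) \<le> A + B" for k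
    using L2_triangle[OF L, of k k] B(1)[of k] B(2)[of k] by linarith
  ultimately show ?thesis unfolding escaping_def using L2_add[OF L] by blast
qed

lemma escaping_diff:
  "escaping i v \<Longrightarrow> escaping i w \<Longrightarrow> escaping i (\<lambda>k z. v k z - w k z)"
  using escaping_add[of i v "\<lambda>k z. - 1 * w k z"] escaping_mult[of i w "\<lambda>_. - 1" 1] by simp

text \<open>For \<open>t > 0\<close> the norm is the mass on \<open>|z_i| < t\<close> divided by
  \<open>t\<close>. The case \<open>t = 0\<close> follows since \<open>D_0 = D_0 D_{1/2}\<close> and
  \<open>D_0\<close> is bounded.\<close>

lemma escaping_dil:
  fixes p :: "nat \<Rightarrow> complex ^ 'n \<Rightarrow> complex"
  assumes p: "escaping i p" "\<And>k. p k \<in> bergman polydisk" and t: "0 \<le> t" "t < 1"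
  shows "(\<lambda>k. L2_norm polydisk (dil i t (p k))) \<longlonglongrightarrow> 0"
proof -
  have pos: "(\<lambda>k. L2_norm polydisk (dil i q (p k))) \<longlonglongrightarrow> 0" if q: "0 < q" "q < 1" for q
  proof -
    have "(\<lambda>k. L2_norm polydisk (\<lambda>z. (if norm (z $ i) < q then 1 else 0) * p k z)) \<longlonglongrightarrow> 0"
      by (rule escaping_disc[OF p(1) q])
    then have "(\<lambda>k. q * L2_norm polydisk (dil i q (p k))) \<longlonglongrightarrow> 0"
      by (simp add: dil_norm_disc[OF p(2) q])
    then have "(\<lambda>k. (1 / q) * (q * L2_norm polydisk (dil i q (p k)))) \<longlonglongrightarrow> (1 / q) * 0"
      by (intro tendsto_mult tendsto_const)
    then show ?thesis using q by simp
  qed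
  show ?thesis
  proof (cases "t = 0")
    case True
    have lim: "(\<lambda>k. L2_norm polydisk (dil i (1/2) (p k))) \<longlonglongrightarrow> 0" by (rule pos) auto
    have le: "L2_norm polydisk (dil i 0 (p k)) \<le> L2_norm polydisk (dil i (1/2) (p k))" for k
      using dil_bergman(2)[OF dil_bergman(1)[OF p(2)[of k], of "1/2" i], of 0 i] by (simp add: dil_dil)
    show ?thesis unfolding True by (rule tendsto_zero_le[OF lim L2_norm_nonneg le])
  next
    case False
    then show ?thesis using pos[of t] t by simp
  qed
qed

text \<open>For \<open>p = P v\<close> one has \<open>\<parallel>D\<^sub>q p\<parallel>\<^sup>2 = \<langle>D\<^sub>q\<^sub>q p, p\<rangle> = \<langle>D\<^sub>q\<^sub>q p, v\<rangle>\<close>, where \<open>v\<close> and \<open>D\<^sub>q\<^sub>q p\<close> live on almost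
  disjoint sets.\<close>

lemma escaping_proj:
  fixes v :: "nat \<Rightarrow> complex ^ 'n \<Rightarrow> complex"
  assumes v: "escaping i v"
  shows "escaping i (\<lambda>k. bergman_proj polydisk (v k))"
proof -
  define p where "p k = bergman_proj polydisk (v k)" for k
  obtain B where B: "B \<ge> 0" "\<And>k. L2_norm polydisk (v k) \<le> B" using escaping_bound[OF v] by blast
  note vL = escaping_L2[OF v]
  have p: "p k \<in> bergman polydisk" for k unfolding p_def by (rule bergman_proj_in[OF open_polydisk vL])
  have pB: "L2_norm polydisk (p k) \<le> B" for k
    unfolding p_def using bergman_proj_norm_le[OF open_polydisk vL, of k] B(2)[of k] by linarith
  have dil0: "(\<lambda>k. (L2_norm polydisk (dil i q (p k)))\<^sup>2) \<longlonglongrightarrow> 0" if q: "0 < q" "q < 1" for q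
  proof (rule tendsto_zero_approx)
    fix e :: real assume e: "e > 0"
    \<comment> \<open>The constant of \<open>dil_shell_bound\<close> times two norm bounds by
      \<open>B\<close>. The shell estimate gains \<open>1 / sqrt J\<close>, hence \<open>J\<close>
      is taken beyond \<open>(D / e)^2\<close>.\<close>
    define D where "D = B * B / ((1 - q) * q)"
    have D: "D \<ge> 0" using q B by (simp add: D_def)
    obtain J :: nat where J: "J > 0" "D / sqrt (real J) \<le> e"
    proof -
      obtain J0 :: nat where J0: "(D / e)\<^sup>2 < real J0" using reals_Archimedean2 by blast
      then have "J0 > 0" by (metis not_gr_zero of_nat_0 not_less zero_le_power2)
      have "D / e \<le> sqrt (real J0)" using J0 D e by (intro real_le_rsqrt) auto
      then have "D / sqrt (real J0) \<le> e" using e \<open>J0 > 0\<close> by (simp add: field_simps)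
      then show thesis using that \<open>J0 > 0\<close> by blast
    qed
    \<comment> \<open>The \<open>J\<close> shells of ratio \<open>s\<close> exactly fill
      \<open>q \<le> |z_i| < 1\<close>.\<close>
    define s where "s = root J q"
    have s: "0 < s" "s < 1" "q \<le> s ^ J" using J q by (auto simp: s_def real_root_pow_pos2)
    have qq: "0 \<le> q * q" "q * q < 1" using q mult_strict_mono[of q 1 q 1] by auto
    define g where "g k = dil i (q * q) (p k)" for k
    have g: "g k \<in> bergman polydisk" for k unfolding g_def by (rule dil_bergman(1)[OF p qq])
    have gB: "L2_norm polydisk (g k) \<le> 1 / (1 - q * q) * B" for k
    proof -
      have "L2_norm polydisk (g k) \<le> 1 / (1 - q * q) * L2_norm polydisk (p k)"
        unfolding g_def by (rule dil_bergman(2)[OF p qq])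
      also have "\<dots> \<le> 1 / (1 - q * q) * B" using pB qq by (intro mult_left_mono) auto
      finally show ?thesis .
    qed
    \<comment> \<open>The inner product of \<open>g k\<close> and \<open>v k\<close> is split at
      \<open>|z_i| = s\<close>: inside, \<open>v k\<close> is small because it escapes; outside,
      \<open>g k\<close> is small by the shell estimate.\<close>
    define a where "a = (\<lambda>z :: complex ^ 'n. if norm (z $ i) < s then 1 else 0 :: complex)"
    define b where "b = (\<lambda>z :: complex ^ 'n. if norm (z $ i) < s then 0 else 1 :: complex)"
    have ab_meas: "a \<in> borel_measurable (lebesgue_on polydisk)" "b \<in> borel_measurable (lebesgue_on polydisk)"
      unfolding a_def b_def by (intro borel_measurable_lebesgue_on borel_disc)+
    have ab1: "norm (a z) \<le> 1" "norm (b z) \<le> 1" "cnj (a z) = a z" "a z + b z = 1" for z by (auto simp: a_def b_def)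
    have avL: "(\<lambda>z. a z * v k z) \<in> L2 polydisk" for k
      by (rule L2_mult_bounded(1)[OF vL ab_meas(1), of 1]) (auto simp: ab1)
    have bgL: "(\<lambda>z. b z * g k z) \<in> L2 polydisk" for k
      by (rule L2_mult_bounded(1)[OF bergman_L2[OF g] ab_meas(2), of 1]) (auto simp: ab1)
    have agL: "(\<lambda>z. a z * g k z) \<in> L2 polydisk" for k
      by (rule L2_mult_bounded(1)[OF bergman_L2[OF g] ab_meas(1), of 1]) (auto simp: ab1)
    have bound: "(L2_norm polydisk (dil i q (p k)))\<^sup>2 \<le> e + 1 / (1 - q * q) * B * L2_norm polydisk (\<lambda>z. a z * v k z)" for k
    proof -
      have dq: "dil i q (p k) \<in> bergman polydisk" using q by (intro dil_bergman(1) p) auto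
      have "of_real ((L2_norm polydisk (dil i q (p k)))\<^sup>2) = L2_inner polydisk (dil i q (p k)) (dil i q (p k))"
        by (simp add: L2_inner_self)
      also have "\<dots> = L2_inner polydisk (dil i q (dil i q (p k))) (p k)"
        using q by (intro dil_selfadjoint[symmetric] dq p) auto
      also have "dil i q (dil i q (p k)) = g k" using q by (simp add: dil_dil g_def)
      also have "L2_inner polydisk (g k) (p k) = L2_inner polydisk (g k) (v k)"
        unfolding p_def
        by (subst (1 2) L2_inner_commute) (simp add: bergman_proj_inner[OF open_polydisk vL g])
      also have "\<dots> = L2_inner polydisk (\<lambda>z. a z * g k z + b z * g k z) (v k)"
        by (simp add: distrib_right[symmetric] ab1)
      also have "\<dots> = L2_inner polydisk (g k) (\<lambda>z. a z * v k z) + L2_inner polydisk (\<lambda>z. b z * g k z) (v k)"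
        using L2_inner_mult_left[of polydisk a "g k" "v k"] by (simp add: L2_inner_add_left agL bgL vL ab1(3))
      finally have eq: "complex_of_real ((L2_norm polydisk (dil i q (p k)))\<^sup>2)
        = L2_inner polydisk (g k) (\<lambda>z. a z * v k z) + L2_inner polydisk (\<lambda>z. b z * g k z) (v k)" .
      have "(L2_norm polydisk (dil i q (p k)))\<^sup>2 = norm (complex_of_real ((L2_norm polydisk (dil i q (p k)))\<^sup>2))"
        unfolding norm_of_real by simp
      also have "\<dots> \<le> norm (L2_inner polydisk (g k) (\<lambda>z. a z * v k z)) + norm (L2_inner polydisk (\<lambda>z. b z * g k z) (v k))"
        unfolding eq by (rule norm_triangle_ineq)
      also have "\<dots> \<le> L2_norm polydisk (g k) * L2_norm polydisk (\<lambda>z. a z * v k z)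
          + L2_norm polydisk (\<lambda>z. b z * g k z) * L2_norm polydisk (v k)"
        by (intro add_mono L2_Cauchy_Schwarz bergman_L2 g avL bgL vL)
      also have "\<dots> \<le> 1 / (1 - q * q) * B * L2_norm polydisk (\<lambda>z. a z * v k z) + (B / ((1 - q) * q * sqrt (real J))) * B"
      proof (intro add_mono mult_mono)
        have "L2_norm polydisk (\<lambda>z. b z * g k z) \<le> 1 / ((1 - q) * q * sqrt (real J)) * L2_norm polydisk (p k)"
          unfolding b_def g_def by (rule dil_shell_bound[OF p q s J(1)])
        also have "\<dots> \<le> 1 / ((1 - q) * q * sqrt (real J)) * B"
          using q pB by (intro mult_left_mono) auto
        finally show "L2_norm polydisk (\<lambda>z. b z * g k z) \<le> B / ((1 - q) * q * sqrt (real J))" by simp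
      qed (use gB B q qq in auto)
      also have "(B / ((1 - q) * q * sqrt (real J))) * B = D / sqrt (real J)"
        by (simp add: D_def)
      finally show ?thesis using J(2) by linarith
    qed
    have "(\<lambda>k. L2_norm polydisk (\<lambda>z. a z * v k z)) \<longlonglongrightarrow> 0"
      unfolding a_def by (rule escaping_disc[OF v s(1,2)])
    then have "(\<lambda>k. 1 / (1 - q * q) * B * L2_norm polydisk (\<lambda>z. a z * v k z)) \<longlonglongrightarrow> 1 / (1 - q * q) * B * 0"
      by (intro tendsto_mult tendsto_const)
    then show "\<exists>b. b \<longlonglongrightarrow> 0 \<and> (\<forall>k. \<bar>(L2_norm polydisk (dil i q (p k)))\<^sup>2\<bar> \<le> e + b k)"
      using bound by (intro exI[of _ "\<lambda>k. 1 / (1 - q * q) * B * L2_norm polydisk (\<lambda>z. a z * v k z)"]) auto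
  qed
  have "(\<lambda>k. L2_norm polydisk (\<lambda>z. of_real (1 - (norm (z $ i))\<^sup>2) * p k z)) \<longlonglongrightarrow> 0"
  proof (rule tendsto_zero_approx)
    fix e :: real assume e: "e > 0"
    \<comment> \<open>The radius \<open>q = sqrt r\<close> is placed so close to 1 that the weight
      on \<open>|z_i| \<ge> q\<close>, at most \<open>1 - q^2 = 1 - r\<close>, contributes no more
      than \<open>e\<close>.\<close>
    have "1 - e / (B + 1) < 1" using e B by simp
    then obtain r where r: "0 < r" "r < 1" "1 - e / (B + 1) < r"
      using dense[of "max 0 (1 - e / (B + 1))" 1] by auto
    define q where "q = sqrt r"
    have q: "0 < q" "q < 1" "(1 - q\<^sup>2) * B \<le> e"
    proof -
      show "0 < q" "q < 1" using r by (auto simp: q_def)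
      have "(1 - r) * B \<le> e / (B + 1) * (B + 1)" using r B e by (intro mult_mono) auto
      then show "(1 - q\<^sup>2) * B \<le> e" using B r by (simp add: q_def)
    qed
    \<comment> \<open>Inside \<open>|z_i| < q\<close> the weight is at most 1 and the mass is
      \<open>q\<close> times the norm of the dilation; outside, the weight itself is small.\<close>
    have "L2_norm polydisk (\<lambda>z. of_real (1 - (norm (z $ i))\<^sup>2) * p k z) \<le> e + L2_norm polydisk (dil i q (p k))" for k
    proof -
      let ?h = "\<lambda>z. (if norm (z $ i) < q then 1 else 0) * p k z"
      let ?k = "\<lambda>z. (of_real (1 - (norm (z $ i))\<^sup>2) * (if norm (z $ i) < q then 0 else 1)) * p k z"
      note pb = bergman_borel[OF p open_polydisk]
      have hb: "?h \<in> borel_measurable borel" by (intro borel_measurable_times borel_disc pb)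
      have kb: "?k \<in> borel_measurable borel" by (intro borel_measurable_times borel_disc borel_weight pb)
      have wb: "(\<lambda>z. of_real (1 - (norm (z $ i))\<^sup>2) * ?h z) \<in> borel_measurable borel"
        by (rule borel_measurable_times[OF borel_weight hb])
      note pL = bergman_L2[OF p]
      have hL: "?h \<in> L2 polydisk"
        by (rule L2_dominated(1)[OF pL borel_measurable_lebesgue_on[OF hb], of 1]) auto
      have kle: "norm (?k z) \<le> (1 - q\<^sup>2) * norm (p k z)" if z: "z \<in> polydisk" for z
      proof (cases "norm (z $ i) < q")
        case False
        then have "q\<^sup>2 \<le> (norm (z $ i))\<^sup>2" using q by (intro power_mono) auto
        then have "norm (complex_of_real (1 - (norm (z $ i))\<^sup>2)) \<le> 1 - q\<^sup>2"
          unfolding norm_of_real using weight_bounds(1)[OF z, of i] by simp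
        then have "norm (complex_of_real (1 - (norm (z $ i))\<^sup>2)) * norm (p k z) \<le> (1 - q\<^sup>2) * norm (p k z)"
          by (intro mult_right_mono) auto
        then show ?thesis using False by (simp only: norm_mult if_False mult_1_right norm_one)
      qed (use q in \<open>simp add: power_le_one\<close>)
      have q2: "0 \<le> 1 - q\<^sup>2" using q by (simp add: power_le_one)
      have kL: "?k \<in> L2 polydisk" "L2_norm polydisk ?k \<le> (1 - q\<^sup>2) * L2_norm polydisk (p k)"
        using L2_dominated[OF pL borel_measurable_lebesgue_on[OF kb] q2 kle] by auto
      have wle: "norm (of_real (1 - (norm (z $ i))\<^sup>2) * ?h z) \<le> 1 * norm (?h z)" if z: "z \<in> polydisk" for z
        unfolding norm_mult norm_of_real using weight_bounds[of z i] z by (intro mult_right_mono) auto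
      have wL: "(\<lambda>z. of_real (1 - (norm (z $ i))\<^sup>2) * ?h z) \<in> L2 polydisk"
        "L2_norm polydisk (\<lambda>z. of_real (1 - (norm (z $ i))\<^sup>2) * ?h z) \<le> 1 * L2_norm polydisk ?h"
        using L2_dominated[OF hL borel_measurable_lebesgue_on[OF wb] _ wle] by auto
      have "(\<lambda>z. of_real (1 - (norm (z $ i))\<^sup>2) * p k z) = (\<lambda>z. ?k z + of_real (1 - (norm (z $ i))\<^sup>2) * ?h z)"
        by (auto simp: fun_eq_iff)
      then have "L2_norm polydisk (\<lambda>z. of_real (1 - (norm (z $ i))\<^sup>2) * p k z)
        \<le> L2_norm polydisk ?k + L2_norm polydisk (\<lambda>z. of_real (1 - (norm (z $ i))\<^sup>2) * ?h z)"
        using L2_triangle[OF kL(1) wL(1)] by simp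
      also have "\<dots> \<le> (1 - q\<^sup>2) * L2_norm polydisk (p k) + L2_norm polydisk ?h"
        using kL wL by linarith
      also have "(1 - q\<^sup>2) * L2_norm polydisk (p k) \<le> (1 - q\<^sup>2) * B"
        using pB q2 by (intro mult_left_mono)
      also have "L2_norm polydisk ?h \<le> L2_norm polydisk (dil i q (p k))"
        unfolding dil_norm_disc[OF p q(1,2)] using q by (simp add: mult_left_le_one_le)
      finally show ?thesis using q(3) by linarith
    qed
    moreover have "(\<lambda>k. sqrt ((L2_norm polydisk (dil i q (p k)))\<^sup>2)) \<longlonglongrightarrow> sqrt 0"
      by (intro tendsto_real_sqrt dil0 q)
    ultimately show "\<exists>b. b \<longlonglongrightarrow> 0 \<and> (\<forall>k. \<bar>L2_norm polydisk (\<lambda>z. of_real (1 - (norm (z $ i))\<^sup>2) * p k z)\<bar> \<le> e + b k)"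
      by (intro exI[of _ "\<lambda>k. L2_norm polydisk (dil i q (p k))"]) auto
  qed
  then show ?thesis unfolding escaping_def p_def[symmetric] using pB bergman_L2[OF p] by blast
qed

section \<open>Division by a coordinate\<close>

lemma mholomorphic_on_Un:
  "mholomorphic_on f A \<Longrightarrow> mholomorphic_on f B \<Longrightarrow> mholomorphic_on f (A \<union> B)"
  unfolding mholomorphic_on_def by blast

text \<open>Away from \<open>z_i = 0\<close> the quotient is explicit. Near \<open>z_i = 0\<close>
  it is given by a Cauchy integral over the circle of radius \<open>1/2\<close> in coordinate
  \<open>i\<close>, holomorphic as an integral over a parameter. The two agree on the
  overlap.\<close>

lemma mholomorphic_division:
  fixes p :: "complex ^ 'n \<Rightarrow> complex"
  assumes p: "mholomorphic_on p polydisk"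
  obtains q where "mholomorphic_on q polydisk" "\<And>z. z \<in> polydisk \<Longrightarrow> p z = p (upd i 0 z) + z $ i * q z"
    "\<And>z. z \<notin> polydisk \<Longrightarrow> q z = 0"
proof -
  define V where "V = {z \<in> (polydisk :: (complex ^ 'n) set). norm (z $ i) < 1/2}"
  define W where "W = {z \<in> (polydisk :: (complex ^ 'n) set). z $ i \<noteq> 0}"
  have "open {z :: complex ^ 'n. norm (z $ i) < 1/2}" by (intro open_Collect_less continuous_intros)
  from open_Int[OF open_polydisk this] have V: "open V" by (simp add: V_def Int_def)
  have "open {z :: complex ^ 'n. z $ i \<noteq> 0}" by (intro open_Collect_neq continuous_intros)
  from open_Int[OF open_polydisk this] have W: "open W" by (simp add: W_def Int_def)
  \<comment> \<open>The difference of the Cauchy kernels at \<open>z_i\<close> and at 0 on the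
    circle of radius \<open>1/2\<close>, divided by \<open>z_i\<close>: the singular factor cancels
    algebraically.\<close>
  define F where "F \<theta> z = p (upd i (e1 \<theta> / 2) z) * inverse (e1 \<theta> / 2 - z $ i)" for \<theta> z
  define r where "r z = integral {0..1} (\<lambda>\<theta>. F \<theta> z)" for z
  have half: "norm (e1 \<theta> / 2) = 1/2" for \<theta> by (simp add: norm_divide)
  have ne: "e1 \<theta> / 2 - z $ i \<noteq> 0" if "z \<in> V" for \<theta> z
  proof
    assume "e1 \<theta> / 2 - z $ i = 0"
    then have "norm (z $ i) = 1/2" using half[of \<theta>] by (metis right_minus_eq)
    then show False using that by (simp add: V_def)
  qed
  have upd_in: "upd i (e1 \<theta> / 2) z \<in> polydisk" if "z \<in> V" for \<theta> z
    using that half[of \<theta>] by (auto simp: V_def intro: upd_in_polydisk)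
  have r: "mholomorphic_on r V"
    unfolding r_def
  proof (rule mholomorphic_on_integral[OF V])
    show "continuous_on ({0..1} \<times> V) (\<lambda>(\<theta>, z). F \<theta> z)"
      unfolding F_def split_beta'
      using upd_in ne
      by (intro continuous_intros continuous_on_compose2[OF mholomorphic_on_continuous_on[OF p]]
          continuous_on_compose2[OF continuous_e1]) auto
    show "mholomorphic_on (F \<theta>) V" for \<theta>
      unfolding F_def
      by (intro mholomorphic_on_mult mholomorphic_on_inverse mholomorphic_on_diff mholomorphic_on_const
          mholomorphic_nth mholomorphic_upd[OF p] upd_in ne)
  qed
  have rq: "z $ i * r z = p z - p (upd i 0 z)" if z: "z \<in> V" for z
  proof -
    have zi: "norm (2 * z $ i) < 1" using z by (simp add: V_def norm_mult)
    \<comment> \<open>The circle of radius \<open>1/2\<close> is rescaled to the unit circle, so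
      \<open>z $ i\<close> corresponds to the point \<open>2 * z $ i\<close>.\<close>
    let ?h = "\<lambda>\<zeta>. p (upd i 0 z + \<zeta> *s axis i (1/2))"
    have line: "upd i 0 z + \<zeta> *s axis i (1/2) = upd i (\<zeta> / 2) z" for \<zeta>
      by (simp add: vec_eq_iff axis_def)
    have hol: "?h holomorphic_on cball 0 1"
    proof (rule mholomorphic_on_line[OF p])
      show "upd i 0 z + \<zeta> *s axis i (1/2) \<in> polydisk" if "\<zeta> \<in> cball 0 1" for \<zeta>
        unfolding line using that z by (intro upd_in_polydisk) (auto simp: V_def norm_divide)
    qed
    let ?w = "2 * z $ i"
    note c1 = circle_mean_Cauchy[OF hol zi]
    note c0 = circle_mean_Cauchy[OF hol, of 0]
    have "p z - p (upd i 0 z) = ?h ?w - ?h 0" unfolding line by simp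
    also have "\<dots> = (LINT \<theta>|I01. ?h (e1 \<theta>) * (e1 \<theta> / (e1 \<theta> - ?w)) - ?h (e1 \<theta>) * (e1 \<theta> / (e1 \<theta> - 0)))"
      using c1 c0 integral_I01(1)[OF c1(2)] integral_I01(1)[OF c0(2)] by simp
    also have "\<dots> = integral {0..1} (\<lambda>\<theta>. ?h (e1 \<theta>) * (e1 \<theta> / (e1 \<theta> - ?w)) - ?h (e1 \<theta>) * (e1 \<theta> / (e1 \<theta> - 0)))"
      by (rule integral_I01(2)) (intro continuous_on_diff c1(2) c0(2), simp)
    also have "\<dots> = integral {0..1} (\<lambda>\<theta>. z $ i * F \<theta> z)"
    proof (rule integral_cong)
      fix \<theta> :: real
      have n1: "e1 \<theta> - ?w \<noteq> 0" using ne[OF z, of \<theta>] by auto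
      have "e1 \<theta> / (e1 \<theta> - ?w) - e1 \<theta> / (e1 \<theta> - 0) = z $ i * inverse (e1 \<theta> / 2 - z $ i)"
        using n1 ne[OF z, of \<theta>] by (simp add: field_simps)
      then show "?h (e1 \<theta>) * (e1 \<theta> / (e1 \<theta> - ?w)) - ?h (e1 \<theta>) * (e1 \<theta> / (e1 \<theta> - 0)) = z $ i * F \<theta> z"
        unfolding F_def line right_diff_distrib[symmetric] by simp
    qed
    also have "\<dots> = z $ i * r z" unfolding r_def by simp
    finally show ?thesis by simp
  qed
  define q where "q z = (if z \<in> V then r z else if z \<in> W then (p z - p (upd i 0 z)) * inverse (z $ i) else 0)" for z
  have un: "polydisk = V \<union> W" by (auto simp: V_def W_def)
  have "mholomorphic_on q V"
    by (rule mholomorphic_on_cong[OF V _ r]) (simp add: q_def)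
  moreover have "mholomorphic_on q W"
  proof (rule mholomorphic_on_cong[OF W])
    show "mholomorphic_on (\<lambda>z. (p z - p (upd i 0 z)) * inverse (z $ i)) W"
      by (intro mholomorphic_on_mult mholomorphic_on_inverse mholomorphic_on_diff mholomorphic_nth
          mholomorphic_upd[OF p] mholomorphic_on_subset[OF p]) (auto simp: W_def intro: upd_in_polydisk)
    show "(p z - p (upd i 0 z)) * inverse (z $ i) = q z" if z: "z \<in> W" for z
    proof (cases "z \<in> V")
      case True
      then show ?thesis using rq[OF True] z by (simp add: q_def W_def field_simps)
    qed (use z in \<open>simp add: q_def\<close>)
  qed
  ultimately have "mholomorphic_on q polydisk" unfolding un by (rule mholomorphic_on_Un)
  moreover have "p z = p (upd i 0 z) + z $ i * q z" if "z \<in> polydisk" for z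
  proof (cases "z \<in> V")
    case True
    then show ?thesis using rq[OF True] by (simp add: q_def)
  next
    case False
    then have "z \<in> W" using that un by blast
    then show ?thesis using False by (simp add: q_def W_def field_simps)
  qed
  moreover have "q z = 0" if "z \<notin> polydisk" for z using that by (simp add: q_def V_def W_def)
  ultimately show thesis using that by blast
qed

lemma AE_coordinate_nonzero: "AE z in lebesgue_on (polydisk :: (complex ^ 'n) set). z $ i \<noteq> 0"
proof -
  have "negligible {z :: complex ^ 'n. axis i 1 \<bullet> z = 0}"
    by (rule negligible_hyperplane) simp
  then have "negligible {z :: complex ^ 'n. z $ i = 0}"
    by (rule negligible_subset) (auto simp: inner_axis')
  then have "{z :: complex ^ 'n. z $ i = 0} \<in> null_sets lebesgue" by (simp add: negligible_iff_null_sets)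
  then have "AE z in lebesgue. (z :: complex ^ 'n) $ i \<noteq> 0" by (rule AE_I') auto
  then show ?thesis by (subst AE_restrict_space_iff) auto
qed

text \<open>Rescaling \<open>z\<^sub>i\<close> by \<open>1/4\<close> bounds the mass of \<open>h\<close> on \<open>\<epsilon> \<le> \<bar>z\<^sub>i\<bar> < 1/4\<close> by a ninth of its mass on
  \<open>\<epsilon> \<le> \<bar>z\<^sub>i\<bar>\<close>, which can be absorbed since the latter is finite.\<close>

lemma bergman_coordinate_bounded_below:
  fixes h :: "complex ^ 'n \<Rightarrow> complex"
  assumes h: "mholomorphic_on h polydisk" "\<And>z. z \<notin> polydisk \<Longrightarrow> h z = 0"
    and zh: "(\<lambda>z. z $ i * h z) \<in> L2 polydisk"
  shows "h \<in> bergman polydisk" "L2_norm polydisk h \<le> 5 * L2_norm polydisk (\<lambda>z. z $ i * h z)"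
proof -
  have hb [measurable]: "h \<in> borel_measurable borel" by (rule borel_extension[OF open_polydisk h])
  let ?N = "L2_norm polydisk (\<lambda>z. z $ i * h z)"
  have nthb [measurable]: "(\<lambda>z :: complex ^ 'n. z $ i) \<in> borel_measurable borel"
    by (intro borel_measurable_continuous_onI continuous_intros)
  have zhb: "(\<lambda>z. z $ i * h z) \<in> borel_measurable borel" by measurable
  define S where "S r = {z \<in> (polydisk :: (complex ^ 'n) set). r \<le> norm (z $ i)}" for r
  have S_borel [measurable]: "S r \<in> sets borel" for r
  proof -
    have "closed {z :: complex ^ 'n. r \<le> norm (z $ i)}" by (intro closed_Collect_le continuous_intros)
    moreover have "S r = polydisk \<inter> {z. r \<le> norm (z $ i)}" by (auto simp: S_def)
    ultimately show ?thesis using borel_polydisk by (metis borel_closed sets.Int)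
  qed
  have rot: "sc i c z \<in> S r \<longleftrightarrow> z \<in> S r" if "norm c = 1" for c z r
    using that by (simp add: S_def sc_in_polydisk_iff norm_mult)
  define X where "X r = (\<integral>\<^sup>+z. ennreal ((norm (h z))\<^sup>2) * indicator (S r) z \<partial>lborel)" for r
  have Y: "(\<integral>\<^sup>+z. ennreal ((norm (z $ i * h z))\<^sup>2) * indicator polydisk z \<partial>lborel) = ennreal (?N\<^sup>2)"
    by (rule L2_norm_nn_polydisk[OF zh zhb, symmetric])
  have outer: "X r \<le> ennreal ((1 / r)\<^sup>2 * ?N\<^sup>2)" if r: "r > 0" for r
  proof -
    have "X r \<le> (\<integral>\<^sup>+z. ennreal ((1 / r)\<^sup>2) * (ennreal ((norm (z $ i * h z))\<^sup>2) * indicator polydisk z) \<partial>lborel)"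
      unfolding X_def
    proof (rule nn_integral_mono)
      fix z :: "complex ^ 'n"
      have "(norm (h z))\<^sup>2 \<le> (1 / r)\<^sup>2 * (norm (z $ i * h z))\<^sup>2" if z: "z \<in> S r"
      proof -
        have "1 \<le> 1 / r * norm (z $ i)" using z r by (simp add: S_def pos_le_divide_eq)
        then have "norm (h z) \<le> 1 / r * norm (z $ i) * norm (h z)"
          using mult_right_mono[of 1 "1 / r * norm (z $ i)" "norm (h z)"] by simp
        then have "(norm (h z))\<^sup>2 \<le> (1 / r * norm (z $ i * h z))\<^sup>2"
          by (intro power_mono) (simp_all add: norm_mult)
        then show ?thesis by (simp only: power_mult_distrib)
      qed
      then show "ennreal ((norm (h z))\<^sup>2) * indicator (S r) z \<le> ennreal ((1 / r)\<^sup>2) * (ennreal ((norm (z $ i * h z))\<^sup>2) * indicator polydisk z)"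
        by (auto simp: indicator_def S_def ennreal_mult[symmetric] intro!: ennreal_leI)
    qed
    also have "\<dots> = ennreal ((1 / r)\<^sup>2) * ennreal (?N\<^sup>2)"
      unfolding Y[symmetric] by (rule nn_integral_cmult) measurable
    finally show ?thesis by (simp add: ennreal_mult[symmetric])
  qed
  have main: "X r \<le> ennreal (18 * ?N\<^sup>2)" if r: "r > 0" for r
  proof -
    \<comment> \<open>Absorbing a multiple of \<open>X r\<close> into the left-hand side requires
      finiteness, which is why the mass is cut off at \<open>|z_i| \<ge> r\<close> with
      \<open>r > 0\<close>.\<close>
    have Xfin: "X r < \<infinity>" using outer[OF r] ennreal_less_top le_less_trans by fastforce
    have [measurable]: "sc i (of_real (1/4)) \<in> borel_measurable (borel :: (complex ^ 'n) measure)"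
      by (intro borel_measurable_continuous_onI continuous_intros)
    define G where "G z = ennreal ((norm (h z))\<^sup>2) * (indicator (S r) z * indicator (- S (1/4)) z)" for z
    have Gb [measurable]: "G \<in> borel_measurable borel" unfolding G_def by measurable
    have "X r \<le> (\<integral>\<^sup>+z. ennreal ((norm (h z))\<^sup>2) * indicator (S (1/4)) z + G z \<partial>lborel)"
      unfolding X_def by (rule nn_integral_mono) (auto simp: G_def indicator_def)
    also have "\<dots> = X (1/4) + (\<integral>\<^sup>+z. G z \<partial>lborel)"
      unfolding X_def by (rule nn_integral_add) measurable
    also have "(\<integral>\<^sup>+z. G z \<partial>lborel) = ennreal ((1/4)\<^sup>2) * (\<integral>\<^sup>+z. G (sc i (of_real (1/4)) z) \<partial>lborel)"
      by (rule nn_integral_sc[OF Gb]) simp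
    also have "(\<integral>\<^sup>+z. G (sc i (of_real (1/4)) z) \<partial>lborel)
        \<le> (\<integral>\<^sup>+z. ennreal ((norm (h (sc i (of_real (1/4)) z)))\<^sup>2) * indicator (S r) z \<partial>lborel)"
    proof (rule nn_integral_mono)
      fix z :: "complex ^ 'n"
      have "z \<in> S r" if "sc i (of_real (1/4)) z \<in> S r" "sc i (of_real (1/4)) z \<notin> S (1/4)"
        using that sc_shell_iff[of "1/4" z "4 * r" i] r by (auto simp: S_def not_le)
      then show "G (sc i (of_real (1/4)) z) \<le> ennreal ((norm (h (sc i (of_real (1/4)) z)))\<^sup>2) * indicator (S r) z"
        by (auto simp: G_def indicator_def)
    qed
    also have "\<dots> \<le> ennreal ((1 / (1 - 1/4))\<^sup>2) * X r"
      unfolding X_def by (rule nn_integral_dilation_bound[OF h(1) hb _ _ S_borel _ rot]) (auto simp: S_def)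
    also have "X (1/4) \<le> ennreal (16 * ?N\<^sup>2)"
      using outer[of "1/4"] by (simp add: power2_eq_square)
    finally have "X r \<le> ennreal (16 * ?N\<^sup>2) + ennreal ((1/4)\<^sup>2) * (ennreal ((1 / (1 - 1/4))\<^sup>2) * X r)"
      by (simp add: add_mono mult_left_mono)
    moreover obtain x where x: "X r = ennreal x" "x \<ge> 0"
      using Xfin by (cases "X r") auto
    ultimately have "ennreal x \<le> ennreal (16 * ?N\<^sup>2 + (1/4)\<^sup>2 * ((1 / (1 - 1/4))\<^sup>2 * x))"
      by (simp add: ennreal_mult ennreal_plus)
    then have "x \<le> 16 * ?N\<^sup>2 + (1/4)\<^sup>2 * ((1 / (1 - 1/4))\<^sup>2 * x)"
      using x by (subst (asm) ennreal_le_iff) auto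
    \<comment> \<open>The Jacobian \<open>1/16\<close> times the dilation constant
      \<open>16/9\<close> is \<open>1/9\<close>, and \<open>16 * 9/8 = 18\<close>.\<close>
    then have "x \<le> 18 * ?N\<^sup>2" by (simp add: power2_eq_square field_simps)
    then show ?thesis unfolding x by (rule ennreal_leI)
  qed
  \<comment> \<open>The inner cut-off tends to 0. Fatou yields a function equal to \<open>h\<close>
    off the null set \<open>z_i = 0\<close>, with norm factor 5 since
    \<open>18 \<le> 25\<close>.\<close>
  define u where "u k z = indicator (S (1 / real (Suc k))) z * h z" for k z
  define v where "v z = (if z $ i = 0 then 0 else h z)" for z
  have ub: "u k \<in> borel_measurable borel" for k unfolding u_def by measurable
  have u2: "(\<integral>\<^sup>+z. ennreal ((norm (u k z))\<^sup>2) \<partial>lebesgue_on polydisk) \<le> ennreal ((5 * ?N)\<^sup>2)" for k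
  proof -
    have "(\<integral>\<^sup>+z. ennreal ((norm (u k z))\<^sup>2) \<partial>lebesgue_on polydisk) = X (1 / real (Suc k))"
      unfolding X_def using ub
      by (subst nn_integral_lebesgue_on_borel) (auto intro!: nn_integral_cong simp: u_def indicator_def S_def)
    also have "\<dots> \<le> ennreal (18 * ?N\<^sup>2)" by (rule main) simp
    also have "\<dots> \<le> ennreal ((5 * ?N)\<^sup>2)" by (intro ennreal_leI) (simp add: power_mult_distrib)
    finally show ?thesis .
  qed
  have uL: "u k \<in> L2 polydisk" for k
    unfolding L2_iff using borel_measurable_lebesgue_on[OF ub] u2[of k] ennreal_less_top le_less_trans by fastforce
  have lim: "(\<lambda>k. u k z) \<longlonglongrightarrow> v z" if z: "z \<in> polydisk" for z
  proof (cases "z $ i = 0")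
    case True
    then have "u k z = v z" for k by (simp add: u_def v_def S_def)
    then show ?thesis by simp
  next
    case False
    then obtain N where N: "inverse (real (Suc N)) < norm (z $ i)" using reals_Archimedean[of "norm (z $ i)"] by auto
    have "u k z = v z" if "k \<ge> N" for k
    proof -
      have "1 / real (Suc k) \<le> inverse (real (Suc N))" using that by (simp add: field_simps)
      then show ?thesis using N z False by (simp add: u_def v_def S_def)
    qed
    then show ?thesis by (intro tendsto_eventually) (auto simp: eventually_sequentially)
  qed
  have v: "v \<in> L2 polydisk" "L2_norm polydisk v \<le> 5 * ?N"
    using L2_Fatou[OF uL L2_norm_le_nn[OF uL u2] _ lim] by auto
  have ae: "AE z in lebesgue_on polydisk. h z = v z"
    using AE_coordinate_nonzero[of i] by eventually_elim (simp add: v_def)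
  have "(\<integral>\<^sup>+z. ennreal ((norm (h z))\<^sup>2) \<partial>lebesgue_on polydisk) = (\<integral>\<^sup>+z. ennreal ((norm (v z))\<^sup>2) \<partial>lebesgue_on polydisk)"
    by (rule nn_integral_cong_AE) (use ae in eventually_elim, simp)
  also have "\<dots> = ennreal ((L2_norm polydisk v)\<^sup>2)" by (rule L2_norm_nn[OF v(1), symmetric])
  also have "\<dots> \<le> ennreal ((5 * ?N)\<^sup>2)" using v(2) by (intro ennreal_leI power_mono) auto
  finally have *: "(\<integral>\<^sup>+z. ennreal ((norm (h z))\<^sup>2) \<partial>lebesgue_on polydisk) \<le> ennreal ((5 * ?N)\<^sup>2)" .
  then have hL: "h \<in> L2 polydisk"
    unfolding L2_iff using borel_measurable_lebesgue_on[OF hb] ennreal_less_top le_less_trans by fastforce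
  then show "h \<in> bergman polydisk" using h by (simp add: bergman_def)
  show "L2_norm polydisk h \<le> 5 * ?N" by (rule L2_norm_le_nn[OF hL *]) simp
qed

section \<open>Asymptotic commutation with the projection\<close>

abbreviation PP :: "(complex ^ 'n \<Rightarrow> complex) \<Rightarrow> complex ^ 'n \<Rightarrow> complex" where
  "PP \<equiv> bergman_proj polydisk"

lemmas PP_in = bergman_proj_in[OF open_polydisk]
lemmas PP_L2 = bergman_proj_L2[OF open_polydisk]
lemmas PP_perp = bergman_proj_perp[OF open_polydisk]
lemmas PP_norm_le = bergman_proj_norm_le[OF open_polydisk]

lemma borel_coordinate_fun:
  assumes c: "continuous_on UNIV (c :: complex \<Rightarrow> complex)"
  shows "(\<lambda>z :: complex ^ 'n. c (z $ i)) \<in> borel_measurable (lebesgue_on \<Omega>)"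
  by (intro borel_measurable_lebesgue_on borel_measurable_continuous_onI continuous_on_compose2[OF c] continuous_intros) auto

lemma coordinate_fun_bound:
  assumes c: "continuous_on UNIV (c :: complex \<Rightarrow> complex)"
  shows "\<exists>A\<ge>0. \<forall>z\<in>(polydisk :: (complex ^ 'n) set). norm (c (z $ i)) \<le> A"
proof -
  have "compact (c ` cball 0 1)" by (intro compact_continuous_image continuous_on_subset[OF c]) auto
  then obtain A where A: "\<forall>x\<in>c ` cball 0 1. norm x \<le> A" using compact_imp_bounded bounded_iff by metis
  have "norm (c (z $ i)) \<le> max A 0" if "z \<in> polydisk" for z :: "complex ^ 'n"
    using A that by (auto simp: polydisk_iff less_imp_le intro!: max.coboundedI1)
  then show ?thesis by (intro exI[of _ "max A 0"]) auto
qed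

lemma escaping_coordinate_mult:
  fixes v :: "nat \<Rightarrow> complex ^ 'n \<Rightarrow> complex"
  assumes "escaping i v" "continuous_on UNIV (c :: complex \<Rightarrow> complex)"
  shows "escaping i (\<lambda>k z. c (z $ i) * v k z)"
  using coordinate_fun_bound[OF assms(2)] escaping_mult[OF assms(1) borel_coordinate_fun[OF assms(2)]] by blast

lemma L2_coordinate_mult:
  fixes v :: "complex ^ 'n \<Rightarrow> complex"
  assumes "v \<in> L2 polydisk" "continuous_on UNIV (c :: complex \<Rightarrow> complex)"
  shows "(\<lambda>z. c (z $ i) * v z) \<in> L2 polydisk"
  using coordinate_fun_bound[OF assms(2)] L2_mult_bounded(1)[OF assms(1) borel_coordinate_fun[OF assms(2)]] by blast

lemma norm_coordinate_le: "z \<in> polydisk \<Longrightarrow> norm (z $ i) \<le> 1" for z :: "complex ^ 'n"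
  by (simp add: polydisk_iff less_imp_le)

text \<open>With \<open>p = D\<^sub>0 p + z\<^sub>i q\<close>, the function \<open>cnj z\<^sub>i p\<close> differs little from the holomorphic \<open>q\<close>, as \<open>\<bar>z\<^sub>i\<bar>\<close> is
  close to \<open>1\<close> where the mass is.\<close>

lemma hankel_cnj_coordinate_escaping:
  fixes p :: "nat \<Rightarrow> complex ^ 'n \<Rightarrow> complex"
  assumes esc: "escaping i p" and p: "\<And>k. p k \<in> bergman polydisk"
  shows "(\<lambda>k. L2_norm polydisk (\<lambda>z. cnj (z $ i) * p k z - PP (\<lambda>z. cnj (z $ i) * p k z) z)) \<longlonglongrightarrow> 0"
proof -
  let ?m = "\<lambda>z :: complex ^ 'n. complex_of_real (1 - (norm (z $ i))\<^sup>2)"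
  define b where "b = (\<lambda>z :: complex ^ 'n. if norm (z $ i) < 1/2 then 1 else 0 :: complex)"
  define c where "c = (\<lambda>z :: complex ^ 'n. if norm (z $ i) < 1/2 then 0 else inverse (z $ i))"
  have bm: "b \<in> borel_measurable (lebesgue_on polydisk)"
    unfolding b_def by (intro borel_measurable_lebesgue_on borel_disc)
  have "(\<lambda>z. (if norm (z $ i) < 1/2 then 0 else 1) * inverse (z $ i)) \<in> borel_measurable (borel :: (complex ^ 'n) measure)"
  proof (rule borel_measurable_times[OF borel_disc])
    have "(\<lambda>z :: complex ^ 'n. z $ i) \<in> borel_measurable borel"
      by (intro borel_measurable_continuous_onI continuous_intros)
    then show "(\<lambda>z :: complex ^ 'n. inverse (z $ i)) \<in> borel_measurable borel" by measurable
  qed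
  moreover have "c = (\<lambda>z. (if norm (z $ i) < 1/2 then 0 else 1) * inverse (z $ i))"
    by (auto simp: c_def)
  ultimately have cm: "c \<in> borel_measurable (lebesgue_on polydisk)" by (simp add: borel_measurable_lebesgue_on)
  have b1: "norm (b z) \<le> 1" for z by (simp add: b_def)
  have c2: "norm (c z) \<le> 2" for z
    using le_imp_inverse_le[of "1/2" "norm (z $ i)"] by (simp add: c_def norm_inverse)
  have cont_cnj: "continuous_on UNIV cnj" by (intro continuous_intros)
  \<comment> \<open>The factor 2 bounds \<open>inverse (z $ i)\<close> on
    \<open>|z_i| \<ge> 1/2\<close>. The factor 5 is one half of the 10 obtained when the division
    bound is applied to the dilation of \<open>q\<close> by \<open>1/2\<close>.\<close>
  have bound: "L2_norm polydisk (\<lambda>z. cnj (z $ i) * p k z - PP (\<lambda>z. cnj (z $ i) * p k z) z)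
      \<le> 2 * (L2_norm polydisk (\<lambda>z. ?m z * p k z) + L2_norm polydisk (dil i 0 (p k)))
        + L2_norm polydisk (\<lambda>z. b z * p k z)
        + 5 * (L2_norm polydisk (dil i (1/2) (p k)) + L2_norm polydisk (dil i 0 (p k)))" for k
  proof -
    define f where "f = p k"
    have f: "f \<in> bergman polydisk" unfolding f_def by (rule p)
    have fL: "f \<in> L2 polydisk" by (rule bergman_L2[OF f])
    obtain q where q: "mholomorphic_on q polydisk" "\<And>z. z \<in> polydisk \<Longrightarrow> f z = f (upd i 0 z) + z $ i * q z"
      "\<And>z. z \<notin> polydisk \<Longrightarrow> q z = 0"
      using mholomorphic_division[OF bergman_mholomorphic[OF f]] by metis
    have d0: "dil i 0 f \<in> bergman polydisk" by (rule dil_bergman(1)[OF f]) auto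
    have dh: "dil i (1/2) f \<in> bergman polydisk" by (rule dil_bergman(1)[OF f]) auto
    have zq: "z $ i * q z = f z - dil i 0 f z" for z
    proof (cases "z \<in> polydisk")
      case True
      have "sc i 0 z = upd i 0 z" by (simp add: vec_eq_iff)
      then show ?thesis using q(2)[OF True] True by (simp add: dil_def)
    qed (use q(3) bergman_off[OF f] in \<open>auto simp: dil_def\<close>)
    have zqL: "(\<lambda>z. z $ i * q z) \<in> L2 polydisk"
      unfolding zq by (rule L2_diff[OF fL bergman_L2[OF d0]])
    note qb = bergman_coordinate_bounded_below[OF q(1,3) zqL]
    have dq: "dil i (1/2) q \<in> bergman polydisk" by (rule dil_bergman(1)[OF qb(1)]) auto
    \<comment> \<open>The division identity evaluated at half of \<open>z_i\<close>; clearing that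
      half gives the factor 2. Hence the part of \<open>q\<close> on \<open>|z_i| < 1/2\<close> is
      controlled by dilations of \<open>f\<close>, which tend to 0 along the sequence.\<close>
    have zdq: "z $ i * dil i (1/2) q z = 2 * (dil i (1/2) f z - dil i 0 f z)" for z
    proof (cases "z \<in> polydisk")
      case True
      have "sc i (of_real (1/2)) z \<in> polydisk" using sc_in_polydisk[OF True, of "of_real (1/2)" i] by simp
      then show ?thesis using zq[of "sc i (of_real (1/2)) z"] True by (simp add: dil_def field_simps)
    qed (simp add: dil_def)
    have "(\<lambda>z. z $ i * dil i (1/2) q z) \<in> L2 polydisk"
      unfolding zdq by (intro L2_cmult L2_diff bergman_L2 d0 dh)
    then have "L2_norm polydisk (dil i (1/2) q) \<le> 5 * L2_norm polydisk (\<lambda>z. z $ i * dil i (1/2) q z)"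
      using bergman_mholomorphic[OF dq] bergman_off[OF dq] by (intro bergman_coordinate_bounded_below(2)) auto
    also have "\<dots> = 10 * L2_norm polydisk (\<lambda>z. dil i (1/2) f z - dil i 0 f z)"
      unfolding zdq L2_norm_cmult by simp
    also have "\<dots> \<le> 10 * (L2_norm polydisk (dil i (1/2) f) + L2_norm polydisk (dil i 0 f))"
      using L2_triangle_diff[OF bergman_L2[OF dh] bergman_L2[OF d0]] by simp
    finally have dqn: "L2_norm polydisk (dil i (1/2) q) \<le> 10 * (L2_norm polydisk (dil i (1/2) f) + L2_norm polydisk (dil i 0 f))" .
    have bq: "L2_norm polydisk (\<lambda>z. b z * q z) = 1/2 * L2_norm polydisk (dil i (1/2) q)"
      unfolding b_def by (rule dil_norm_disc[OF qb(1)]) auto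
    have cfL: "(\<lambda>z. cnj (z $ i) * f z) \<in> L2 polydisk" by (rule L2_coordinate_mult[OF fL cont_cnj])
    define y where "y z = cnj (z $ i) * f z - q z" for z
    have yL: "y \<in> L2 polydisk" unfolding y_def by (rule L2_diff[OF cfL bergman_L2[OF qb(1)]])
    \<comment> \<open>Multiplying by \<open>z_i\<close> turns \<open>cnj z_i * f\<close> into
      \<open>|z_i|^2 * f\<close> and \<open>q\<close> into \<open>f - D_0 f\<close>, so only the
      escaping weight and \<open>D_0 f\<close> remain.\<close>
    have zy: "z $ i * y z = dil i 0 f z - ?m z * f z" for z
      using zq[of z] by (simp add: y_def right_diff_distrib complex_norm_square mult.assoc[symmetric] del: of_real_power) 
        (simp add: algebra_simps)
    have mfL: "(\<lambda>z. ?m z * f z) \<in> L2 polydisk"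
      by (rule L2_mult_bounded(1)[OF fL borel_measurable_lebesgue_on[OF borel_weight], where B = 1])
        (simp_all only: norm_weight_le zero_le_one)
    have zyL: "(\<lambda>z. z $ i * y z) \<in> L2 polydisk" unfolding zy by (rule L2_diff[OF bergman_L2[OF d0] mfL])
    \<comment> \<open>The factor \<open>z_i\<close> is divided out where
      \<open>|z_i| \<ge> 1/2\<close>. On the small disc both summands of \<open>y\<close> are
      estimated separately.\<close>
    have yeq: "y = (\<lambda>z. (c z * (z $ i * y z) + b z * (cnj (z $ i) * f z)) - b z * q z)"
    proof
      fix z show "y z = (c z * (z $ i * y z) + b z * (cnj (z $ i) * f z)) - b z * q z"
        by (cases "z $ i = 0") (auto simp: c_def b_def y_def)
    qed
    have L: "(\<lambda>z. c z * (z $ i * y z)) \<in> L2 polydisk" "(\<lambda>z. b z * (cnj (z $ i) * f z)) \<in> L2 polydisk" "(\<lambda>z. b z * q z) \<in> L2 polydisk"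
      using L2_mult_bounded(1)[OF zyL cm c2] L2_mult_bounded(1)[OF cfL bm b1] L2_mult_bounded(1)[OF bergman_L2[OF qb(1)] bm b1] by auto
    have bfL: "(\<lambda>z. b z * f z) \<in> L2 polydisk" by (rule L2_mult_bounded(1)[OF fL bm b1]) simp
    have "L2_norm polydisk (\<lambda>z. cnj (z $ i) * f z - PP (\<lambda>z. cnj (z $ i) * f z) z) \<le> L2_norm polydisk y"
      unfolding y_def by (rule bergman_proj_compl_le[OF open_polydisk cfL qb(1)])
    also have "\<dots> \<le> L2_norm polydisk (\<lambda>z. c z * (z $ i * y z) + b z * (cnj (z $ i) * f z)) + L2_norm polydisk (\<lambda>z. b z * q z)"
      by (subst yeq) (intro L2_triangle_diff L2_add L)
    also have "L2_norm polydisk (\<lambda>z. c z * (z $ i * y z) + b z * (cnj (z $ i) * f z))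
      \<le> L2_norm polydisk (\<lambda>z. c z * (z $ i * y z)) + L2_norm polydisk (\<lambda>z. b z * (cnj (z $ i) * f z))"
      by (intro L2_triangle L)
    also have "L2_norm polydisk (\<lambda>z. c z * (z $ i * y z)) \<le> 2 * L2_norm polydisk (\<lambda>z. z $ i * y z)"
      by (rule L2_mult_bounded(2)[OF zyL cm c2]) simp
    also have "L2_norm polydisk (\<lambda>z. z $ i * y z) \<le> L2_norm polydisk (dil i 0 f) + L2_norm polydisk (\<lambda>z. ?m z * f z)"
      unfolding zy by (rule L2_triangle_diff[OF bergman_L2[OF d0] mfL])
    also have "L2_norm polydisk (\<lambda>z. b z * (cnj (z $ i) * f z)) \<le> 1 * L2_norm polydisk (\<lambda>z. b z * f z)"
    proof (rule L2_dominated(2)[OF bfL L2_measurable[OF L(2)]])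
      show "norm (b z * (cnj (z $ i) * f z)) \<le> 1 * norm (b z * f z)" if "z \<in> polydisk" for z
        using norm_coordinate_le[OF that, of i] mult_right_mono[of "norm (z $ i)" 1 "norm (b z) * norm (f z)"]
        by (simp add: norm_mult mult_ac)
    qed simp
    finally show ?thesis using dqn unfolding bq f_def[symmetric] by (simp add: algebra_simps)
  qed
  have l1: "(\<lambda>k. L2_norm polydisk (\<lambda>z. ?m z * p k z)) \<longlonglongrightarrow> 0" using esc by (simp add: escaping_def)
  have l2: "(\<lambda>k. L2_norm polydisk (dil i 0 (p k))) \<longlonglongrightarrow> 0" by (rule escaping_dil[OF esc p]) auto
  have l3: "(\<lambda>k. L2_norm polydisk (dil i (1/2) (p k))) \<longlonglongrightarrow> 0" by (rule escaping_dil[OF esc p]) auto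
  have l4: "(\<lambda>k. L2_norm polydisk (\<lambda>z. b z * p k z)) \<longlonglongrightarrow> 0"
    unfolding b_def by (rule escaping_disc[OF esc]) auto
  have "(\<lambda>k. 2 * (L2_norm polydisk (\<lambda>z. ?m z * p k z) + L2_norm polydisk (dil i 0 (p k)))
        + L2_norm polydisk (\<lambda>z. b z * p k z)
        + 5 * (L2_norm polydisk (dil i (1/2) (p k)) + L2_norm polydisk (dil i 0 (p k)))) \<longlonglongrightarrow> 2 * (0 + 0) + 0 + 5 * (0 + 0)"
    by (intro tendsto_intros l1 l2 l3 l4)
  then show ?thesis by (intro tendsto_zero_le[OF _ L2_norm_nonneg bound]) simp
qed

text \<open>The commutator of \<open>P\<close> with multiplication by \<open>c (z $ i)\<close> tends
  to 0 along every sequence escaping to face \<open>i\<close>. The quantifier over all such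
  sequences, holomorphic or not, is what makes these \<open>c\<close> closed under products.\<close>

definition commutes :: "'n::finite \<Rightarrow> (complex \<Rightarrow> complex) \<Rightarrow> bool" where
  "commutes i c \<longleftrightarrow> continuous_on UNIV c \<and> (\<forall>v. escaping i v \<longrightarrow>
    (\<lambda>k. L2_norm polydisk (\<lambda>z :: complex ^ 'n. PP (\<lambda>z. c (z $ i) * v k z) z - c (z $ i) * PP (v k) z)) \<longlonglongrightarrow> 0)"

lemma commutesD:
  "commutes i c \<Longrightarrow> escaping i v \<Longrightarrow>
    (\<lambda>k. L2_norm polydisk (\<lambda>z. PP (\<lambda>z. c (z $ i) * v k z) z - c (z $ i) * PP (v k) z)) \<longlonglongrightarrow> 0"
  by (simp add: commutes_def)

lemma commutes_continuous: "commutes i c \<Longrightarrow> continuous_on UNIV c"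
  by (simp add: commutes_def)

lemma commutes_const: "commutes i (\<lambda>_. a)"
  by (simp add: commutes_def bergman_proj_cmult[OF open_polydisk escaping_L2])

text \<open>Multiplication by \<open>cnj z_i\<close> preserves the orthogonal complement, so
  \<open>v\<close> may be replaced by \<open>P v\<close>. The commutator is then minus a Hankel
  image of the escaping holomorphic sequence \<open>P v\<close>.\<close>

lemma commutes_cnj: "commutes (i :: 'n::finite) cnj"
  unfolding commutes_def
proof (intro conjI allI impI)
  show cont: "continuous_on UNIV cnj" by (intro continuous_intros)
  fix v :: "nat \<Rightarrow> complex ^ 'n \<Rightarrow> complex" assume v: "escaping i v"
  have "PP (\<lambda>z. cnj (z $ i) * v k z) = PP (\<lambda>z. cnj (z $ i) * PP (v k) z)" for k
  proof -
    note vL = escaping_L2[OF v, of k]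
    define x where "x z = v k z - PP (v k) z" for z
    have x: "x \<in> bergman_perp polydisk" unfolding x_def by (rule PP_perp[OF vL])
    have cx: "(\<lambda>z. cnj (z $ i) * x z) \<in> bergman_perp polydisk"
      by (rule bergman_perp_cnj_mult[OF open_polydisk x mholomorphic_nth norm_coordinate_le]) auto
    have "(\<lambda>z. cnj (z $ i) * v k z) = (\<lambda>z. cnj (z $ i) * PP (v k) z + cnj (z $ i) * x z)"
      by (auto simp: x_def algebra_simps)
    then have "PP (\<lambda>z. cnj (z $ i) * v k z) = (\<lambda>z. PP (\<lambda>z. cnj (z $ i) * PP (v k) z) z + PP (\<lambda>z. cnj (z $ i) * x z) z)"
      using bergman_proj_add[OF open_polydisk L2_coordinate_mult[OF PP_L2[OF vL] cont] bergman_perp_L2[OF open_polydisk cx]] by simp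
    then show ?thesis using bergman_proj_of_perp[OF open_polydisk cx] by simp
  qed
  then have "L2_norm polydisk (\<lambda>z. PP (\<lambda>z. cnj (z $ i) * v k z) z - cnj (z $ i) * PP (v k) z)
    = L2_norm polydisk (\<lambda>z. cnj (z $ i) * PP (v k) z - PP (\<lambda>z. cnj (z $ i) * PP (v k) z) z)" for k
    by (simp add: L2_norm_minus_commute)
  then show "(\<lambda>k. L2_norm polydisk (\<lambda>z. PP (\<lambda>z. cnj (z $ i) * v k z) z - cnj (z $ i) * PP (v k) z)) \<longlonglongrightarrow> 0"
    using hankel_cnj_coordinate_escaping[OF escaping_proj[OF v] PP_in[OF escaping_L2[OF v]]] by simp
qed

text \<open>With \<open>x = v - P v\<close> the commutator is \<open>e = P (z_i x)\<close>. Its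
  squared norm is the inner product of \<open>x\<close> with \<open>cnj z_i * e\<close>, hence with
  \<open>(I - P) (cnj z_i * e)\<close>, and \<open>e\<close> is itself holomorphic and
  escaping.\<close>

lemma commutes_id: "commutes (i :: 'n::finite) (\<lambda>w. w)"
  unfolding commutes_def
proof (intro conjI allI impI)
  show cont: "continuous_on UNIV (\<lambda>w :: complex. w)" by (intro continuous_intros)
  have contc: "continuous_on UNIV cnj" by (intro continuous_intros)
  fix v :: "nat \<Rightarrow> complex ^ 'n \<Rightarrow> complex" assume v: "escaping i v"
  note vL = escaping_L2[OF v]
  define e where "e k z = PP (\<lambda>z. z $ i * v k z) z - z $ i * PP (v k) z" for k z
  obtain B where B: "B \<ge> 0" "\<And>k. L2_norm polydisk (v k) \<le> B" using escaping_bound[OF v] by blast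
  have zvL: "(\<lambda>z. z $ i * v k z) \<in> L2 polydisk" for k by (rule L2_coordinate_mult[OF vL cont])
  have zp: "(\<lambda>z. z $ i * PP (v k) z) \<in> bergman polydisk" for k
    by (rule bergman_mult[OF PP_in[OF vL] mholomorphic_nth norm_coordinate_le open_polydisk]) auto
  have e: "e k \<in> bergman polydisk" for k
    unfolding e_def by (rule bergman_diff[OF PP_in[OF zvL] zp])
  have esc: "escaping i e"
    unfolding e_def by (intro escaping_diff escaping_proj escaping_coordinate_mult[OF v cont] escaping_coordinate_mult[OF escaping_proj[OF v] cont])
  define D where "D k = L2_norm polydisk (\<lambda>z. cnj (z $ i) * e k z - PP (\<lambda>z. cnj (z $ i) * e k z) z)" for k
  have D: "D \<longlonglongrightarrow> 0" unfolding D_def by (rule hankel_cnj_coordinate_escaping[OF esc e])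
  have bound: "(L2_norm polydisk (e k))\<^sup>2 \<le> B * D k" for k
  proof -
    define x where "x z = v k z - PP (v k) z" for z
    have x: "x \<in> bergman_perp polydisk" unfolding x_def by (rule PP_perp[OF vL])
    have xL: "x \<in> L2 polydisk" by (rule bergman_perp_L2[OF open_polydisk x])
    have zxL: "(\<lambda>z. z $ i * x z) \<in> L2 polydisk" by (rule L2_coordinate_mult[OF xL cont])
    define y where "y z = cnj (z $ i) * e k z" for z
    have yL: "y \<in> L2 polydisk" unfolding y_def by (rule L2_coordinate_mult[OF bergman_L2[OF e] contc])
    have "(\<lambda>z. z $ i * x z) = (\<lambda>z. z $ i * v k z - z $ i * PP (v k) z)" by (auto simp: x_def algebra_simps)
    then have "PP (\<lambda>z. z $ i * x z) = e k"
      using bergman_proj_diff[OF open_polydisk zvL bergman_L2[OF zp]] bergman_proj_id[OF open_polydisk zp]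
      by (simp add: e_def[abs_def])
    then have "L2_inner polydisk (e k) (e k) = L2_inner polydisk (\<lambda>z. z $ i * x z) (e k)"
      using bergman_proj_inner[OF open_polydisk zxL e] by metis
    also have "\<dots> = L2_inner polydisk x y" unfolding y_def by (rule L2_inner_mult_left)
    also have "\<dots> = L2_inner polydisk x (\<lambda>z. y z - PP y z)"
      using L2_inner_diff_right[OF yL PP_L2[OF yL] xL] bergman_perp_inner'[OF open_polydisk x PP_in[OF yL]] by simp
    finally have eq: "complex_of_real ((L2_norm polydisk (e k))\<^sup>2) = L2_inner polydisk x (\<lambda>z. y z - PP y z)"
      by (simp only: L2_inner_self)
    have "(L2_norm polydisk (e k))\<^sup>2 = norm (complex_of_real ((L2_norm polydisk (e k))\<^sup>2))"
      unfolding norm_of_real by simp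
    also have "\<dots> \<le> L2_norm polydisk x * L2_norm polydisk (\<lambda>z. y z - PP y z)"
      unfolding eq by (rule L2_Cauchy_Schwarz[OF xL L2_diff[OF yL PP_L2[OF yL]]])
    also have "L2_norm polydisk (\<lambda>z. y z - PP y z) = D k" unfolding D_def y_def[abs_def] ..
    also have "L2_norm polydisk x \<le> B"
      unfolding x_def[abs_def] using bergman_proj_compl_norm_le[OF open_polydisk vL, of k] B(2)[of k] by linarith
    finally show ?thesis by (simp add: D_def mult_right_mono)
  qed
  have "(\<lambda>k. (L2_norm polydisk (e k))\<^sup>2) \<longlonglongrightarrow> 0"
    by (rule tendsto_zero_le[where b = "\<lambda>k. B * D k"]) (use bound tendsto_mult[OF tendsto_const D, of B] in auto)
  then have "(\<lambda>k. sqrt ((L2_norm polydisk (e k))\<^sup>2)) \<longlonglongrightarrow> sqrt 0" by (rule tendsto_real_sqrt)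
  then show "(\<lambda>k. L2_norm polydisk (\<lambda>z. PP (\<lambda>z. z $ i * v k z) z - z $ i * PP (v k) z)) \<longlonglongrightarrow> 0"
    by (simp add: e_def[abs_def])
qed

lemma commutes_add:
  assumes c: "commutes (i :: 'n::finite) c" and d: "commutes i d"
  shows "commutes i (\<lambda>w. c w + d w)"
  unfolding commutes_def
proof (intro conjI allI impI)
  note cc = commutes_continuous[OF c] and dc = commutes_continuous[OF d]
  show "continuous_on UNIV (\<lambda>w. c w + d w)" by (intro continuous_on_add cc dc)
  fix v :: "nat \<Rightarrow> complex ^ 'n \<Rightarrow> complex" assume v: "escaping i v"
  note vL = escaping_L2[OF v]
  note L = L2_coordinate_mult[OF vL cc] L2_coordinate_mult[OF vL dc] L2_coordinate_mult[OF PP_L2[OF vL] cc] L2_coordinate_mult[OF PP_L2[OF vL] dc]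
  let ?X = "\<lambda>k z. PP (\<lambda>z. c (z $ i) * v k z) z - c (z $ i) * PP (v k) z"
  let ?Y = "\<lambda>k z. PP (\<lambda>z. d (z $ i) * v k z) z - d (z $ i) * PP (v k) z"
  have eq: "(\<lambda>z. PP (\<lambda>z. (c (z $ i) + d (z $ i)) * v k z) z - (c (z $ i) + d (z $ i)) * PP (v k) z) = (\<lambda>z. ?X k z + ?Y k z)" for k
    unfolding distrib_right bergman_proj_add[OF open_polydisk L(1,2)] by (simp add: algebra_simps)
  have XL: "?X k \<in> L2 polydisk" "?Y k \<in> L2 polydisk" for k by (intro L2_diff PP_L2 L)+
  show "(\<lambda>k. L2_norm polydisk (\<lambda>z. PP (\<lambda>z. (c (z $ i) + d (z $ i)) * v k z) z - (c (z $ i) + d (z $ i)) * PP (v k) z)) \<longlonglongrightarrow> 0"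
    unfolding eq
    by (rule tendsto_zero_le[OF tendsto_add_zero[OF commutesD[OF c v] commutesD[OF d v]] L2_norm_nonneg L2_triangle[OF XL]])
qed

text \<open>The product rule \<open>[P, c d] = [P, c] d + c [P, d]\<close>, where \<open>d v\<close>
  escapes again and \<open>c\<close> is bounded on the polydisk.\<close>

lemma commutes_mult:
  assumes c: "commutes (i :: 'n::finite) c" and d: "commutes i d"
  shows "commutes i (\<lambda>w. c w * d w)"
  unfolding commutes_def
proof (intro conjI allI impI)
  note cc = commutes_continuous[OF c] and dc = commutes_continuous[OF d]
  show "continuous_on UNIV (\<lambda>w. c w * d w)" by (intro continuous_on_mult cc dc)
  fix v :: "nat \<Rightarrow> complex ^ 'n \<Rightarrow> complex" assume v: "escaping i v"
  note vL = escaping_L2[OF v]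
  have dv: "escaping i (\<lambda>k z. d (z $ i) * v k z)" by (rule escaping_coordinate_mult[OF v dc])
  obtain A where A: "A \<ge> 0" "\<And>z. z \<in> (polydisk :: (complex ^ 'n) set) \<Longrightarrow> norm (c (z $ i)) \<le> A"
    using coordinate_fun_bound[OF cc] by blast
  let ?X = "\<lambda>k z. PP (\<lambda>z. c (z $ i) * (d (z $ i) * v k z)) z - c (z $ i) * PP (\<lambda>z. d (z $ i) * v k z) z"
  let ?Y = "\<lambda>k z. PP (\<lambda>z. d (z $ i) * v k z) z - d (z $ i) * PP (v k) z"
  have eq: "(\<lambda>z. PP (\<lambda>z. c (z $ i) * d (z $ i) * v k z) z - c (z $ i) * d (z $ i) * PP (v k) z) = (\<lambda>z. ?X k z + c (z $ i) * ?Y k z)" for k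
    by (simp add: algebra_simps)
  note dvL = escaping_L2[OF dv]
  have XL: "?X k \<in> L2 polydisk" "?Y k \<in> L2 polydisk" for k
    by (intro L2_diff PP_L2 L2_coordinate_mult[OF _ cc] L2_coordinate_mult[OF _ dc] vL)+
  show "(\<lambda>k. L2_norm polydisk (\<lambda>z. PP (\<lambda>z. c (z $ i) * d (z $ i) * v k z) z - c (z $ i) * d (z $ i) * PP (v k) z)) \<longlonglongrightarrow> 0"
    unfolding eq
  proof (rule tendsto_zero_le)
    have "(\<lambda>k. L2_norm polydisk (?X k) + A * L2_norm polydisk (?Y k)) \<longlonglongrightarrow> 0 + A * 0"
      by (intro tendsto_add tendsto_mult tendsto_const commutesD[OF c dv] commutesD[OF d v])
    then show "(\<lambda>k. L2_norm polydisk (?X k) + A * L2_norm polydisk (?Y k)) \<longlonglongrightarrow> 0" by simp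
    fix k
    have "L2_norm polydisk (\<lambda>z. ?X k z + c (z $ i) * ?Y k z) \<le> L2_norm polydisk (?X k) + L2_norm polydisk (\<lambda>z. c (z $ i) * ?Y k z)"
      by (intro L2_triangle XL L2_coordinate_mult[OF _ cc])
    also have "L2_norm polydisk (\<lambda>z. c (z $ i) * ?Y k z) \<le> A * L2_norm polydisk (?Y k)"
      by (rule L2_mult_bounded(2)[OF XL(2) borel_coordinate_fun[OF cc] A(2) A(1)])
    finally show "L2_norm polydisk (\<lambda>z. ?X k z + c (z $ i) * ?Y k z) \<le> L2_norm polydisk (?X k) + A * L2_norm polydisk (?Y k)" by simp
  qed simp
qed

text \<open>A commutator with \<open>P\<close> has norm at most twice the supremum of the
  multiplier, so uniform approximation on the closed disc suffices. The factor 2 explains the half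
  in \<open>e'\<close>.\<close>

lemma commutes_approx:
  assumes c: "continuous_on UNIV c"
    and ap: "\<And>e. e > 0 \<Longrightarrow> \<exists>d. commutes (i :: 'n::finite) d \<and> (\<forall>w\<in>cball 0 1. norm (c w - d w) \<le> e)"
  shows "commutes i c"
  unfolding commutes_def
proof (intro conjI allI impI)
  show "continuous_on UNIV c" by (rule c)
  fix v :: "nat \<Rightarrow> complex ^ 'n \<Rightarrow> complex" assume v: "escaping i v"
  note vL = escaping_L2[OF v]
  obtain B where B: "B \<ge> 0" "\<And>k. L2_norm polydisk (v k) \<le> B" using escaping_bound[OF v] by blast
  show "(\<lambda>k. L2_norm polydisk (\<lambda>z. PP (\<lambda>z. c (z $ i) * v k z) z - c (z $ i) * PP (v k) z)) \<longlonglongrightarrow> 0"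
  proof (rule tendsto_zero_approx)
    fix e :: real assume e: "e > 0"
    define e' where "e' = e / 2 / (B + 1)"
    have e': "e' > 0" using e B by (simp add: e'_def)
    obtain d where d: "commutes i d" and cd: "\<And>w. w \<in> cball 0 1 \<Longrightarrow> norm (c w - d w) \<le> e'" using ap[OF e'] by blast
    note dc = commutes_continuous[OF d]
    have fc: "continuous_on UNIV (\<lambda>w. c w - d w)" by (intro continuous_on_diff c dc)
    have f1: "norm (c (z $ i) - d (z $ i)) \<le> e'" if "z \<in> polydisk" for z :: "complex ^ 'n"
      by (rule cd) (use norm_coordinate_le[OF that] in auto)
    let ?X = "\<lambda>k z. PP (\<lambda>z. d (z $ i) * v k z) z - d (z $ i) * PP (v k) z"
    let ?Y = "\<lambda>k z. PP (\<lambda>z. (c (z $ i) - d (z $ i)) * v k z) z - (c (z $ i) - d (z $ i)) * PP (v k) z"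
    have bound: "L2_norm polydisk (\<lambda>z. PP (\<lambda>z. c (z $ i) * v k z) z - c (z $ i) * PP (v k) z) \<le> e + L2_norm polydisk (?X k)" for k
    proof -
      note L = L2_coordinate_mult[OF vL dc, of i k] L2_coordinate_mult[OF vL fc, of i k] L2_coordinate_mult[OF PP_L2[OF vL] dc, of i k]
        L2_coordinate_mult[OF PP_L2[OF vL] fc, of i k]
      have "(\<lambda>z. c (z $ i) * v k z) = (\<lambda>z. d (z $ i) * v k z + (c (z $ i) - d (z $ i)) * v k z)" by (simp add: algebra_simps)
      then have eq: "(\<lambda>z. PP (\<lambda>z. c (z $ i) * v k z) z - c (z $ i) * PP (v k) z) = (\<lambda>z. ?X k z + ?Y k z)"
        using bergman_proj_add[OF open_polydisk L(1,2)] by (simp add: algebra_simps)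
      have "L2_norm polydisk (\<lambda>z. PP (\<lambda>z. c (z $ i) * v k z) z - c (z $ i) * PP (v k) z) \<le> L2_norm polydisk (?X k) + L2_norm polydisk (?Y k)"
        unfolding eq by (intro L2_triangle L2_diff PP_L2 L)
      also have "L2_norm polydisk (?Y k) \<le> L2_norm polydisk (PP (\<lambda>z. (c (z $ i) - d (z $ i)) * v k z)) + L2_norm polydisk (\<lambda>z. (c (z $ i) - d (z $ i)) * PP (v k) z)"
        by (intro L2_triangle_diff PP_L2 L)
      also have "L2_norm polydisk (PP (\<lambda>z. (c (z $ i) - d (z $ i)) * v k z)) \<le> L2_norm polydisk (\<lambda>z. (c (z $ i) - d (z $ i)) * v k z)"
        by (rule PP_norm_le[OF L(2)])
      also have "\<dots> \<le> e' * L2_norm polydisk (v k)"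
        by (rule L2_mult_bounded(2)[OF vL borel_coordinate_fun[OF fc] f1]) (use e' in auto)
      also have "L2_norm polydisk (\<lambda>z. (c (z $ i) - d (z $ i)) * PP (v k) z) \<le> e' * L2_norm polydisk (PP (v k))"
        by (rule L2_mult_bounded(2)[OF PP_L2[OF vL] borel_coordinate_fun[OF fc] f1]) (use e' in auto)
      also have "L2_norm polydisk (PP (v k)) \<le> L2_norm polydisk (v k)" by (rule PP_norm_le[OF vL])
      finally have "L2_norm polydisk (\<lambda>z. PP (\<lambda>z. c (z $ i) * v k z) z - c (z $ i) * PP (v k) z)
        \<le> L2_norm polydisk (?X k) + (e' * L2_norm polydisk (v k) + e' * L2_norm polydisk (v k))" using e' by simp
      also have "e' * L2_norm polydisk (v k) \<le> e' * (B + 1)" using B(2)[of k] e' by (intro mult_left_mono) auto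
      also have "e' * (B + 1) = e / 2"
      proof -
        have "B + 1 \<noteq> 0" using B by linarith
        then show ?thesis unfolding e'_def by (rule nonzero_eq_divide_eq[THEN iffD1, OF _ refl])
      qed
      finally show ?thesis by simp
    qed
    show "\<exists>b. b \<longlonglongrightarrow> 0 \<and> (\<forall>k. \<bar>L2_norm polydisk (\<lambda>z. PP (\<lambda>z. c (z $ i) * v k z) z - c (z $ i) * PP (v k) z)\<bar> \<le> e + b k)"
      using bound commutesD[OF d v] by (intro exI[of _ "\<lambda>k. L2_norm polydisk (?X k)"]) auto
  qed
qed

text \<open>A real linear functional on the plane is a complex combination of \<open>w\<close> and
  \<open>cnj w\<close>; sums and products follow by the algebra properties.\<close>

lemma commutes_real_polynomial:
  fixes f :: "complex \<Rightarrow> real"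
  assumes "real_polynomial_function f"
  shows "commutes i (\<lambda>w. of_real (f w))"
  using assms
proof (induction rule: real_polynomial_function.induct)
  case (linear f)
  have eq: "complex_of_real (f w) = (of_real (f 1) / 2 + of_real (f \<i>) / (2 * \<i>)) * w + (of_real (f 1) / 2 - of_real (f \<i>) / (2 * \<i>)) * cnj w" for w
  proof -
    have "w = Re w *\<^sub>R 1 + Im w *\<^sub>R \<i>" by (simp add: complex_eq_iff)
    from arg_cong[OF this, of f] have "f w = f (Re w *\<^sub>R 1 + Im w *\<^sub>R \<i>)" .
    also have "\<dots> = Re w * f 1 + Im w * f \<i>"
      using bounded_linear.linear[OF linear] by (simp only: linear_add linear_scale real_scaleR_def)
    finally have fw: "f w = Re w * f 1 + Im w * f \<i>" .
    have re: "complex_of_real (Re w) = (w + cnj w) / 2" by (simp add: complex_eq_iff)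
    have im: "complex_of_real (Im w) = (w - cnj w) / (2 * \<i>)" by (simp add: complex_eq_iff Re_divide Im_divide)
    have "complex_of_real (f w) = (w + cnj w) / 2 * of_real (f 1) + (w - cnj w) / (2 * \<i>) * of_real (f \<i>)"
      by (simp only: fw of_real_add of_real_mult re im)
    then show ?thesis by (simp add: algebra_simps add_divide_distrib diff_divide_distrib)
  qed
  then obtain a b where "\<And>w. complex_of_real (f w) = a * w + b * cnj w" by blast
  then show ?case by (simp only:) (intro commutes_add commutes_mult commutes_const commutes_id commutes_cnj)
next
  case (const c)
  show ?case by (rule commutes_const)
next
  case (add f g)
  then show ?case using commutes_add[of i "\<lambda>w. of_real (f w)" "\<lambda>w. of_real (g w)"] by simp
next
  case (mult f g)
  then show ?case using commutes_mult[of i "\<lambda>w. of_real (f w)" "\<lambda>w. of_real (g w)"] by simp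
qed

lemma commutes_real_continuous:
  fixes f :: "complex \<Rightarrow> real"
  assumes f: "continuous_on UNIV f"
  shows "commutes i (\<lambda>w. of_real (f w))"
proof (rule commutes_approx)
  show "continuous_on UNIV (\<lambda>w. complex_of_real (f w))" by (intro continuous_on_of_real f)
  fix e :: real assume "e > 0"
  obtain g where g: "real_polynomial_function g" "\<And>w. w \<in> cball 0 1 \<Longrightarrow> \<bar>f w - g w\<bar> < e"
    using Stone_Weierstrass_real_polynomial_function[OF compact_cball continuous_on_subset[OF f] \<open>e > 0\<close>, of 0 1] by auto
  have "norm (complex_of_real (f w) - of_real (g w)) \<le> e" if "w \<in> cball 0 1" for w
    using g(2)[OF that] by (simp flip: of_real_diff)
  then show "\<exists>d. commutes i d \<and> (\<forall>w\<in>cball 0 1. norm (complex_of_real (f w) - d w) \<le> e)"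
    using commutes_real_polynomial[OF g(1)] by (intro exI[of _ "\<lambda>w. of_real (g w)"]) auto
qed

section \<open>Boundary slices\<close>

lemma scaleR_eq_vector_smult: "r *\<^sub>R v = of_real r *s v" for v :: "complex ^ 'n"
proof (unfold vec_eq_iff, intro allI)
  fix i show "(r *\<^sub>R v) $ i = (of_real r *s v) $ i"
    unfolding vector_scaleR_component vector_smult_component by (rule scaleR_conv_of_real)
qed

lemma norm_upd0_le: "norm (upd i 0 h) \<le> norm h"
proof -
  have "L2_set (\<lambda>j. norm (upd i 0 h $ j)) UNIV \<le> L2_set (\<lambda>j. norm (h $ j)) UNIV"
    by (rule L2_set_mono) auto
  then show ?thesis by (simp add: norm_vec_def)
qed

lemma dist_upd: "dist (upd i a z) (upd i b z) = dist a b"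
proof -
  have "(\<Sum>j\<in>UNIV. (dist (upd i a z $ j) (upd i b z $ j))\<^sup>2) = (\<Sum>j\<in>{i}. (dist (upd i a z $ j) (upd i b z $ j))\<^sup>2)"
    by (rule sum.mono_neutral_right) auto
  then show ?thesis by (simp add: dist_vec_def L2_set_def)
qed

lemma upd_in_closure: "z \<in> polydisk \<Longrightarrow> norm w \<le> 1 \<Longrightarrow> upd i w z \<in> closure polydisk"
  by (auto simp: closure_polydisk polydisk_iff less_imp_le)

text \<open>The slices \<open>z_i = r k * w\<close> with \<open>r k < 1\<close> lie inside the
  polydisk. The extended derivative is uniformly continuous on the compact closure, so the
  derivatives along these slices converge uniformly and the limit slice is differentiable.\<close>

lemma C1_slice_derivative:
  fixes \<phi> :: "complex ^ 'n \<Rightarrow> complex"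
  assumes \<phi>: "\<phi> \<in> C1_closure polydisk" and w: "norm w = 1"
  obtains E where "\<And>z. z \<in> polydisk \<Longrightarrow> ((\<lambda>z. \<phi> (upd i w z)) has_derivative E z) (at z)"
proof -
  obtain D :: "complex ^ 'n \<Rightarrow> (complex ^ 'n) \<Rightarrow>\<^sub>L complex" where D: "continuous_on (closure polydisk) D"
    "\<And>z. z \<in> polydisk \<Longrightarrow> (\<phi> has_derivative blinfun_apply (D z)) (at z)"
    and c: "continuous_on (closure polydisk) \<phi>"
    using \<phi> unfolding C1_closure_def by blast
  define r where "r k = 1 - 1 / real (Suc k)" for k
  have r: "0 \<le> r k" "r k < 1" for k by (auto simp: r_def field_simps)
  have rlim: "(\<lambda>k. of_real (r k) * w) \<longlonglongrightarrow> of_real 1 * w"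
  proof (intro tendsto_intros)
    show "r \<longlonglongrightarrow> 1" unfolding r_def using LIMSEQ_inverse_real_of_nat_add_minus[of 1] by (simp add: divide_inverse)
  qed
  have inp: "upd i (of_real (r k) * w) z \<in> polydisk" if "z \<in> polydisk" for z k
    using r[of k] w that by (intro upd_in_polydisk) (auto simp: norm_mult)
  have lim: "(\<lambda>k. \<phi> (upd i (of_real (r k) * w) z)) \<longlonglongrightarrow> \<phi> (upd i w z)" if z: "z \<in> polydisk" for z
  proof (rule continuous_on_tendsto_compose[OF c])
    have "isCont (\<lambda>a. upd i a z) (1 * w)"
      using continuous_on_upd[OF continuous_on_id continuous_on_const, of UNIV i z] by (simp add: continuous_on_eq_continuous_at)
    from isCont_tendsto_compose[OF this] rlim
    show "(\<lambda>k. upd i (of_real (r k) * w) z) \<longlonglongrightarrow> upd i w z" by simp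
    show "upd i w z \<in> closure polydisk" using z w by (intro upd_in_closure) auto
    show "\<forall>\<^sub>F k in sequentially. upd i (of_real (r k) * w) z \<in> closure polydisk"
      using inp[OF z] closure_subset by (intro always_eventually) blast
  qed
  \<comment> \<open>Coordinate \<open>i\<close> is frozen, so the derivative sees only the increment
    with that coordinate set to 0.\<close>
  define E where "E z = (\<lambda>h. blinfun_apply (D (upd i w z)) (upd i 0 h))" for z
  have "\<exists>g. \<forall>x\<in>polydisk. (\<lambda>k. \<phi> (upd i (of_real (r k) * w) x)) \<longlonglongrightarrow> g x \<and> (g has_derivative E x) (at x within polydisk)"
  proof (rule has_derivative_sequence[where f' = "\<lambda>k z h. blinfun_apply (D (upd i (of_real (r k) * w) z)) (upd i 0 h)" and ?x0.0 = 0])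
    show "convex (polydisk :: (complex ^ 'n) set)" by (rule convex_polydisk)
    show "0 \<in> polydisk" by (simp add: polydisk_iff)
    then show "(\<lambda>k. \<phi> (upd i (of_real (r k) * w) 0)) \<longlonglongrightarrow> \<phi> (upd i w 0)" by (rule lim)
    show "((\<lambda>z. \<phi> (upd i (of_real (r k) * w) z)) has_derivative (\<lambda>h. blinfun_apply (D (upd i (of_real (r k) * w) x)) (upd i 0 h))) (at x within polydisk)"
      if "x \<in> polydisk" for k x
      by (rule has_derivative_compose[OF has_derivative_upd D(2)[OF inp[OF that]]])
    fix e :: real assume e: "e > 0"
    have "uniformly_continuous_on (closure polydisk) D"
      by (rule compact_uniformly_continuous[OF D(1) compact_closure_polydisk])
    then obtain d where d: "d > 0" "\<And>x y. x \<in> closure polydisk \<Longrightarrow> y \<in> closure polydisk \<Longrightarrow> dist y x < d \<Longrightarrow> dist (D y) (D x) < e"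
      using e unfolding uniformly_continuous_on_def by metis
    have "\<forall>\<^sub>F k in sequentially. dist (of_real (r k) * w) (of_real 1 * w) < d"
      using rlim d(1) by (rule tendstoD)
    then show "\<forall>\<^sub>F k in sequentially. \<forall>x\<in>polydisk. \<forall>h. norm (blinfun_apply (D (upd i (of_real (r k) * w) x)) (upd i 0 h) - E x h) \<le> e * norm h"
    proof eventually_elim
      case (elim k)
      show ?case
      proof (intro ballI allI)
        fix x h :: "complex ^ 'n" assume x: "x \<in> polydisk"
        have "dist (D (upd i (of_real (r k) * w) x)) (D (upd i w x)) < e"
          using elim inp[OF x, of k] closure_subset x w by (intro d(2)) (auto simp: dist_upd intro: upd_in_closure)
        then have "norm (D (upd i (of_real (r k) * w) x) - D (upd i w x)) \<le> e" by (simp add: dist_norm)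
        moreover have "norm (blinfun_apply (D (upd i (of_real (r k) * w) x)) (upd i 0 h) - E x h)
          \<le> norm (D (upd i (of_real (r k) * w) x) - D (upd i w x)) * norm (upd i 0 h)"
          unfolding E_def blinfun.diff_left[symmetric] by (rule norm_blinfun)
        ultimately show "norm (blinfun_apply (D (upd i (of_real (r k) * w) x)) (upd i 0 h) - E x h) \<le> e * norm h"
          using norm_upd0_le[of i h] e by (meson mult_mono norm_ge_zero order_trans less_imp_le)
      qed
    qed
  qed
  then obtain g where g: "\<And>x. x \<in> polydisk \<Longrightarrow> (\<lambda>k. \<phi> (upd i (of_real (r k) * w) x)) \<longlonglongrightarrow> g x"
    "\<And>x. x \<in> polydisk \<Longrightarrow> (g has_derivative E x) (at x within polydisk)" by blast
  have geq: "g x = \<phi> (upd i w x)" if "x \<in> polydisk" for x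
    using LIMSEQ_unique[OF g(1)[OF that] lim[OF that]] .
  have "((\<lambda>z. \<phi> (upd i w z)) has_derivative E z) (at z)" if z: "z \<in> polydisk" for z
  proof -
    have "(g has_derivative E z) (at z)" using g(2)[OF z] at_within_open[OF z open_polydisk] by simp
    then show ?thesis by (rule has_derivative_transform_within_open[OF _ open_polydisk z]) (rule geq)
  qed
  then show thesis using that by blast
qed

section \<open>Analytic discs with two prescribed points and velocities\<close>

lemma has_derivative_smult_curve:
  fixes v :: "complex ^ 'n"
  assumes "(f has_field_derivative f') (at \<zeta>)"
  shows "((\<lambda>\<zeta>. f \<zeta> *s v) has_derivative (\<lambda>\<eta>. (f' * \<eta>) *s v)) (at \<zeta>)"
  using bounded_linear.has_derivative[OF bounded_linear_vector_smult_left assms[unfolded has_field_derivative_def]] .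

text \<open>Cubic Hermite interpolation with velocities shrunk by a common factor \<open>s\<close>,
  so that the curve over \<open>{0..1}\<close> stays near the segment from \<open>z0\<close> to
  \<open>z1\<close>, which lies in the convex polydisk. The domain \<open>V\<close> is made convex
  and bounded with a view to the Riemann mapping theorem.\<close>

lemma hermite_curve:
  fixes z0 z1 v0 v1 :: "complex ^ 'n"
  assumes z: "z0 \<in> polydisk" "z1 \<in> polydisk"
  obtains Q :: "complex \<Rightarrow> complex ^ 'n" and V s where "open V" "convex V" "bounded V" "0 \<in> V" "1 \<in> V" "\<And>\<zeta>. \<zeta> \<in> V \<Longrightarrow> Q \<zeta> \<in> polydisk" "(s :: real) > 0"
    "\<And>j. (\<lambda>\<zeta>. Q \<zeta> $ j) holomorphic_on UNIV" "Q 0 = z0" "Q 1 = z1"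
    "(Q has_derivative (\<lambda>\<eta>. (of_real s * \<eta>) *s v0)) (at 0)" "(Q has_derivative (\<lambda>\<eta>. (of_real s * \<eta>) *s v1)) (at 1)"
proof -
  let ?S = "closed_segment z0 z1"
  have "?S \<subseteq> polydisk" using z convex_polydisk by (rule closed_segment_subset)
  then obtain e where e: "e > 0" "{x. infdist x ?S \<le> e} \<subseteq> polydisk"
    using compact_in_open_separated[of ?S polydisk] open_polydisk compact_segment by (metis ends_in_segment(1) empty_iff)
  \<comment> \<open>The velocity terms have size at most \<open>s * (norm v0 + norm v1)\<close>; the
    added 1 keeps the denominator positive.\<close>
  define s where "s = e / (norm v0 + norm v1 + 1)"
  have den: "norm v0 + norm v1 + 1 > 0" by (simp add: add_nonneg_pos)
  have s: "s > 0" using e den by (simp add: s_def)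
  have ssmall: "s * (norm v0 + norm v1) \<le> e"
  proof -
    have "s * (norm v0 + norm v1) \<le> s * (norm v0 + norm v1 + 1)" using s by (intro mult_left_mono) auto
    also have "\<dots> = e" using den by (simp add: s_def)
    finally show ?thesis .
  qed
  \<comment> \<open>The Hermite basis: \<open>a\<close> rises from 0 to 1 with vanishing derivative
    at both ends, while \<open>b\<close> and \<open>c\<close> vanish at both ends and have
    derivative \<open>s\<close> only at 0 and only at 1, respectively.\<close>
  define a b c where "a \<zeta> = 3 * \<zeta>\<^sup>2 - 2 * \<zeta> ^ 3" and "b \<zeta> = of_real s * (\<zeta> * (1 - \<zeta>)\<^sup>2)" and "c \<zeta> = of_real s * (\<zeta>\<^sup>2 * (\<zeta> - 1))" for \<zeta> :: complex
  define Q where "Q \<zeta> = z0 + (a \<zeta> *s (z1 - z0) + (b \<zeta> *s v0 + c \<zeta> *s v1))" for \<zeta>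
  have real: "Q (of_real t) \<in> polydisk" if t: "0 \<le> t" "t \<le> 1" for t
  proof -
    let ?u = "3 * t\<^sup>2 - 2 * t ^ 3"
    have "0 \<le> t\<^sup>2 * (3 - 2 * t)" "0 \<le> (1 - t)\<^sup>2 * (1 + 2 * t)" using t by auto
    then have u: "0 \<le> ?u" "?u \<le> 1" by (simp_all add: power2_eq_square power3_eq_cube algebra_simps)
    define x where "x = z0 + a (of_real t) *s (z1 - z0)"
    have "x = (1 - ?u) *\<^sub>R z0 + ?u *\<^sub>R z1"
      unfolding x_def a_def scaleR_eq_vector_smult by (simp add: vec_eq_iff algebra_simps)
    then have xS: "x \<in> ?S" using u unfolding in_segment by blast
    have p1: "\<bar>t * (1 - t)\<^sup>2\<bar> \<le> 1" "\<bar>t\<^sup>2 * (t - 1)\<bar> \<le> 1"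
    proof -
      have "t * (1 - t)\<^sup>2 \<le> 1 * 1" using t by (intro mult_mono) (auto simp: power_le_one)
      then show "\<bar>t * (1 - t)\<^sup>2\<bar> \<le> 1" using t by simp
      have "t\<^sup>2 * (1 - t) \<le> 1 * 1" using t by (intro mult_mono) (auto simp: power_le_one)
      then show "\<bar>t\<^sup>2 * (t - 1)\<bar> \<le> 1" using t by (simp add: abs_mult)
    qed
    have b1: "norm (b (of_real t)) \<le> s" 
    proof -
      have "b (of_real t) = of_real (s * (t * (1 - t)\<^sup>2))" by (simp add: b_def)
      then have "norm (b (of_real t)) = s * \<bar>t * (1 - t)\<^sup>2\<bar>" using s by (simp only: norm_of_real abs_mult abs_of_pos)
      also have "\<dots> \<le> s * 1" using s p1(1) by (intro mult_left_mono) auto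
      finally show ?thesis by simp
    qed
    have c1: "norm (c (of_real t)) \<le> s"
    proof -
      have "c (of_real t) = of_real (s * (t\<^sup>2 * (t - 1)))" by (simp add: c_def)
      then have "norm (c (of_real t)) = s * \<bar>t\<^sup>2 * (t - 1)\<bar>" using s by (simp only: norm_of_real abs_mult abs_of_pos)
      also have "\<dots> \<le> s * 1" using s p1(2) by (intro mult_left_mono) auto
      finally show ?thesis by simp
    qed
    have "dist (Q (of_real t)) x \<le> norm (b (of_real t) *s v0) + norm (c (of_real t) *s v1)"
      unfolding dist_norm Q_def x_def using norm_triangle_ineq by (simp add: algebra_simps)
    also have "\<dots> \<le> s * norm v0 + s * norm v1"
      unfolding norm_vector_smult using b1 c1 by (intro add_mono mult_right_mono) auto
    also have "\<dots> \<le> e" using ssmall by (simp add: distrib_left)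
    finally have "infdist (Q (of_real t)) ?S \<le> e" using infdist_le[OF xS] order_trans by blast
    then show ?thesis using e by blast
  qed
  have contQ: "continuous_on UNIV Q"
  proof -
    have sm: "continuous_on UNIV (\<lambda>\<zeta>. f \<zeta> *s v)" if "continuous_on UNIV f" for f :: "complex \<Rightarrow> complex" and v :: "complex ^ 'n"
      using that unfolding vector_scalar_mult_def by (intro continuous_on_vec_lambda continuous_intros)
    show ?thesis unfolding Q_def a_def b_def c_def by (intro continuous_on_add sm continuous_intros)
  qed
  define U where "U = Q -` polydisk"
  have U: "open U" unfolding U_def by (rule open_vimage[OF open_polydisk contQ])
  let ?I = "closed_segment (0 :: complex) 1"
  have "?I \<subseteq> U"
  proof
    fix \<zeta> assume "\<zeta> \<in> ?I"
    then obtain t where "0 \<le> t" "t \<le> 1" "\<zeta> = of_real t"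
      by (auto simp: in_segment scaleR_conv_of_real)
    then show "\<zeta> \<in> U" using real by (simp add: U_def)
  qed
  then obtain d where d: "d > 0" "{x. infdist x ?I \<le> d} \<subseteq> U"
    using compact_in_open_separated[of ?I U] U compact_segment by (metis ends_in_segment(1) empty_iff)
  \<comment> \<open>A tube about the segment. It is the Minkowski sum of the segment and a disc,
    hence convex.\<close>
  define V where "V = (\<Union>x\<in>?I. ball x d)"
  have "V = (\<Union>x\<in>?I. \<Union>y\<in>ball 0 d. {x + y})"
  proof -
    have bl: "ball x d = (\<Union>y\<in>ball 0 d. {x + y})" for x :: complex
    proof -
      have "w \<in> (\<Union>y\<in>ball 0 d. {x + y})" if "w \<in> ball x d" for w
        using that by (intro UN_I[of "w - x"]) (auto simp: dist_norm norm_minus_commute)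
      then show ?thesis by (auto simp: dist_norm)
    qed
    show ?thesis unfolding V_def by (rule SUP_cong[OF refl bl])
  qed
  then have "convex V" by (simp add: convex_sums)
  moreover have "open V" unfolding V_def by auto
  moreover have "bounded V"
  proof -
    have "V \<subseteq> ball 0 (1 + d)"
    proof
      fix w assume "w \<in> V"
      then obtain x where x: "x \<in> ?I" "dist x w < d" by (auto simp: V_def)
      then have "norm x \<le> 1" by (auto simp: in_segment)
      then show "w \<in> ball 0 (1 + d)" using x(2) norm_triangle_sub[of w x] by (simp add: dist_norm norm_minus_commute)
    qed
    then show ?thesis using bounded_ball bounded_subset by blast
  qed
  moreover have "0 \<in> V" "1 \<in> V"
  proof -
    have "x \<in> V" if "x \<in> ?I" for x using that d(1) unfolding V_def by (intro UN_I[of x]) auto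
    then show "0 \<in> V" "1 \<in> V" by auto
  qed
  moreover have "Q \<zeta> \<in> polydisk" if "\<zeta> \<in> V" for \<zeta>
  proof -
    obtain x where x: "x \<in> ?I" "dist x \<zeta> < d" using \<open>\<zeta> \<in> V\<close> by (auto simp: V_def)
    then have "infdist \<zeta> ?I \<le> d" using infdist_le[OF x(1), of \<zeta>] by (simp add: dist_commute)
    then show ?thesis using d by (auto simp: U_def)
  qed
  moreover have "(\<lambda>\<zeta>. Q \<zeta> $ j) holomorphic_on UNIV" for j
    unfolding Q_def a_def b_def c_def by (simp) (intro holomorphic_intros)
  moreover have "Q 0 = z0" "Q 1 = z1" by (simp_all add: Q_def a_def b_def c_def vec_eq_iff)
  moreover have dQ: "(Q has_derivative (\<lambda>\<eta>. ((6 * \<zeta> - 6 * \<zeta>\<^sup>2) * \<eta>) *s (z1 - z0) + (((of_real s * ((1 - \<zeta>)\<^sup>2 - 2 * \<zeta> * (1 - \<zeta>))) * \<eta>) *s v0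
      + ((of_real s * (3 * \<zeta>\<^sup>2 - 2 * \<zeta>)) * \<eta>) *s v1))) (at \<zeta>)" for \<zeta>
  proof -
    have a: "(a has_field_derivative (6 * \<zeta> - 6 * \<zeta>\<^sup>2)) (at \<zeta>)"
      unfolding a_def by (rule derivative_eq_intros refl | simp)+
    have b: "(b has_field_derivative (of_real s * ((1 - \<zeta>)\<^sup>2 - 2 * \<zeta> * (1 - \<zeta>)))) (at \<zeta>)"
      unfolding b_def by (rule derivative_eq_intros refl | simp add: algebra_simps)+
    have c: "(c has_field_derivative (of_real s * (3 * \<zeta>\<^sup>2 - 2 * \<zeta>))) (at \<zeta>)"
      unfolding c_def by (rule derivative_eq_intros refl | simp add: algebra_simps power2_eq_square)+
    have "(Q has_derivative (\<lambda>\<eta>. 0 + (((6 * \<zeta> - 6 * \<zeta>\<^sup>2) * \<eta>) *s (z1 - z0) + (((of_real s * ((1 - \<zeta>)\<^sup>2 - 2 * \<zeta> * (1 - \<zeta>))) * \<eta>) *s v0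
      + ((of_real s * (3 * \<zeta>\<^sup>2 - 2 * \<zeta>)) * \<eta>) *s v1)))) (at \<zeta>)"
      unfolding Q_def
      by (intro has_derivative_add has_derivative_const has_derivative_smult_curve a b c)
    then show ?thesis by simp
  qed
  moreover have "(Q has_derivative (\<lambda>\<eta>. (of_real s * \<eta>) *s v0)) (at 0)" "(Q has_derivative (\<lambda>\<eta>. (of_real s * \<eta>) *s v1)) (at 1)"
    using dQ[of 0] dQ[of 1] by simp_all
  ultimately show thesis using that s by blast
qed

text \<open>If \<open>\<phi>\<close> failed the Cauchy-Riemann equations at \<open>z0\<close> in direction \<open>v0\<close> and \<open>\<psi>\<close> at \<open>z1\<close> in direction \<open>v1\<close>,
  a disc through \<open>z0\<close> and \<open>z1\<close> with these velocities would contradict the hypothesis.\<close>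

lemma slice_dichotomy:
  fixes \<phi> \<psi> :: "complex ^ 'n \<Rightarrow> complex"
  assumes \<phi>: "\<phi> \<in> C1_closure polydisk" and \<psi>: "\<psi> \<in> C1_closure polydisk"
    and disc: "\<And>g :: complex \<Rightarrow> complex ^ 'n.
           (\<forall>j. (\<lambda>\<zeta>. g \<zeta> $ j) holomorphic_on ball 0 1) \<Longrightarrow>
           g ` ball 0 1 \<subseteq> frontier polydisk \<Longrightarrow>
           (\<phi> \<circ> g) holomorphic_on ball 0 1 \<or> (\<psi> \<circ> g) holomorphic_on ball 0 1"
    and w: "norm w = 1"
  shows "mholomorphic_on (\<lambda>z. \<phi> (upd i w z)) polydisk \<or> mholomorphic_on (\<lambda>z. \<psi> (upd i w z)) polydisk"
proof (rule ccontr)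
  assume neg: "\<not> ?thesis"
  obtain E where E: "\<And>z. z \<in> polydisk \<Longrightarrow> ((\<lambda>z. \<phi> (upd i w z)) has_derivative E z) (at z)"
    using C1_slice_derivative[OF \<phi> w] by metis
  obtain F where F: "\<And>z. z \<in> polydisk \<Longrightarrow> ((\<lambda>z. \<psi> (upd i w z)) has_derivative F z) (at z)"
    using C1_slice_derivative[OF \<psi> w] by metis
  obtain z0 c0 v0 where 0: "z0 \<in> polydisk" "E z0 (c0 *s v0) \<noteq> c0 * E z0 v0"
    using neg E unfolding mholomorphic_on_def by blast
  obtain z1 c1 v1 where 1: "z1 \<in> polydisk" "F z1 (c1 *s v1) \<noteq> c1 * F z1 v1"
    using neg F unfolding mholomorphic_on_def by blast
  obtain Q :: "complex \<Rightarrow> complex ^ 'n" and V s where V: "open V" "convex V" "bounded V" "0 \<in> V" "1 \<in> V" "\<And>\<zeta>. \<zeta> \<in> V \<Longrightarrow> Q \<zeta> \<in> polydisk" and s: "(s :: real) > 0"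
    and Q: "\<And>j. (\<lambda>\<zeta>. Q \<zeta> $ j) holomorphic_on UNIV" "Q 0 = z0" "Q 1 = z1"
    "(Q has_derivative (\<lambda>\<eta>. (of_real s * \<eta>) *s v0)) (at 0)" "(Q has_derivative (\<lambda>\<eta>. (of_real s * \<eta>) *s v1)) (at 1)"
    by (rule hermite_curve[OF 0(1) 1(1), of v0 v1]) blast
  \<comment> \<open>The hypothesis speaks of discs parametrised by \<open>ball 0 1\<close>, so the
    Riemann map of \<open>V\<close> is used to reparametrise the curve; freezing coordinate
    \<open>i\<close> at \<open>w\<close> puts it on the boundary.\<close>
  have "V \<noteq> {}" "V \<noteq> UNIV" using V(3,4) not_bounded_UNIV by auto
  moreover have "simply_connected V" by (rule convex_imp_simply_connected[OF V(2)])
  ultimately obtain f g where f: "f holomorphic_on V" and g: "g holomorphic_on ball 0 1"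
    and fg: "\<And>z. z \<in> V \<Longrightarrow> f z \<in> ball 0 1" "\<And>z. z \<in> V \<Longrightarrow> g (f z) = z" "\<And>z. z \<in> ball 0 1 \<Longrightarrow> g z \<in> V"
    using Riemann_mapping_theorem[of V] V(1) by metis
  define G where "G \<zeta> = upd i w (Q (g \<zeta>))" for \<zeta>
  have Ghol: "\<forall>j. (\<lambda>\<zeta>. G \<zeta> $ j) holomorphic_on ball 0 1"
  proof
    fix j
    have "((\<lambda>\<zeta>. Q \<zeta> $ j) \<circ> g) holomorphic_on ball 0 1"
      by (rule holomorphic_on_compose[OF g holomorphic_on_subset[OF Q(1)]]) auto
    then show "(\<lambda>\<zeta>. G \<zeta> $ j) holomorphic_on ball 0 1" by (cases "j = i") (simp_all add: G_def comp_def)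
  qed
  have Gfr: "G ` ball 0 1 \<subseteq> frontier polydisk"
  proof clarify
    fix \<zeta> :: complex assume "\<zeta> \<in> ball 0 1"
    then have "Q (g \<zeta>) \<in> polydisk" using V(6) fg(3) by blast
    then show "G \<zeta> \<in> frontier polydisk" using w unfolding G_def frontier_polydisk_iff polydisk_iff by (auto simp: less_imp_le)
  qed
  have key: "L (c *s v) = c * L v"
    if hol: "(\<theta> \<circ> G) holomorphic_on ball 0 1" and x: "x \<in> V" "Q x = p" "(Q has_derivative (\<lambda>\<eta>. (of_real s * \<eta>) *s v)) (at x)"
      and L: "((\<lambda>z. \<theta> (upd i w z)) has_derivative L) (at p)" for \<theta> x p v c and L :: "complex ^ 'n \<Rightarrow> complex"
  proof -
    have "((\<theta> \<circ> G) \<circ> f) holomorphic_on V"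
      by (rule holomorphic_on_compose[OF f holomorphic_on_subset[OF hol]]) (use fg(1) in auto)
    then have "(\<lambda>\<zeta>. \<theta> (upd i w (Q \<zeta>))) holomorphic_on V"
      by (rule holomorphic_transform) (simp add: G_def fg)
    then obtain l where "((\<lambda>\<zeta>. \<theta> (upd i w (Q \<zeta>))) has_field_derivative l) (at x)"
      using V(1) x(1) holomorphic_on_imp_differentiable_at field_differentiable_def by blast
    then have 1: "((\<lambda>\<zeta>. \<theta> (upd i w (Q \<zeta>))) has_derivative (\<lambda>\<eta>. l * \<eta>)) (at x)"
      by (simp add: has_field_derivative_def)
    have 2: "((\<lambda>\<zeta>. \<theta> (upd i w (Q \<zeta>))) has_derivative (\<lambda>\<eta>. L ((of_real s * \<eta>) *s v))) (at x)"
      by (rule has_derivative_compose[OF x(3)]) (simp add: x(2) L)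
    have eq: "l * \<eta> = L ((of_real s * \<eta>) *s v)" for \<eta>
      using has_derivative_unique[OF 1 2] by (rule fun_cong)
    \<comment> \<open>\<open>L\<close> is only known to be real linear here, so it matters that the
      velocity factor \<open>s\<close> is real.\<close>
    have Ls: "L ((of_real s * \<eta>) *s v) = of_real s * L (\<eta> *s v)" for \<eta>
    proof -
      have e: "(of_real s * \<eta>) *s v = s *\<^sub>R (\<eta> *s v)" unfolding scaleR_eq_vector_smult by (simp add: vec_eq_iff)
      show ?thesis unfolding e linear_scale[OF has_derivative_linear[OF L]] by (rule scaleR_conv_of_real)
    qed
    have A: "of_real s * L (c *s v) = l * c" using eq[of c] Ls[of c] by metis
    have B: "l = of_real s * L v" using eq[of 1] Ls[of 1] by (simp only: mult_1_right vector_smult_lid)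
    have "of_real s * L (c *s v) = of_real s * (c * L v)" unfolding A B by (simp only: mult_ac)
    then show ?thesis using s by simp
  qed
  from disc[OF Ghol Gfr] show False
  proof
    assume "(\<phi> \<circ> G) holomorphic_on ball 0 1"
    from key[OF this V(4) Q(2,4) E[OF 0(1)]] 0(2) show False by blast
  next
    assume "(\<psi> \<circ> G) holomorphic_on ball 0 1"
    from key[OF this V(5) Q(3,5) F[OF 1(1)]] 1(2) show False by blast
  qed
qed

section \<open>Hankel operators\<close>

lemma L2_norm_sum_le:
  "finite A \<Longrightarrow> (\<And>a. a \<in> A \<Longrightarrow> f a \<in> L2 \<Omega>) \<Longrightarrow> L2_norm \<Omega> (\<lambda>z. \<Sum>a\<in>A. f a z) \<le> (\<Sum>a\<in>A. L2_norm \<Omega> (f a))"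
proof (induction A rule: finite_induct)
  case (insert x F)
  have "L2_norm \<Omega> (\<lambda>z. f x z + (\<Sum>a\<in>F. f a z)) \<le> L2_norm \<Omega> (f x) + L2_norm \<Omega> (\<lambda>z. \<Sum>a\<in>F. f a z)"
    using insert by (intro L2_triangle L2_sum) auto
  then show ?case using insert by simp
qed simp

text \<open>Measurability and an explicit bound travel together. The bound is a parameter because a
  symbol and its freezing error need different sizes.\<close>

definition multiplier :: "real \<Rightarrow> (complex ^ 'n \<Rightarrow> complex) \<Rightarrow> bool" where
  "multiplier M a \<longleftrightarrow> 0 \<le> M \<and> a \<in> borel_measurable (lebesgue_on polydisk) \<and> (\<forall>z\<in>polydisk. norm (a z) \<le> M)"

lemma multiplier_L2: "multiplier M a \<Longrightarrow> v \<in> L2 polydisk \<Longrightarrow> (\<lambda>z. a z * v z) \<in> L2 polydisk"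
  unfolding multiplier_def using L2_mult_bounded(1)[of v polydisk a M] by blast

lemma multiplier_norm:
  "multiplier M a \<Longrightarrow> v \<in> L2 polydisk \<Longrightarrow> L2_norm polydisk (\<lambda>z. a z * v z) \<le> M * L2_norm polydisk v"
  unfolding multiplier_def using L2_mult_bounded(2)[of v polydisk a M] by blast

lemma multiplier_escaping: "multiplier M a \<Longrightarrow> escaping i v \<Longrightarrow> escaping i (\<lambda>k z. a z * v k z)"
  unfolding multiplier_def using escaping_mult[of i v a M] by blast

lemma multiplier_cnj: "multiplier M a \<Longrightarrow> multiplier M (\<lambda>z. cnj (a z))"
  unfolding multiplier_def using borel_measurable_cnj by auto

lemma multiplier_continuous:
  assumes "continuous_on polydisk a" "0 \<le> M" "\<And>z. z \<in> polydisk \<Longrightarrow> norm (a z) \<le> M"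
  shows "multiplier M (a :: complex ^ 'n \<Rightarrow> complex)"
  unfolding multiplier_def using assms open_polydisk
  by (auto intro!: continuous_imp_measurable_on_sets_lebesgue)

lemma continuous_closure_bound:
  fixes \<phi> :: "complex ^ 'n \<Rightarrow> complex"
  assumes "continuous_on (closure polydisk) \<phi>"
  shows "\<exists>M\<ge>0. \<forall>z\<in>closure polydisk. norm (\<phi> z) \<le> M"
proof -
  have "bounded (\<phi> ` closure polydisk)"
    using compact_continuous_image[OF assms compact_closure_polydisk] by (rule compact_imp_bounded)
  then obtain M where "\<forall>x\<in>\<phi> ` closure polydisk. norm x \<le> M" unfolding bounded_iff by blast
  then have "\<forall>z\<in>closure polydisk. norm (\<phi> z) \<le> max M 0" by (auto intro: max.coboundedI1)
  then show ?thesis by (intro exI[of _ "max M 0"]) auto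
qed

text \<open>Tent functions centred at a finite net of the circle, divided by a common denominator.
  Flooring this denominator at \<open>d / 2\<close> keeps the quotients continuous on the whole
  plane, and near the circle the floor is inactive.\<close>

lemma circle_partition:
  assumes "\<delta> > 0"
  obtains \<Theta> and \<kappa> :: "complex \<Rightarrow> complex \<Rightarrow> real" and r where "finite \<Theta>" "\<And>w. w \<in> \<Theta> \<Longrightarrow> norm w = 1"
    "\<And>w. continuous_on UNIV (\<kappa> w)" "\<And>w x. 0 \<le> \<kappa> w x" "\<And>w x. \<delta> \<le> norm (x - w) \<Longrightarrow> \<kappa> w x = 0"
    "\<And>x. (\<Sum>w\<in>\<Theta>. \<kappa> w x) \<le> 1" "0 < r" "r < 1" "\<And>x. r \<le> norm x \<Longrightarrow> norm x \<le> 1 \<Longrightarrow> (\<Sum>w\<in>\<Theta>. \<kappa> w x) = 1"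
proof -
  define d where "d = min \<delta> 1"
  have d: "0 < d" "d \<le> \<delta>" "d \<le> 1" using assms by (auto simp: d_def)
  obtain \<Theta> where \<Theta>: "\<Theta> \<subseteq> sphere (0::complex) 1" "finite \<Theta>" "sphere 0 1 \<subseteq> (\<Union>w\<in>\<Theta>. ball w (d / 4))"
  proof (rule compactE_image[OF compact_sphere, of "sphere (0::complex) 1" "\<lambda>w. ball w (d / 4)" 0 1])
    show "sphere 0 1 \<subseteq> (\<Union>w\<in>sphere (0::complex) 1. ball w (d / 4))" using d by auto
  qed auto
  define t where "t w x = max 0 (d - norm (x - w))" for w x :: complex
  define m where "m x = max (d / 2) (\<Sum>w\<in>\<Theta>. t w x)" for x
  define \<kappa> where "\<kappa> w x = t w x / m x" for w x
  have m: "0 < m x" for x using d by (simp add: m_def less_max_iff_disj)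
  have ct: "continuous_on UNIV (t w)" for w unfolding t_def by (intro continuous_intros)
  have sum: "(\<Sum>w\<in>\<Theta>. \<kappa> w x) = (\<Sum>w\<in>\<Theta>. t w x) / m x" for x
    unfolding \<kappa>_def by (rule sum_divide_distrib[symmetric])
  have "continuous_on UNIV (\<kappa> w)" for w
    unfolding \<kappa>_def m_def using m by (intro continuous_intros ct) (simp add: m_def less_imp_neq[symmetric])
  moreover have "0 \<le> \<kappa> w x" for w x using m[of x] by (simp add: \<kappa>_def t_def less_imp_le)
  moreover have "\<kappa> w x = 0" if "\<delta> \<le> norm (x - w)" for w x using that d by (simp add: \<kappa>_def t_def)
  moreover have "(\<Sum>w\<in>\<Theta>. \<kappa> w x) \<le> 1" for x
    unfolding sum using m[of x] by (simp add: pos_divide_le_eq) (simp add: m_def)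
  moreover have "(\<Sum>w\<in>\<Theta>. \<kappa> w x) = 1" if x: "1 - d / 4 \<le> norm x" "norm x \<le> 1" for x
  proof -
    have nx: "norm x > 0" using x d by linarith
    \<comment> \<open>The radial projection \<open>y\<close> is within \<open>d / 4\<close> of
      \<open>x\<close> and some net point \<open>w\<close> within \<open>d / 4\<close> of
      \<open>y\<close>, so the tent at \<open>w\<close> has height at least \<open>d / 2\<close> at
      \<open>x\<close>.\<close>
    define y where "y = x / of_real (norm x)"
    have "norm y = 1" using nx by (simp add: y_def norm_divide)
    then obtain w where w: "w \<in> \<Theta>" "norm (y - w) < d / 4"
      using \<Theta>(3) by (force simp: dist_norm norm_minus_commute)
    have "x - y = y * of_real (norm x - 1)" using nx by (simp add: y_def field_simps)
    then have "norm (x - y) = 1 - norm x" using \<open>norm y = 1\<close> x by (simp add: norm_mult del: of_real_diff)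
    then have "norm (x - w) \<le> d / 2"
      using w(2) x norm_triangle_ineq[of "x - y" "y - w"] by simp
    then have "d / 2 \<le> t w x" unfolding t_def by linarith
    also have "\<dots> \<le> (\<Sum>w\<in>\<Theta>. t w x)"
      by (rule member_le_sum[OF w(1) _ \<Theta>(2)]) (simp add: t_def)
    finally have "m x = (\<Sum>w\<in>\<Theta>. t w x)" by (simp add: m_def)
    then show ?thesis unfolding sum using m[of x] by simp
  qed
  moreover have "norm w = 1" if "w \<in> \<Theta>" for w using that \<Theta>(1) by auto
  ultimately show thesis using that[of \<Theta> \<kappa> "1 - d / 4"] \<Theta>(2) d by auto
qed

text \<open>The explicit form of the composite of \<open>hankel\<close> with its adjoint, free of
  the definite description for the adjoint.\<close>

definition hankel_product :: "(complex ^ 'n \<Rightarrow> complex) \<Rightarrow> (complex ^ 'n \<Rightarrow> complex) \<Rightarrow> (complex ^ 'n \<Rightarrow> complex) \<Rightarrow> complex ^ 'n \<Rightarrow> complex" where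
  "hankel_product \<psi> \<phi> f = PP (\<lambda>z. cnj (\<psi> z) * hankel polydisk \<phi> f z)"

lemma hankel_eq: "hankel polydisk \<phi> f = (\<lambda>z. \<phi> z * f z - PP (\<lambda>w. \<phi> w * f w) z)"
  by (simp add: hankel_def)

lemma hankel_perp: "multiplier M \<phi> \<Longrightarrow> f \<in> L2 polydisk \<Longrightarrow> hankel polydisk \<phi> f \<in> bergman_perp polydisk"
  unfolding hankel_eq by (intro PP_perp multiplier_L2)

lemma hankel_L2: "multiplier M \<phi> \<Longrightarrow> f \<in> L2 polydisk \<Longrightarrow> hankel polydisk \<phi> f \<in> L2 polydisk"
  by (rule bergman_perp_L2[OF open_polydisk hankel_perp])

lemma hankel_norm:
  assumes "multiplier M \<phi>" "f \<in> L2 polydisk"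
  shows "L2_norm polydisk (hankel polydisk \<phi> f) \<le> M * L2_norm polydisk f"
  unfolding hankel_eq
  using bergman_proj_compl_norm_le[OF open_polydisk multiplier_L2[OF assms]] multiplier_norm[OF assms] by linarith

lemma hankel_lincomb:
  assumes \<phi>: "multiplier M \<phi>" and f: "f \<in> L2 polydisk" and g: "g \<in> L2 polydisk"
  shows "hankel polydisk \<phi> (\<lambda>z. a * f z + b * g z) = (\<lambda>z. a * hankel polydisk \<phi> f z + b * hankel polydisk \<phi> g z)"
proof -
  have "(\<lambda>z. \<phi> z * (a * f z + b * g z)) = (\<lambda>z. a * (\<phi> z * f z) + b * (\<phi> z * g z))" by (simp add: algebra_simps)
  then show ?thesis
    unfolding hankel_eq using bergman_proj_lincomb[OF open_polydisk multiplier_L2[OF \<phi> f] multiplier_L2[OF \<phi> g], of a b]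
    by (simp add: algebra_simps)
qed

lemma hankel_product_lincomb:
  assumes \<phi>: "multiplier M \<phi>" and \<psi>: "multiplier M \<psi>" and f: "f \<in> L2 polydisk" and g: "g \<in> L2 polydisk"
  shows "hankel_product \<psi> \<phi> (\<lambda>z. a * f z + b * g z) = (\<lambda>z. a * hankel_product \<psi> \<phi> f z + b * hankel_product \<psi> \<phi> g z)"
proof -
  note L = multiplier_L2[OF multiplier_cnj[OF \<psi>] hankel_L2[OF \<phi> f]] multiplier_L2[OF multiplier_cnj[OF \<psi>] hankel_L2[OF \<phi> g]]
  have "(\<lambda>z. cnj (\<psi> z) * hankel polydisk \<phi> (\<lambda>z. a * f z + b * g z) z)
    = (\<lambda>z. a * (cnj (\<psi> z) * hankel polydisk \<phi> f z) + b * (cnj (\<psi> z) * hankel polydisk \<phi> g z))"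
    unfolding hankel_lincomb[OF \<phi> f g] by (simp add: algebra_simps)
  then show ?thesis unfolding hankel_product_def using bergman_proj_lincomb[OF open_polydisk L] by simp
qed

lemma hankel_product_bergman:
  assumes "multiplier M \<phi>" "multiplier M \<psi>" "f \<in> L2 polydisk"
  shows "hankel_product \<psi> \<phi> f \<in> bergman polydisk"
  unfolding hankel_product_def by (rule PP_in[OF multiplier_L2[OF multiplier_cnj[OF assms(2)] hankel_L2[OF assms(1,3)]]])

lemma hankel_product_norm:
  assumes "multiplier M \<phi>" "multiplier M \<psi>" "f \<in> L2 polydisk"
  shows "L2_norm polydisk (hankel_product \<psi> \<phi> f) \<le> M * (M * L2_norm polydisk f)"
proof -
  note h = hankel_L2[OF assms(1,3)] and c = multiplier_cnj[OF assms(2)]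
  have "L2_norm polydisk (hankel_product \<psi> \<phi> f) \<le> L2_norm polydisk (\<lambda>z. cnj (\<psi> z) * hankel polydisk \<phi> f z)"
    unfolding hankel_product_def by (rule PP_norm_le[OF multiplier_L2[OF c h]])
  also have "\<dots> \<le> M * L2_norm polydisk (hankel polydisk \<phi> f)" by (rule multiplier_norm[OF c h])
  also have "\<dots> \<le> M * (M * L2_norm polydisk f)"
    using hankel_norm[OF assms(1,3)] assms(1) by (intro mult_left_mono) (auto simp: multiplier_def)
  finally show ?thesis .
qed

text \<open>Since \<open>g\<close> is orthogonal to the Bergman space, the projection part of the
  Hankel operator contributes nothing. Moving \<open>\<psi>\<close> across the inner product and
  projecting gives the candidate; testing against the difference shows uniqueness.\<close>

lemma bergman_adjoint_hankel:
  fixes \<psi> g :: "complex ^ 'n \<Rightarrow> complex"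
  assumes \<psi>: "multiplier M \<psi>" and g: "g \<in> bergman_perp polydisk"
  shows "bergman_adjoint polydisk (hankel polydisk \<psi>) g = PP (\<lambda>z. cnj (\<psi> z) * g z)"
  unfolding bergman_adjoint_def
proof (rule the_equality)
  note gL = bergman_perp_L2[OF open_polydisk g]
  have cgL: "(\<lambda>z. cnj (\<psi> z) * g z) \<in> L2 polydisk" by (rule multiplier_L2[OF multiplier_cnj[OF \<psi>] gL])
  let ?h = "PP (\<lambda>z. cnj (\<psi> z) * g z)"
  have h: "?h \<in> bergman polydisk" by (rule PP_in[OF cgL])
  have eq: "L2_inner polydisk (hankel polydisk \<psi> f) g = L2_inner polydisk f ?h" if f: "f \<in> bergman polydisk" for f
  proof -
    have \<psi>f: "(\<lambda>z. \<psi> z * f z) \<in> L2 polydisk" by (rule multiplier_L2[OF \<psi> bergman_L2[OF f]])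
    have "L2_inner polydisk (hankel polydisk \<psi> f) g = L2_inner polydisk (\<lambda>z. \<psi> z * f z) g - L2_inner polydisk (PP (\<lambda>z. \<psi> z * f z)) g"
      unfolding hankel_eq by (rule L2_inner_diff_left[OF \<psi>f PP_L2[OF \<psi>f] gL])
    also have "L2_inner polydisk (PP (\<lambda>z. \<psi> z * f z)) g = 0"
      by (rule bergman_perp_inner[OF open_polydisk g PP_in[OF \<psi>f]])
    also have "L2_inner polydisk (\<lambda>z. \<psi> z * f z) g = L2_inner polydisk f (\<lambda>z. cnj (\<psi> z) * g z)"
      by (rule L2_inner_mult_left)
    also have "\<dots> = L2_inner polydisk f ?h"
      by (subst (1 2) L2_inner_commute) (simp add: bergman_proj_inner[OF open_polydisk cgL f])
    finally show ?thesis by simp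
  qed
  show "?h \<in> bergman polydisk \<and> (\<forall>f\<in>bergman polydisk. L2_inner polydisk (hankel polydisk \<psi> f) g = L2_inner polydisk f ?h)"
    using h eq by blast
  fix h' assume h': "h' \<in> bergman polydisk \<and> (\<forall>f\<in>bergman polydisk. L2_inner polydisk (hankel polydisk \<psi> f) g = L2_inner polydisk f h')"
  define d where "d z = ?h z - h' z" for z
  have d: "d \<in> bergman polydisk" unfolding d_def using h h' by (intro bergman_diff) auto
  have "L2_inner polydisk d d = L2_inner polydisk d ?h - L2_inner polydisk d h'"
    unfolding d_def[abs_def, symmetric] using L2_inner_diff_right[of ?h polydisk h' d] h h' d
    by (simp add: bergman_L2 d_def[abs_def])
  also have "\<dots> = 0" using eq[OF d] h' d by auto
  finally have "L2_norm polydisk d = 0" by (simp add: L2_inner_self)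
  from bergman_norm_0[OF open_polydisk d this] have "?h z = h' z" for z
    unfolding d_def fun_eq_iff by simp
  then show "h' = ?h" by (simp add: fun_eq_iff)
qed

section \<open>Freezing the symbols on boundary slices\<close>

lemma sum_eq_complement:
  assumes "finite A" "B \<subseteq> A"
  shows "(\<Sum>x\<in>A. f x) = (\<Sum>x\<in>B. f x) + (\<Sum>x\<in>A - B. f x :: 'b::ab_group_add)"
  using sum.subset_diff[OF assms(2,1), of f] by (simp add: add.commute)

text \<open>A term is nonzero only if \<open>z_i\<close> is within \<open>\<delta>\<close> of
  \<open>w\<close>, and this is also the distance from \<open>z\<close> to the slice point
  \<open>upd i w z\<close>. Each term is then at most \<open>e\<close> times its weight, and the
  weights sum to at most 1.\<close>

lemma frozen_sum_multiplier:
  fixes \<phi> :: "complex ^ 'n \<Rightarrow> complex" and \<kappa> :: "complex \<Rightarrow> complex \<Rightarrow> real"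
  assumes cont: "continuous_on (closure polydisk) \<phi>" and e: "e \<ge> 0"
    and unif: "\<And>x y. x \<in> closure polydisk \<Longrightarrow> y \<in> closure polydisk \<Longrightarrow> dist y x < \<delta> \<Longrightarrow> norm (\<phi> y - \<phi> x) \<le> e"
    and A: "finite A" "\<And>w. w \<in> A \<Longrightarrow> norm w = 1" and \<kappa>: "\<And>w. continuous_on UNIV (\<kappa> w)" "\<And>w x. 0 \<le> \<kappa> w x"
      "\<And>w x. \<delta> \<le> norm (x - w) \<Longrightarrow> \<kappa> w x = 0" "\<And>x. (\<Sum>w\<in>A. \<kappa> w x) \<le> 1"
  shows "multiplier e (\<lambda>z. \<Sum>w\<in>A. of_real (\<kappa> w (z $ i)) * (\<phi> z - \<phi> (upd i w z)))"
proof (rule multiplier_continuous[OF _ e])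
  have cont': "continuous_on polydisk \<phi>" by (rule continuous_on_subset[OF cont closure_subset])
  have cw: "continuous_on polydisk (\<lambda>z. \<phi> (upd i w z))" if "w \<in> A" for w
    using A(2)[OF that] by (intro continuous_on_compose2[OF cont] continuous_intros) (auto intro: upd_in_closure)
  show "continuous_on polydisk (\<lambda>z. \<Sum>w\<in>A. of_real (\<kappa> w (z $ i)) * (\<phi> z - \<phi> (upd i w z)))"
    by (intro continuous_on_sum continuous_on_mult continuous_on_of_real continuous_on_diff cont' cw
        continuous_on_compose2[OF \<kappa>(1)] continuous_intros) auto
  fix z :: "complex ^ 'n" assume z: "z \<in> polydisk"
  have "norm (\<Sum>w\<in>A. of_real (\<kappa> w (z $ i)) * (\<phi> z - \<phi> (upd i w z))) \<le> (\<Sum>w\<in>A. \<kappa> w (z $ i) * e)"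
  proof (rule sum_norm_le)
    fix w assume w: "w \<in> A"
    show "norm (of_real (\<kappa> w (z $ i)) * (\<phi> z - \<phi> (upd i w z))) \<le> \<kappa> w (z $ i) * e"
    proof (cases "\<delta> \<le> norm (z $ i - w)")
      case True
      then show ?thesis using \<kappa>(3) by simp
    next
      case False
      have "dist z (upd i w z) = norm (z $ i - w)"
        using dist_upd[of i "z $ i" z w] by (simp add: dist_norm)
      then have "norm (\<phi> z - \<phi> (upd i w z)) \<le> e"
        using False z A(2)[OF w] closure_subset by (intro unif) (auto intro: upd_in_closure)
      then show ?thesis unfolding norm_mult norm_of_real using \<kappa>(2)[of w "z $ i"] by (simp add: mult_left_mono)
    qed
  qed
  also have "\<dots> = (\<Sum>w\<in>A. \<kappa> w (z $ i)) * e" by (rule sum_distrib_right[symmetric])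
  also have "\<dots> \<le> 1 * e" using \<kappa>(4) e by (intro mult_right_mono) auto
  finally show "norm (\<Sum>w\<in>A. of_real (\<kappa> w (z $ i)) * (\<phi> z - \<phi> (upd i w z))) \<le> e" by simp
qed

text \<open>Up to the commutator, \<open>c (v - P v)\<close> is \<open>(I - P) (c v)\<close>.
  Multiplication by \<open>cnj a\<close> keeps the latter orthogonal to the Bergman space, so
  \<open>P\<close> kills it.\<close>

lemma proj_cnj_mholomorphic_commutator:
  fixes \<psi> :: "complex ^ 'n \<Rightarrow> complex"
  assumes a: "multiplier M a" and hol: "mholomorphic_on a polydisk" and c: "continuous_on UNIV c" and v: "v \<in> L2 polydisk"
  shows "L2_norm polydisk (PP (\<lambda>z. cnj (a z) * (c (z $ i) * (v z - PP v z))))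
    \<le> M * L2_norm polydisk (\<lambda>z. PP (\<lambda>z. c (z $ i) * v z) z - c (z $ i) * PP v z)"
proof -
  have ab: "\<And>z. z \<in> polydisk \<Longrightarrow> norm (a z) \<le> M" "0 \<le> M" using a by (auto simp: multiplier_def)
  have cvL: "(\<lambda>z. c (z $ i) * v z) \<in> L2 polydisk" by (rule L2_coordinate_mult[OF v c])
  define y where "y z = c (z $ i) * v z - PP (\<lambda>z. c (z $ i) * v z) z" for z
  define x where "x z = PP (\<lambda>z. c (z $ i) * v z) z - c (z $ i) * PP v z" for z
  have y: "y \<in> bergman_perp polydisk" unfolding y_def by (rule PP_perp[OF cvL])
  have xL: "x \<in> L2 polydisk" unfolding x_def by (rule L2_diff[OF PP_L2[OF cvL] L2_coordinate_mult[OF PP_L2[OF v] c]])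
  have ay: "(\<lambda>z. cnj (a z) * y z) \<in> bergman_perp polydisk"
    by (rule bergman_perp_cnj_mult[OF open_polydisk y hol ab])
  have axL: "(\<lambda>z. cnj (a z) * x z) \<in> L2 polydisk" by (rule multiplier_L2[OF multiplier_cnj[OF a] xL])
  have "(\<lambda>z. cnj (a z) * (c (z $ i) * (v z - PP v z))) = (\<lambda>z. cnj (a z) * y z + cnj (a z) * x z)"
    by (simp add: x_def y_def algebra_simps)
  then have "PP (\<lambda>z. cnj (a z) * (c (z $ i) * (v z - PP v z))) = PP (\<lambda>z. cnj (a z) * x z)"
    using bergman_proj_add[OF open_polydisk bergman_perp_L2[OF open_polydisk ay] axL] bergman_proj_of_perp[OF open_polydisk ay] by simp
  then have "L2_norm polydisk (PP (\<lambda>z. cnj (a z) * (c (z $ i) * (v z - PP v z)))) \<le> L2_norm polydisk (\<lambda>z. cnj (a z) * x z)"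
    using PP_norm_le[OF axL] by simp
  also have "\<dots> \<le> M * L2_norm polydisk x" by (rule multiplier_norm[OF multiplier_cnj[OF a] xL])
  finally show ?thesis by (simp add: x_def[abs_def])
qed

text \<open>The holomorphic function \<open>a * P (c f)\<close> competes with the projection of
  \<open>a * c f\<close>. Because \<open>f = P f\<close>, the error is \<open>a\<close> times the
  commutator.\<close>

lemma hankel_mholomorphic_commutator:
  fixes a :: "complex ^ 'n \<Rightarrow> complex"
  assumes a: "multiplier M a" and hol: "mholomorphic_on a polydisk" and c: "continuous_on UNIV c" and f: "f \<in> bergman polydisk"
  shows "L2_norm polydisk (hankel polydisk (\<lambda>z. c (z $ i) * a z) f)
    \<le> M * L2_norm polydisk (\<lambda>z. PP (\<lambda>z. c (z $ i) * f z) z - c (z $ i) * PP f z)"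
proof -
  have ab: "\<And>z. z \<in> polydisk \<Longrightarrow> norm (a z) \<le> M" "0 \<le> M" using a by (auto simp: multiplier_def)
  note fL = bergman_L2[OF f]
  have cfL: "(\<lambda>z. c (z $ i) * f z) \<in> L2 polydisk" by (rule L2_coordinate_mult[OF fL c])
  define p where "p z = PP (\<lambda>z. c (z $ i) * f z) z" for z
  have p: "p \<in> bergman polydisk" unfolding p_def by (rule PP_in[OF cfL])
  have ap: "(\<lambda>z. a z * p z) \<in> bergman polydisk" by (rule bergman_mult[OF p hol ab(1) open_polydisk ab(2)])
  have L: "(\<lambda>z. a z * (c (z $ i) * f z)) \<in> L2 polydisk" by (rule multiplier_L2[OF a cfL])
  have dL: "(\<lambda>z. c (z $ i) * f z - p z) \<in> L2 polydisk" by (rule L2_diff[OF cfL bergman_L2[OF p]])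
  have "L2_norm polydisk (hankel polydisk (\<lambda>z. c (z $ i) * a z) f) = L2_norm polydisk (\<lambda>z. a z * (c (z $ i) * f z) - PP (\<lambda>z. a z * (c (z $ i) * f z)) z)"
    unfolding hankel_eq by (simp add: mult_ac)
  also have "\<dots> \<le> L2_norm polydisk (\<lambda>z. a z * (c (z $ i) * f z) - a z * p z)"
    by (rule bergman_proj_compl_le[OF open_polydisk L ap])
  also have "\<dots> = L2_norm polydisk (\<lambda>z. a z * (c (z $ i) * f z - p z))" by (simp add: algebra_simps)
  also have "\<dots> \<le> M * L2_norm polydisk (\<lambda>z. c (z $ i) * f z - p z)" by (rule multiplier_norm[OF a dL])
  also have "L2_norm polydisk (\<lambda>z. c (z $ i) * f z - p z) = L2_norm polydisk (\<lambda>z. PP (\<lambda>z. c (z $ i) * f z) z - c (z $ i) * PP f z)"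
    unfolding bergman_proj_id[OF open_polydisk f] p_def by (rule L2_norm_minus_commute)
  finally show ?thesis .
qed

text \<open>Near \<open>\<bar>z\<^sub>i\<bar> = 1\<close> the symbols are replaced by their restrictions to finitely many boundary slices;
  on each slice one of the two is holomorphic, and the cut-offs commute asymptotically with the projection.\<close>

lemma hankel_product_escaping:
  fixes \<phi> \<psi> :: "complex ^ 'n \<Rightarrow> complex"
  assumes c\<phi>: "continuous_on (closure polydisk) \<phi>" and c\<psi>: "continuous_on (closure polydisk) \<psi>"
    and dich: "\<And>w. norm w = 1 \<Longrightarrow>
      mholomorphic_on (\<lambda>z. \<phi> (upd i w z)) polydisk \<or> mholomorphic_on (\<lambda>z. \<psi> (upd i w z)) polydisk"
    and esc: "escaping i f" and f: "\<And>k. f k \<in> bergman polydisk"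
  shows "(\<lambda>k. L2_norm polydisk (hankel_product \<psi> \<phi> (f k))) \<longlonglongrightarrow> 0"
proof (rule tendsto_zero_approx)
  fix e0 :: real assume e0: "e0 > 0"
  obtain M1 M2 where M1: "M1 \<ge> 0" "\<And>z. z \<in> closure polydisk \<Longrightarrow> norm (\<phi> z) \<le> M1"
    and M2: "M2 \<ge> 0" "\<And>z. z \<in> closure polydisk \<Longrightarrow> norm (\<psi> z) \<le> M2"
    using continuous_closure_bound[OF c\<phi>] continuous_closure_bound[OF c\<psi>] by blast
  define M where "M = max M1 M2"
  have M: "0 \<le> M" "\<And>z. z \<in> closure polydisk \<Longrightarrow> norm (\<phi> z) \<le> M" "\<And>z. z \<in> closure polydisk \<Longrightarrow> norm (\<psi> z) \<le> M"
    using M1 M2 by (auto simp: M_def max.coboundedI1 max.coboundedI2)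
  have sub: "z \<in> closure polydisk" if "z \<in> polydisk" for z :: "complex ^ 'n" using that closure_subset by blast
  have \<phi>: "multiplier M \<phi>" and \<psi>: "multiplier M \<psi>"
    by (auto intro!: multiplier_continuous continuous_on_subset[OF c\<phi> closure_subset] continuous_on_subset[OF c\<psi> closure_subset] M sub)
  have slice: "multiplier M (\<lambda>z. \<theta> (upd i w z))"
    if "continuous_on (closure polydisk) \<theta>" "\<And>z. z \<in> closure polydisk \<Longrightarrow> norm (\<theta> z) \<le> M" "norm w = 1" for \<theta> :: "complex ^ 'n \<Rightarrow> complex" and w
  proof (rule multiplier_continuous[OF _ M(1)])
    show "continuous_on polydisk (\<lambda>z. \<theta> (upd i w z))"
      using that(3) by (intro continuous_on_compose2[OF that(1)] continuous_intros) (auto intro: upd_in_closure)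
    show "norm (\<theta> (upd i w z)) \<le> M" if "z \<in> polydisk" for z
      using upd_in_closure[OF that, of w i] \<open>norm w = 1\<close> by (intro \<open>\<And>z. z \<in> closure polydisk \<Longrightarrow> norm (\<theta> z) \<le> M\<close>) simp
  qed
  obtain B where B: "B \<ge> 0" "\<And>k. L2_norm polydisk (f k) \<le> B" using escaping_bound[OF esc] by blast
  \<comment> \<open>Freezing \<open>\<psi>\<close> and freezing \<open>\<phi>\<close> each cost
    \<open>e * M * B\<close>; the added 1 keeps the denominator positive.\<close>
  define e where "e = e0 / (2 * M * B + 1)"
  have den: "2 * M * B + 1 > 0" using M B by (simp add: add_nonneg_pos)
  have e: "e > 0" using e0 den by (simp add: e_def)
  have e_small: "e * (2 * M * B) \<le> e0"
  proof -
    have "e * (2 * M * B) \<le> e * (2 * M * B + 1)" using e by (intro mult_left_mono) auto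
    also have "\<dots> = e0" using den by (simp add: e_def)
    finally show ?thesis .
  qed
  obtain d1 where d1: "d1 > 0" "\<And>x y. x \<in> closure polydisk \<Longrightarrow> y \<in> closure polydisk \<Longrightarrow> dist y x < d1 \<Longrightarrow> dist (\<phi> y) (\<phi> x) < e"
    using compact_uniformly_continuous[OF c\<phi> compact_closure_polydisk] e unfolding uniformly_continuous_on_def by metis
  obtain d2 where d2: "d2 > 0" "\<And>x y. x \<in> closure polydisk \<Longrightarrow> y \<in> closure polydisk \<Longrightarrow> dist y x < d2 \<Longrightarrow> dist (\<psi> y) (\<psi> x) < e"
    using compact_uniformly_continuous[OF c\<psi> compact_closure_polydisk] e unfolding uniformly_continuous_on_def by metis
  define \<delta> where "\<delta> = min d1 d2"
  have \<delta>: "\<delta> > 0" using d1 d2 by (simp add: \<delta>_def)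
  obtain \<Theta> and \<kappa> :: "complex \<Rightarrow> complex \<Rightarrow> real" and r where \<Theta>: "finite \<Theta>" "\<And>w. w \<in> \<Theta> \<Longrightarrow> norm w = 1"
    and \<kappa>: "\<And>w. continuous_on UNIV (\<kappa> w)" "\<And>w x. 0 \<le> \<kappa> w x" "\<And>w x. \<delta> \<le> norm (x - w) \<Longrightarrow> \<kappa> w x = 0" "\<And>x. (\<Sum>w\<in>\<Theta>. \<kappa> w x) \<le> 1"
    and r: "0 < r" "r < 1" "\<And>x. r \<le> norm x \<Longrightarrow> norm x \<le> 1 \<Longrightarrow> (\<Sum>w\<in>\<Theta>. \<kappa> w x) = 1"
    by (rule circle_partition[OF \<delta>]) blast
  \<comment> \<open>Slices on which \<open>\<phi>\<close> is holomorphic go to \<open>A\<close>. On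
    the remaining ones, \<open>Bs\<close>, the dichotomy makes \<open>\<psi>\<close>
    holomorphic.\<close>
  define A where "A = {w \<in> \<Theta>. mholomorphic_on (\<lambda>z. \<phi> (upd i w z)) polydisk}"
  define Bs where "Bs = \<Theta> - A"
  have A: "finite A" "A \<subseteq> \<Theta>" "\<And>w. w \<in> A \<Longrightarrow> norm w = 1" "\<And>w. w \<in> A \<Longrightarrow> mholomorphic_on (\<lambda>z. \<phi> (upd i w z)) polydisk"
    using \<Theta> by (auto simp: A_def)
  have Bs: "finite Bs" "Bs \<subseteq> \<Theta>" "\<And>w. w \<in> Bs \<Longrightarrow> norm w = 1" "\<And>w. w \<in> Bs \<Longrightarrow> mholomorphic_on (\<lambda>z. \<psi> (upd i w z)) polydisk"
    using \<Theta> dich by (auto simp: A_def Bs_def)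
  have sum1: "(\<Sum>w\<in>S. \<kappa> w x) \<le> 1" if "S \<subseteq> \<Theta>" for S x
    using sum_mono2[OF \<Theta>(1) that, of "\<lambda>w. \<kappa> w x"] \<kappa>(2,4) order_trans by blast
  define c where "c w x = complex_of_real (\<kappa> w x)" for w x
  have cc: "continuous_on UNIV (c w)" for w unfolding c_def by (intro continuous_on_of_real \<kappa>)
  have com: "commutes i (c w)" for w unfolding c_def by (rule commutes_real_continuous[OF \<kappa>(1)])
  define \<alpha> where "\<alpha> z = (\<Sum>w\<in>A. c w (z $ i) * (\<phi> z - \<phi> (upd i w z)))" for z
  define \<beta> where "\<beta> z = (\<Sum>w\<in>Bs. c w (z $ i) * (\<psi> z - \<psi> (upd i w z)))" for z
  have \<alpha>: "multiplier e \<alpha>" unfolding \<alpha>_def c_def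
    by (rule frozen_sum_multiplier[OF c\<phi> _ _ A(1,3) \<kappa>(1,2,3) sum1[OF A(2)]])
      (use e d1(2) in \<open>auto simp: \<delta>_def dist_norm less_imp_le\<close>)
  have \<beta>: "multiplier e \<beta>" unfolding \<beta>_def c_def
    by (rule frozen_sum_multiplier[OF c\<psi> _ _ Bs(1,3) \<kappa>(1,2,3) sum1[OF Bs(2)]])
      (use e d2(2) in \<open>auto simp: \<delta>_def dist_norm less_imp_le\<close>)
  \<comment> \<open>The part not covered by the partition is supported away from the face and is
    therefore negligible on escaping sequences.\<close>
  define \<gamma> where "\<gamma> z = 1 - (\<Sum>w\<in>\<Theta>. c w (z $ i))" for z :: "complex ^ 'n"
  have \<gamma>c: "\<gamma> z = of_real (1 - (\<Sum>w\<in>\<Theta>. \<kappa> w (z $ i)))" for z by (simp add: \<gamma>_def c_def)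
  have \<gamma>m: "\<gamma> \<in> borel_measurable (lebesgue_on polydisk)"
    unfolding \<gamma>_def by (intro borel_measurable_diff borel_measurable_const borel_measurable_sum borel_coordinate_fun cc)
  have \<gamma>1: "norm (\<gamma> z) \<le> 1" for z
  proof -
    have "0 \<le> (\<Sum>w\<in>\<Theta>. \<kappa> w (z $ i))" using \<kappa>(2) by (intro sum_nonneg) auto
    then show ?thesis unfolding \<gamma>c norm_of_real using \<kappa>(4)[of "z $ i"] by linarith
  qed
  have \<gamma>: "multiplier 1 \<gamma>" using \<gamma>m \<gamma>1 by (simp add: multiplier_def)
  have cm: "multiplier 1 (\<lambda>z. c w (z $ i))" if "w \<in> \<Theta>" for w
  proof -
    have "\<kappa> w x \<le> (\<Sum>w\<in>\<Theta>. \<kappa> w x)" for x by (rule member_le_sum[OF that _ \<Theta>(1)]) (rule \<kappa>(2))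
    then have "\<kappa> w x \<le> 1" for x using \<kappa>(4) order_trans by blast
    then show ?thesis using \<kappa>(2) borel_coordinate_fun[OF cc] by (simp add: multiplier_def c_def)
  qed
  define \<Phi> where "\<Phi> k z = \<phi> z * f k z" for k z
  define u where "u k = hankel polydisk \<phi> (f k)" for k
  note fL = bergman_L2[OF f]
  have \<Phi>esc: "escaping i \<Phi>" unfolding \<Phi>_def[abs_def] by (rule multiplier_escaping[OF \<phi> esc])
  have \<Phi>L: "\<Phi> k \<in> L2 polydisk" for k by (rule escaping_L2[OF \<Phi>esc])
  have u_eq: "u k = (\<lambda>z. \<Phi> k z - PP (\<Phi> k) z)" for k unfolding u_def hankel_eq \<Phi>_def[abs_def] ..
  have uesc: "escaping i u" unfolding u_eq[abs_def] by (intro escaping_diff \<Phi>esc escaping_proj)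
  have uL: "u k \<in> L2 polydisk" for k by (rule escaping_L2[OF uesc])
  have uB: "L2_norm polydisk (u k) \<le> M * B" for k
    using hankel_norm[OF \<phi> fL, of k] B(2)[of k] M(1) unfolding u_def by (meson mult_left_mono order_trans)
  define X where "X w k = L2_norm polydisk (\<lambda>z. PP (\<lambda>z. c w (z $ i) * \<Phi> k z) z - c w (z $ i) * PP (\<Phi> k) z)" for w k
  define Y where "Y w k = L2_norm polydisk (\<lambda>z. PP (\<lambda>z. c w (z $ i) * f k z) z - c w (z $ i) * PP (f k) z)" for w k
  define Z where "Z k = L2_norm polydisk (\<lambda>z. \<gamma> z * u k z)" for k
  have X: "X w \<longlonglongrightarrow> 0" for w unfolding X_def by (rule commutesD[OF com \<Phi>esc])
  have Y: "Y w \<longlonglongrightarrow> 0" for w unfolding Y_def by (rule commutesD[OF com esc])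
  have Z: "Z \<longlonglongrightarrow> 0" unfolding Z_def
  proof (rule escaping_mult_vanish[OF uesc \<gamma>m])
    fix e' :: real assume "e' > 0"
    have r2: "r\<^sup>2 < 1" using r by (simp add: power_less_one_iff)
    show "\<exists>C\<ge>0. \<forall>z\<in>polydisk. norm (\<gamma> z) \<le> e' + C * (1 - (norm (z $ i))\<^sup>2)"
    proof (intro exI[of _ "1 / (1 - r\<^sup>2)"] conjI ballI)
      fix z :: "complex ^ 'n" assume z: "z \<in> polydisk"
      show "norm (\<gamma> z) \<le> e' + 1 / (1 - r\<^sup>2) * (1 - (norm (z $ i))\<^sup>2)"
      proof (cases "norm (z $ i) < r")
        case True
        then have "(norm (z $ i))\<^sup>2 \<le> r\<^sup>2" by (intro power_mono) auto
        then have "1 \<le> 1 / (1 - r\<^sup>2) * (1 - (norm (z $ i))\<^sup>2)" using r2 by (simp add: pos_le_divide_eq)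
        then show ?thesis using \<gamma>1[of z] \<open>e' > 0\<close> by linarith
      next
        case False
        then have "\<gamma> z = 0" unfolding \<gamma>c using r(3)[of "z $ i"] norm_coordinate_le[OF z, of i] by simp
        then show ?thesis using weight_bounds(1)[OF z, of i] r2 \<open>e' > 0\<close> by simp
      qed
    qed (use r2 in auto)
  qed
  have bound: "L2_norm polydisk (hankel_product \<psi> \<phi> (f k))
      \<le> e0 + (M * Z k + (\<Sum>w\<in>Bs. M * X w k) + M * ((\<Sum>w\<in>A. X w k) + (\<Sum>w\<in>A. M * Y w k)))" for k
  proof -
    have cuL: "(\<lambda>z. c w (z $ i) * u k z) \<in> L2 polydisk" for w by (rule L2_coordinate_mult[OF uL cc])
    have c\<Phi>L: "(\<lambda>z. c w (z $ i) * \<Phi> k z) \<in> L2 polydisk" for w by (rule L2_coordinate_mult[OF \<Phi>L cc])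
    define a where "a z = (\<Sum>w\<in>A. c w (z $ i) * u k z)" for z
    have aL: "a \<in> L2 polydisk" unfolding a_def by (intro L2_sum cuL)
    have \<psi>w: "multiplier M (\<lambda>z. \<psi> (upd i w z))" if "w \<in> Bs" for w by (rule slice[OF c\<psi> M(3) Bs(3)[OF that]])
    have \<phi>w: "multiplier M (\<lambda>z. \<phi> (upd i w z))" if "w \<in> A" for w by (rule slice[OF c\<phi> M(2) A(3)[OF that]])
    \<comment> \<open>The integrand \<open>cnj \<psi> * u\<close> splits into the part away from the
      face, the freezing error of \<open>\<psi>\<close>, the slices with \<open>\<psi>\<close>
      holomorphic, and the slices with \<open>\<phi>\<close> holomorphic. On the last ones
      \<open>\<psi>\<close> is left unfrozen and the smallness has to come from
      \<open>u\<close>.\<close>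
    define t1 where "t1 z = cnj (\<psi> z) * (\<gamma> z * u k z)" for z
    define t2 where "t2 z = cnj (\<beta> z) * u k z" for z
    define t3 where "t3 z = (\<Sum>w\<in>Bs. cnj (\<psi> (upd i w z)) * (c w (z $ i) * u k z))" for z
    define t4 where "t4 z = cnj (\<psi> z) * a z" for z
    have t3L': "(\<lambda>z. cnj (\<psi> (upd i w z)) * (c w (z $ i) * u k z)) \<in> L2 polydisk" if "w \<in> Bs" for w
      by (rule multiplier_L2[OF multiplier_cnj[OF \<psi>w[OF that]] cuL])
    have tL: "t1 \<in> L2 polydisk" "t2 \<in> L2 polydisk" "t3 \<in> L2 polydisk" "t4 \<in> L2 polydisk"
      unfolding t1_def[abs_def] t2_def[abs_def] t3_def[abs_def] t4_def[abs_def]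
      by (rule multiplier_L2[OF multiplier_cnj[OF \<psi>] multiplier_L2[OF \<gamma> uL]],
          rule multiplier_L2[OF multiplier_cnj[OF \<beta>] uL], rule L2_sum[OF t3L'],
          assumption, rule multiplier_L2[OF multiplier_cnj[OF \<psi>] aL])
    have split: "cnj (\<psi> z) * u k z = (t1 z + t2 z) + (t3 z + t4 z)" for z
    proof -
      have cnjc: "cnj (c w x) = c w x" for w x by (simp add: c_def)
      have "t2 z + t3 z = (\<Sum>w\<in>Bs. c w (z $ i) * cnj (\<psi> z)) * u k z"
        unfolding t2_def t3_def \<beta>_def cnj_sum sum_distrib_right sum.distrib[symmetric]
        by (rule sum.cong[OF refl]) (simp add: cnjc algebra_simps)
      then have e23: "t2 z + t3 z = (\<Sum>w\<in>Bs. c w (z $ i)) * (cnj (\<psi> z) * u k z)"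
        by (simp only: sum_distrib_right[symmetric] mult.assoc)
      have e4: "t4 z = (\<Sum>w\<in>A. c w (z $ i)) * (cnj (\<psi> z) * u k z)"
        unfolding t4_def a_def sum_distrib_right[symmetric] by (simp add: mult_ac)
      have e1: "t1 z = (1 - ((\<Sum>w\<in>A. c w (z $ i)) + (\<Sum>w\<in>Bs. c w (z $ i)))) * (cnj (\<psi> z) * u k z)"
        unfolding t1_def \<gamma>_def Bs_def using sum_eq_complement[OF \<Theta>(1) A(2), of "\<lambda>w. c w (z $ i)"] by (simp add: mult_ac)
      have "(t1 z + t2 z) + (t3 z + t4 z) = t1 z + ((t2 z + t3 z) + t4 z)" by (simp only: add.assoc)
      also have "\<dots> = cnj (\<psi> z) * u k z" unfolding e23 e4 e1 by (simp add: algebra_simps)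
      finally show ?thesis by simp
    qed
    have "hankel_product \<psi> \<phi> (f k) = (\<lambda>z. (PP t1 z + PP t2 z) + (PP t3 z + PP t4 z))"
      unfolding hankel_product_def u_def[symmetric] split
      by (simp add: bergman_proj_add[OF open_polydisk] tL L2_add)
    then have "L2_norm polydisk (hankel_product \<psi> \<phi> (f k))
      \<le> L2_norm polydisk (\<lambda>z. PP t1 z + PP t2 z) + L2_norm polydisk (\<lambda>z. PP t3 z + PP t4 z)"
      using L2_triangle[OF L2_add[OF PP_L2[OF tL(1)] PP_L2[OF tL(2)]] L2_add[OF PP_L2[OF tL(3)] PP_L2[OF tL(4)]]] by simp
    also have "\<dots> \<le> (L2_norm polydisk (PP t1) + L2_norm polydisk (PP t2)) + (L2_norm polydisk (PP t3) + L2_norm polydisk (PP t4))"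
      by (intro add_mono L2_triangle PP_L2 tL)
    also have "\<dots> \<le> (M * Z k + e * (M * B)) + ((\<Sum>w\<in>Bs. M * X w k) + M * ((\<Sum>w\<in>A. X w k) + (e * B + (\<Sum>w\<in>A. M * Y w k))))"
    proof (intro add_mono)
      have "L2_norm polydisk (PP t1) \<le> L2_norm polydisk t1" by (rule PP_norm_le[OF tL(1)])
      also have "\<dots> \<le> M * Z k"
        unfolding t1_def[abs_def] Z_def by (rule multiplier_norm[OF multiplier_cnj[OF \<psi>] multiplier_L2[OF \<gamma> uL]])
      finally show "L2_norm polydisk (PP t1) \<le> M * Z k" .
      have "L2_norm polydisk (PP t2) \<le> L2_norm polydisk t2" by (rule PP_norm_le[OF tL(2)])
      also have "\<dots> \<le> e * L2_norm polydisk (u k)"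
        unfolding t2_def[abs_def] by (rule multiplier_norm[OF multiplier_cnj[OF \<beta>] uL])
      also have "\<dots> \<le> e * (M * B)" using uB e by (intro mult_left_mono) auto
      finally show "L2_norm polydisk (PP t2) \<le> e * (M * B)" .
      have "PP t3 = (\<lambda>z. \<Sum>w\<in>Bs. PP (\<lambda>z. cnj (\<psi> (upd i w z)) * (c w (z $ i) * u k z)) z)"
        unfolding t3_def[abs_def] by (rule bergman_proj_sum[OF open_polydisk Bs(1) t3L'])
      then have "L2_norm polydisk (PP t3) \<le> (\<Sum>w\<in>Bs. L2_norm polydisk (PP (\<lambda>z. cnj (\<psi> (upd i w z)) * (c w (z $ i) * u k z))))"
        using L2_norm_sum_le[OF Bs(1) PP_L2[OF t3L']] by simp
      also have "\<dots> \<le> (\<Sum>w\<in>Bs. M * X w k)"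
        unfolding X_def u_eq by (intro sum_mono proj_cnj_mholomorphic_commutator \<psi>w Bs(4) cc \<Phi>L)
      finally show "L2_norm polydisk (PP t3) \<le> (\<Sum>w\<in>Bs. M * X w k)" .
      have "L2_norm polydisk (PP t4) \<le> L2_norm polydisk t4" by (rule PP_norm_le[OF tL(4)])
      also have "\<dots> \<le> M * L2_norm polydisk a"
        unfolding t4_def[abs_def] by (rule multiplier_norm[OF multiplier_cnj[OF \<psi>] aL])
      also have "L2_norm polydisk a \<le> (\<Sum>w\<in>A. X w k) + (e * B + (\<Sum>w\<in>A. M * Y w k))"
      proof -
        \<comment> \<open>Each \<open>c w\<close> times \<open>(I - P) \<Phi>\<close> is a
          commutator \<open>x w\<close> plus \<open>h w\<close>, the Hankel image with the localised
          symbol \<open>c w * \<phi>\<close>.\<close>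
        define x where "x w z = PP (\<lambda>z. c w (z $ i) * \<Phi> k z) z - c w (z $ i) * PP (\<Phi> k) z" for w z
        define h where "h w z = c w (z $ i) * \<Phi> k z - PP (\<lambda>z. c w (z $ i) * \<Phi> k z) z" for w z
        have xL: "x w \<in> L2 polydisk" for w
          unfolding x_def by (rule L2_diff[OF PP_L2[OF c\<Phi>L] L2_coordinate_mult[OF PP_L2[OF \<Phi>L] cc]])
        have hL: "h w \<in> L2 polydisk" for w unfolding h_def by (rule L2_diff[OF c\<Phi>L PP_L2[OF c\<Phi>L]])
        define y where "y w = hankel polydisk (\<lambda>z. c w (z $ i) * \<phi> (upd i w z)) (f k)" for w
        have cfL: "(\<lambda>z. c w (z $ i) * (\<phi> (upd i w z) * f k z)) \<in> L2 polydisk" if "w \<in> A" for w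
          by (rule L2_coordinate_mult[OF multiplier_L2[OF \<phi>w[OF that] fL] cc])
        have y_eq: "y w = (\<lambda>z. c w (z $ i) * (\<phi> (upd i w z) * f k z) - PP (\<lambda>z. c w (z $ i) * (\<phi> (upd i w z) * f k z)) z)" for w
          unfolding y_def hankel_eq by (simp add: mult.assoc)
        have yL: "y w \<in> L2 polydisk" if "w \<in> A" for w
          unfolding y_eq by (rule L2_diff[OF cfL[OF that] PP_L2[OF cfL[OF that]]])
        have \<alpha>L: "hankel polydisk \<alpha> (f k) \<in> L2 polydisk" by (rule hankel_L2[OF \<alpha> fL])
        have a_eq: "a = (\<lambda>z. (\<Sum>w\<in>A. x w z) + (\<Sum>w\<in>A. h w z))"
          unfolding a_def x_def h_def u_eq by (simp add: sum.distrib[symmetric] algebra_simps)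
        \<comment> \<open>Freezing \<open>\<phi>\<close> on its slices replaces the localised
          symbols by nearly holomorphic ones, at the cost of the Hankel operator with small symbol
          \<open>\<alpha>\<close>.\<close>
        have h_sum: "(\<lambda>z. \<Sum>w\<in>A. h w z) = (\<lambda>z. hankel polydisk \<alpha> (f k) z + (\<Sum>w\<in>A. y w z))"
        proof -
          have e1: "(\<Sum>w\<in>A. c w (z $ i) * \<Phi> k z) = \<alpha> z * f k z + (\<Sum>w\<in>A. c w (z $ i) * (\<phi> (upd i w z) * f k z))" for z
            unfolding \<alpha>_def \<Phi>_def sum_distrib_right sum.distrib[symmetric] by (rule sum.cong[OF refl]) (simp add: algebra_simps)
          have "PP (\<lambda>z. \<Sum>w\<in>A. c w (z $ i) * \<Phi> k z) = (\<lambda>z. \<Sum>w\<in>A. PP (\<lambda>z. c w (z $ i) * \<Phi> k z) z)"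
            by (rule bergman_proj_sum[OF open_polydisk A(1) c\<Phi>L])
          moreover have "PP (\<lambda>z. \<Sum>w\<in>A. c w (z $ i) * \<Phi> k z)
            = (\<lambda>z. PP (\<lambda>z. \<alpha> z * f k z) z + (\<Sum>w\<in>A. PP (\<lambda>z. c w (z $ i) * (\<phi> (upd i w z) * f k z)) z))"
            unfolding e1 using bergman_proj_add[OF open_polydisk multiplier_L2[OF \<alpha> fL[of k]] L2_sum[where A = A, OF cfL]]
              fun_cong[OF bergman_proj_sum[OF open_polydisk A(1) cfL]] by simp
          ultimately have e2: "(\<Sum>w\<in>A. PP (\<lambda>z. c w (z $ i) * \<Phi> k z) z)
            = PP (\<lambda>z. \<alpha> z * f k z) z + (\<Sum>w\<in>A. PP (\<lambda>z. c w (z $ i) * (\<phi> (upd i w z) * f k z)) z)" for z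
            by (metis (no_types))
          show ?thesis
            unfolding h_def y_eq hankel_eq sum_subtractf e1 e2 by (simp add: algebra_simps)
        qed
        have "L2_norm polydisk a \<le> L2_norm polydisk (\<lambda>z. \<Sum>w\<in>A. x w z) + L2_norm polydisk (\<lambda>z. \<Sum>w\<in>A. h w z)"
          unfolding a_eq by (intro L2_triangle L2_sum xL hL)
        also have "L2_norm polydisk (\<lambda>z. \<Sum>w\<in>A. x w z) \<le> (\<Sum>w\<in>A. X w k)"
          using L2_norm_sum_le[OF A(1) xL] by (simp add: X_def x_def[abs_def])
        also have "L2_norm polydisk (\<lambda>z. \<Sum>w\<in>A. h w z) \<le> L2_norm polydisk (hankel polydisk \<alpha> (f k)) + L2_norm polydisk (\<lambda>z. \<Sum>w\<in>A. y w z)"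
          unfolding h_sum by (intro L2_triangle L2_sum \<alpha>L yL)
        also have "L2_norm polydisk (hankel polydisk \<alpha> (f k)) \<le> e * B"
          using hankel_norm[OF \<alpha> fL, of k] B(2)[of k] e by (meson mult_left_mono order_trans less_imp_le)
        also have "L2_norm polydisk (\<lambda>z. \<Sum>w\<in>A. y w z) \<le> (\<Sum>w\<in>A. L2_norm polydisk (y w))"
          by (rule L2_norm_sum_le[OF A(1) yL])
        also have "\<dots> \<le> (\<Sum>w\<in>A. M * Y w k)"
          unfolding y_def Y_def by (intro sum_mono hankel_mholomorphic_commutator \<phi>w A(4) cc f)
        finally show ?thesis by simp
      qed
      finally show "L2_norm polydisk (PP t4) \<le> M * ((\<Sum>w\<in>A. X w k) + (e * B + (\<Sum>w\<in>A. M * Y w k)))"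
        using M(1) by (simp add: mult_left_mono)
    qed
    also have "\<dots> = e * (2 * M * B) + (M * Z k + (\<Sum>w\<in>Bs. M * X w k) + M * ((\<Sum>w\<in>A. X w k) + (\<Sum>w\<in>A. M * Y w k)))"
      by (simp add: algebra_simps)
    finally show ?thesis using e_small by linarith
  qed
  have "(\<lambda>k. M * Z k + (\<Sum>w\<in>Bs. M * X w k) + M * ((\<Sum>w\<in>A. X w k) + (\<Sum>w\<in>A. M * Y w k)))
    \<longlonglongrightarrow> M * 0 + (\<Sum>w\<in>Bs. M * 0) + M * ((\<Sum>w\<in>A. 0) + (\<Sum>w\<in>A. M * 0))"
    by (intro tendsto_add tendsto_mult tendsto_const tendsto_sum X Y Z)
  then show "\<exists>b. b \<longlonglongrightarrow> 0 \<and> (\<forall>k. \<bar>L2_norm polydisk (hankel_product \<psi> \<phi> (f k))\<bar> \<le> e0 + b k)"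
    using bound by (intro exI[of _ "\<lambda>k. M * Z k + (\<Sum>w\<in>Bs. M * X w k) + M * ((\<Sum>w\<in>A. X w k) + (\<Sum>w\<in>A. M * Y w k))"]) auto
qed

text \<open>Otherwise the images stay above some \<open>c > 0\<close> infinitely often, and members
  with such images can be chosen ever smaller on closed polydisks growing to the full one. What is
  left lives where some coordinate is near the unit circle; distributing it over the faces yields
  escaping sequences.\<close>

lemma hankel_product_null_sequence:
  fixes \<phi> \<psi> :: "complex ^ 'n \<Rightarrow> complex"
  assumes c\<phi>: "continuous_on (closure polydisk) \<phi>" and c\<psi>: "continuous_on (closure polydisk) \<psi>"
    and dich: "\<And>i w. norm w = 1 \<Longrightarrow>
      mholomorphic_on (\<lambda>z. \<phi> (upd i w z)) polydisk \<or> mholomorphic_on (\<lambda>z. \<psi> (upd i w z)) polydisk"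
    and M: "multiplier M \<phi>" "multiplier M \<psi>"
    and f: "\<And>k. f k \<in> bergman polydisk" "\<And>k. L2_norm polydisk (f k) \<le> B"
    and lim: "\<And>K. compact K \<Longrightarrow> K \<subseteq> polydisk \<Longrightarrow> uniform_limit K f (\<lambda>_. 0) sequentially"
  shows "(\<lambda>k. L2_norm polydisk (hankel_product \<psi> \<phi> (f k))) \<longlonglongrightarrow> 0"
proof (rule ccontr)
  let ?T = "hankel_product \<psi> \<phi>"
  assume "\<not> ?thesis"
  then obtain c where c: "c > 0" "\<And>N. \<exists>k\<ge>N. c \<le> L2_norm polydisk (?T (f k))"
    unfolding lim_sequentially by (auto simp: not_less)
  have B: "0 \<le> B" using f(2)[of 0] L2_norm_nonneg order_trans by blast
  \<comment> \<open>The offset 2 makes \<open>r 0 = 1/2\<close>, so every radius is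
    positive.\<close>
  define r where "r j = 1 - 1 / real (j + 2)" for j
  have r: "0 < r j" "r j < 1" for j by (auto simp: r_def field_simps)
  have rlim: "r \<longlonglongrightarrow> 1"
  proof -
    have "(\<lambda>j. 1 - inverse (real (Suc (Suc j)))) \<longlonglongrightarrow> 1 - 0"
      by (rule tendsto_diff[OF tendsto_const LIMSEQ_Suc[OF LIMSEQ_inverse_real_of_nat]])
    then show ?thesis by (simp add: r_def[abs_def] inverse_eq_divide)
  qed
  define K where "K j = {z :: complex ^ 'n. \<forall>l. norm (z $ l) \<le> r j}" for j
  have K_sub: "K j \<subseteq> polydisk" for j unfolding K_def polydisk_iff subset_iff mem_Collect_eq using r(2)[of j] le_less_trans by blast
  have "compact (K j)" for j
  proof -
    have "closed {z :: complex ^ 'n. norm (z $ l) \<le> r j}" for l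
      by (intro closed_Collect_le continuous_intros)
    then have "closed (\<Inter>l. {z :: complex ^ 'n. norm (z $ l) \<le> r j})" by (intro closed_INT) auto
    moreover have "(\<Inter>l. {z :: complex ^ 'n. norm (z $ l) \<le> r j}) = K j" by (auto simp: K_def)
    ultimately have "closed (K j)" by simp
    moreover have "bounded (K j)"
      using compact_imp_bounded[OF compact_closure_polydisk] K_sub closure_subset by (meson bounded_subset order_trans)
    ultimately show ?thesis by (simp add: compact_eq_bounded_closed)
  qed
  then have "\<exists>N. \<forall>k\<ge>N. \<forall>z\<in>K j. norm (f k z) < 1 / real (Suc j)" for j
    using lim[OF _ K_sub, of j] unfolding uniform_limit_iff eventually_sequentially by (auto simp: dist_norm)
  then have "\<exists>k. (\<forall>z\<in>K j. norm (f k z) < 1 / real (Suc j)) \<and> c \<le> L2_norm polydisk (?T (f k))" for j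
    using c(2) by meson
  then obtain s where s: "\<And>j z. z \<in> K j \<Longrightarrow> norm (f (s j) z) < 1 / real (Suc j)" "\<And>j. c \<le> L2_norm polydisk (?T (f (s j)))"
    by metis
  define g where "g j = f (s j)" for j
  have g: "g j \<in> bergman polydisk" "L2_norm polydisk (g j) \<le> B" for j using f by (auto simp: g_def)
  note gL = bergman_L2[OF g(1)]
  define d where "d l j z = (if norm (z $ l) < r j then 0 else 1 :: complex)" for l j and z :: "complex ^ 'n"
  \<comment> \<open>A point is shared equally among the faces to which it is close. If there is
    none, all numerators are 0 and the whole weight goes to \<open>\<kappa>\<close>.\<close>
  define \<rho> where "\<rho> l j z = d l j z / (\<Sum>l\<in>UNIV. d l j z)" for l j and z :: "complex ^ 'n"
  define \<kappa> where "\<kappa> j z = 1 - (\<Sum>l\<in>UNIV. \<rho> l j z)" for j and z :: "complex ^ 'n"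
  have d_real: "(\<Sum>l\<in>UNIV. d l j z) = of_nat (card {l. \<not> norm (z $ l) < r j})" for j z
  proof -
    have "(\<Sum>l\<in>UNIV. d l j z) = (\<Sum>l\<in>{l. \<not> norm (z $ l) < r j}. 1)"
      unfolding d_def by (rule sum.mono_neutral_cong_right) auto
    then show ?thesis by simp
  qed
  have \<rho>_meas: "\<rho> l j \<in> borel_measurable (lebesgue_on polydisk)" for l j
    unfolding \<rho>_def d_def by (intro borel_measurable_lebesgue_on borel_measurable_divide borel_measurable_sum borel_disc)
  have \<rho>1: "norm (\<rho> l j z) \<le> 1" for l j z
  proof (cases "norm (z $ l) < r j")
    case True
    then show ?thesis by (simp add: \<rho>_def d_def)
  next
    case False
    then have "card {l. \<not> norm (z $ l) < r j} \<noteq> 0" by auto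
    then have "1 \<le> real (card {l. \<not> norm (z $ l) < r j})" by linarith
    then show ?thesis using False unfolding \<rho>_def d_real by (simp add: d_def norm_divide divide_le_eq_1)
  qed
  have \<rho>: "multiplier 1 (\<rho> l j)" for l j using \<rho>_meas \<rho>1 by (simp add: multiplier_def)
  have \<kappa>_eq: "\<kappa> j z = (if \<forall>l. norm (z $ l) < r j then 1 else 0)" for j z
  proof (cases "\<forall>l. norm (z $ l) < r j")
    case True
    then show ?thesis by (simp add: \<kappa>_def \<rho>_def d_def)
  next
    case False
    then have "{l. \<not> norm (z $ l) < r j} \<noteq> {}" by auto
    then have "(\<Sum>l\<in>UNIV. d l j z) \<noteq> 0" unfolding d_real by simp
    then have "(\<Sum>l\<in>UNIV. \<rho> l j z) = 1" unfolding \<rho>_def sum_divide_distrib[symmetric] by simp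
    then show ?thesis using False by (simp add: \<kappa>_def)
  qed
  have \<rho>gL: "(\<lambda>z. \<rho> l j z * g j z) \<in> L2 polydisk" for l j by (rule multiplier_L2[OF \<rho> gL])
  have one: "(\<lambda>z. 1) \<in> L2 polydisk"
    unfolding L2_def using finite_measure.integrable_const[OF finite_measure_lebesgue_on[OF lmeasurable_polydisk]] by simp
  have esc: "escaping l (\<lambda>j z. \<rho> l j z * g j z)" for l
    unfolding escaping_def
  proof (intro conjI allI)
    show "(\<lambda>z. \<rho> l j z * g j z) \<in> L2 polydisk" for j by (rule \<rho>gL)
    show "\<exists>B. \<forall>j. L2_norm polydisk (\<lambda>z. \<rho> l j z * g j z) \<le> B"
      using multiplier_norm[OF \<rho> gL] g(2) by (intro exI[of _ B]) (metis mult_1 order_trans)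
    have le: "L2_norm polydisk (\<lambda>z. of_real (1 - (norm (z $ l))\<^sup>2) * (\<rho> l j z * g j z)) \<le> (1 - (r j)\<^sup>2) * B" for j
    proof -
      have rj: "0 \<le> 1 - (r j)\<^sup>2" using r[of j] by (simp add: power_le_one)
      have m: "(\<lambda>z. of_real (1 - (norm (z $ l))\<^sup>2) * (\<rho> l j z * g j z)) \<in> borel_measurable (lebesgue_on polydisk)"
        by (intro borel_measurable_times borel_measurable_lebesgue_on[OF borel_weight] \<rho>_meas L2_measurable[OF gL])
      have "L2_norm polydisk (\<lambda>z. of_real (1 - (norm (z $ l))\<^sup>2) * (\<rho> l j z * g j z)) \<le> (1 - (r j)\<^sup>2) * L2_norm polydisk (g j)"
      proof (rule L2_dominated(2)[OF gL m rj])
        fix z :: "complex ^ 'n" assume z: "z \<in> polydisk"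
        show "norm (of_real (1 - (norm (z $ l))\<^sup>2) * (\<rho> l j z * g j z)) \<le> (1 - (r j)\<^sup>2) * norm (g j z)"
        proof (cases "norm (z $ l) < r j")
          case True
          then show ?thesis using rj by (simp add: \<rho>_def d_def)
        next
          case False
          then have "(r j)\<^sup>2 \<le> (norm (z $ l))\<^sup>2" using r[of j] by (intro power_mono) auto
          then have "norm (complex_of_real (1 - (norm (z $ l))\<^sup>2)) \<le> 1 - (r j)\<^sup>2"
            unfolding norm_of_real using weight_bounds(1)[OF z, of l] by simp
          then have "norm (complex_of_real (1 - (norm (z $ l))\<^sup>2)) * (norm (\<rho> l j z) * norm (g j z)) \<le> (1 - (r j)\<^sup>2) * (1 * norm (g j z))"
            using rj by (intro mult_mono \<rho>1) auto
          then show ?thesis by (simp only: norm_mult mult_1)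
        qed
      qed
      also have "\<dots> \<le> (1 - (r j)\<^sup>2) * B" using g(2) rj by (intro mult_left_mono) auto
      finally show ?thesis .
    qed
    have "(\<lambda>j. (1 - (r j)\<^sup>2) * B) \<longlonglongrightarrow> (1 - 1\<^sup>2) * B"
      by (intro tendsto_intros rlim)
    then show "(\<lambda>j. L2_norm polydisk (\<lambda>z. of_real (1 - (norm (z $ l))\<^sup>2) * (\<rho> l j z * g j z))) \<longlonglongrightarrow> 0"
      by (intro tendsto_zero_le[OF _ L2_norm_nonneg le]) simp
  qed
  \<comment> \<open>The cut-off pieces are not holomorphic. Projecting them restores holomorphy, and
    by \<open>escaping_proj\<close> they still escape.\<close>
  define p where "p l j = PP (\<lambda>z. \<rho> l j z * g j z)" for l j
  have p: "p l j \<in> bergman polydisk" for l j unfolding p_def by (rule PP_in[OF \<rho>gL])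
  have Tp: "(\<lambda>j. L2_norm polydisk (?T (p l j))) \<longlonglongrightarrow> 0" for l
    using hankel_product_escaping[OF c\<phi> c\<psi> dich escaping_proj[OF esc] PP_in[OF \<rho>gL]] unfolding p_def .
  define q where "q j = PP (\<lambda>z. \<kappa> j z * g j z)" for j
  have \<kappa>m: "\<kappa> j \<in> borel_measurable (lebesgue_on polydisk)" for j
    unfolding \<kappa>_def by (intro borel_measurable_diff borel_measurable_const borel_measurable_sum \<rho>_meas)
  have \<kappa>: "multiplier 1 (\<kappa> j)" for j using \<kappa>m by (simp add: multiplier_def \<kappa>_eq)
  have \<kappa>gL: "(\<lambda>z. \<kappa> j z * g j z) \<in> L2 polydisk" for j by (rule multiplier_L2[OF \<kappa> gL])
  have q: "q j \<in> bergman polydisk" for j unfolding q_def by (rule PP_in[OF \<kappa>gL])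
  \<comment> \<open>The cut-off \<open>\<kappa> j\<close> lives on \<open>K j\<close>, where
    \<open>g j\<close> is below \<open>1 / Suc j\<close>; finite volume turns this into a norm
    bound.\<close>
  have qn: "L2_norm polydisk (q j) \<le> 1 / real (Suc j) * L2_norm polydisk (\<lambda>z :: complex ^ 'n. 1)" for j
  proof -
    have "L2_norm polydisk (q j) \<le> L2_norm polydisk (\<lambda>z. \<kappa> j z * g j z)" unfolding q_def by (rule PP_norm_le[OF \<kappa>gL])
    also have "\<dots> \<le> 1 / real (Suc j) * L2_norm polydisk (\<lambda>z :: complex ^ 'n. 1)"
    proof (rule L2_dominated(2)[OF one L2_measurable[OF \<kappa>gL]])
      fix z :: "complex ^ 'n"
      show "norm (\<kappa> j z * g j z) \<le> 1 / real (Suc j) * norm (1 :: complex)"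
      proof (cases "\<forall>l. norm (z $ l) < r j")
        case True
        then have "z \<in> K j" by (auto simp: K_def less_imp_le)
        then show ?thesis using s(1)[of z j] True by (simp add: \<kappa>_eq g_def)
      next
        case False
        then show ?thesis unfolding \<kappa>_eq if_not_P[OF False] by simp
      qed
    qed simp
    finally show ?thesis .
  qed
  have sumL: "(\<lambda>z. \<Sum>l\<in>UNIV. p l j z) \<in> L2 polydisk" for j by (intro L2_sum bergman_L2 p)
  \<comment> \<open>The weights sum to 1, and \<open>P\<close> fixes \<open>g j\<close>, so
    projecting the pieces still recovers \<open>g j\<close> exactly.\<close>
  have g_eq: "g j = (\<lambda>z. 1 * q j z + 1 * (\<Sum>l\<in>UNIV. p l j z))" for j
  proof -
    have "(\<lambda>z. \<kappa> j z * g j z + (\<Sum>l\<in>UNIV. \<rho> l j z * g j z)) = g j"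
      by (rule ext) (simp add: \<kappa>_def sum_distrib_right[symmetric] algebra_simps sum_distrib_left[symmetric])
    then have "PP (g j) = (\<lambda>z. PP (\<lambda>z. \<kappa> j z * g j z) z + PP (\<lambda>z. \<Sum>l\<in>UNIV. \<rho> l j z * g j z) z)"
      using bergman_proj_add[OF open_polydisk \<kappa>gL[of j] L2_sum[of UNIV "\<lambda>l z. \<rho> l j z * g j z", OF \<rho>gL]] by simp
    also have "PP (\<lambda>z. \<Sum>l\<in>UNIV. \<rho> l j z * g j z) = (\<lambda>z. \<Sum>l\<in>UNIV. p l j z)"
      unfolding p_def by (rule bergman_proj_sum[OF open_polydisk finite \<rho>gL])
    finally have "PP (g j) = (\<lambda>z. q j z + (\<Sum>l\<in>UNIV. p l j z))" by (simp add: q_def)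
    then show ?thesis using bergman_proj_id[OF open_polydisk g(1)[of j]] by simp
  qed
  have T_sum: "?T (\<lambda>z. \<Sum>l\<in>A. p l j z) = (\<lambda>z. \<Sum>l\<in>A. ?T (p l j) z)" if "finite A" for A j
    using that
  proof (induction A rule: finite_induct)
    case empty
    have "?T (\<lambda>z. 0 * 0 + 0 * 0) = (\<lambda>z. 0 * ?T (\<lambda>z. 0) z + 0 * ?T (\<lambda>z. 0) z)"
      by (rule hankel_product_lincomb[OF M]) auto
    then show ?case by simp
  next
    case (insert x A)
    have "?T (\<lambda>z. 1 * p x j z + 1 * (\<Sum>l\<in>A. p l j z)) = (\<lambda>z. 1 * ?T (p x j) z + 1 * ?T (\<lambda>z. \<Sum>l\<in>A. p l j z) z)"
      by (rule hankel_product_lincomb[OF M]) (intro bergman_L2 p L2_sum)+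
    then show ?case using insert by simp
  qed
  have TL: "?T h \<in> L2 polydisk" if "h \<in> L2 polydisk" for h
    by (rule bergman_L2[OF hankel_product_bergman[OF M that]])
  have bound: "L2_norm polydisk (?T (g j))
    \<le> M * (M * (1 / real (Suc j) * L2_norm polydisk (\<lambda>z :: complex ^ 'n. 1))) + (\<Sum>l\<in>UNIV. L2_norm polydisk (?T (p l j)))" for j
  proof -
    have "?T (g j) = (\<lambda>z. 1 * ?T (q j) z + 1 * ?T (\<lambda>z. \<Sum>l\<in>UNIV. p l j z) z)"
      by (subst g_eq) (rule hankel_product_lincomb[OF M bergman_L2[OF q] sumL])
    then have "?T (g j) = (\<lambda>z. ?T (q j) z + (\<Sum>l\<in>UNIV. ?T (p l j) z))"
      by (simp add: T_sum)
    then have "L2_norm polydisk (?T (g j)) \<le> L2_norm polydisk (?T (q j)) + L2_norm polydisk (\<lambda>z. \<Sum>l\<in>UNIV. ?T (p l j) z)"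
      using L2_triangle[OF TL[OF bergman_L2[OF q]] L2_sum[OF TL[OF bergman_L2[OF p]]]] by simp
    also have "L2_norm polydisk (?T (q j)) \<le> M * (M * L2_norm polydisk (q j))"
      by (rule hankel_product_norm[OF M bergman_L2[OF q]])
    also have "\<dots> \<le> M * (M * (1 / real (Suc j) * L2_norm polydisk (\<lambda>z :: complex ^ 'n. 1)))"
      using M(1) by (intro mult_left_mono qn) (auto simp: multiplier_def)
    also have "L2_norm polydisk (\<lambda>z. \<Sum>l\<in>UNIV. ?T (p l j) z) \<le> (\<Sum>l\<in>UNIV. L2_norm polydisk (?T (p l j)))"
      by (rule L2_norm_sum_le[OF finite TL[OF bergman_L2[OF p]]])
    finally show ?thesis by simp
  qed
  have "(\<lambda>j. M * (M * (inverse (real (Suc j)) * L2_norm polydisk (\<lambda>z :: complex ^ 'n. 1))) + (\<Sum>l\<in>UNIV. L2_norm polydisk (?T (p l j))))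
    \<longlonglongrightarrow> M * (M * (0 * L2_norm polydisk (\<lambda>z :: complex ^ 'n. 1))) + (\<Sum>l\<in>(UNIV :: 'n set). 0)"
    by (intro tendsto_add tendsto_mult tendsto_const tendsto_sum LIMSEQ_inverse_real_of_nat Tp)
  then have "(\<lambda>j. M * (M * (1 / real (Suc j) * L2_norm polydisk (\<lambda>z :: complex ^ 'n. 1))) + (\<Sum>l\<in>UNIV. L2_norm polydisk (?T (p l j)))) \<longlonglongrightarrow> 0"
    by (simp add: inverse_eq_divide)
  from tendsto_zero_le[OF this L2_norm_nonneg bound]
  have "(\<lambda>j. L2_norm polydisk (?T (g j))) \<longlonglongrightarrow> 0" .
  then have "c \<le> 0" by (rule LIMSEQ_le_const) (use s(2) in \<open>auto simp: g_def\<close>)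
  then show False using c(1) by simp
qed

theorem theorem2:
  fixes \<phi> \<psi> :: "complex ^ 'n \<Rightarrow> complex"
  assumes "CARD('n) \<ge> 2"
    and "\<phi> \<in> C1_closure polydisk"
    and "\<psi> \<in> C1_closure polydisk"
    and "\<And>g :: complex \<Rightarrow> complex ^ 'n.
           (\<forall>j. (\<lambda>\<zeta>. g \<zeta> $ j) holomorphic_on ball 0 1) \<Longrightarrow>
           g ` ball 0 1 \<subseteq> frontier polydisk \<Longrightarrow>
           (\<phi> \<circ> g) holomorphic_on ball 0 1 \<or> (\<psi> \<circ> g) holomorphic_on ball 0 1"
  shows "compact_on_bergman polydisk
           (bergman_adjoint polydisk (hankel polydisk \<psi>) \<circ> hankel polydisk \<phi>)"
proof -
  have c\<phi>: "continuous_on (closure polydisk) \<phi>" and c\<psi>: "continuous_on (closure polydisk) \<psi>"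
    using assms(2,3) by (auto simp: C1_closure_def)
  obtain M1 M2 where M1: "M1 \<ge> 0" "\<And>z. z \<in> closure polydisk \<Longrightarrow> norm (\<phi> z) \<le> M1"
    and M2: "M2 \<ge> 0" "\<And>z. z \<in> closure polydisk \<Longrightarrow> norm (\<psi> z) \<le> M2"
    using continuous_closure_bound[OF c\<phi>] continuous_closure_bound[OF c\<psi>] by blast
  define M where "M = max M1 M2"
  have M: "0 \<le> M" "\<And>z. z \<in> closure polydisk \<Longrightarrow> norm (\<phi> z) \<le> M" "\<And>z. z \<in> closure polydisk \<Longrightarrow> norm (\<psi> z) \<le> M"
    using M1 M2 by (auto simp: M_def max.coboundedI1 max.coboundedI2)
  have sub: "z \<in> closure polydisk" if "z \<in> polydisk" for z :: "complex ^ 'n" using that closure_subset by blast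
  have m: "multiplier M \<phi>" "multiplier M \<psi>"
    by (auto intro!: multiplier_continuous continuous_on_subset[OF c\<phi> closure_subset] continuous_on_subset[OF c\<psi> closure_subset] M sub)
  have dich: "mholomorphic_on (\<lambda>z. \<phi> (upd i w z)) polydisk \<or> mholomorphic_on (\<lambda>z. \<psi> (upd i w z)) polydisk"
    if "norm w = 1" for i w
    by (rule slice_dichotomy[OF assms(2,3,4) that])
  let ?S = "bergman_adjoint polydisk (hankel polydisk \<psi>) \<circ> hankel polydisk \<phi>"
  let ?T = "hankel_product \<psi> \<phi>"
  have S: "?S f = ?T f" if "f \<in> bergman polydisk" for f
    using bergman_adjoint_hankel[OF m(2) hankel_perp[OF m(1) bergman_L2[OF that]]] by (simp add: hankel_product_def)
  show ?thesis
    unfolding compact_on_bergman_def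
  proof (intro conjI ballI allI impI)
    show "?S f \<in> bergman polydisk" if "f \<in> bergman polydisk" for f
      unfolding S[OF that] by (rule hankel_product_bergman[OF m bergman_L2[OF that]])
    show "?S (\<lambda>z. a * f z + b * g z) = (\<lambda>z. a * ?S f z + b * ?S g z)"
      if "f \<in> bergman polydisk" "g \<in> bergman polydisk" for f g a b
      unfolding S[OF that(1)] S[OF that(2)] S[OF bergman_add[OF bergman_cmult[OF that(1)] bergman_cmult[OF that(2)]]]
      by (rule hankel_product_lincomb[OF m bergman_L2[OF that(1)] bergman_L2[OF that(2)]])
    fix F :: "nat \<Rightarrow> complex ^ 'n \<Rightarrow> complex"
    assume "(\<forall>k. F k \<in> bergman polydisk) \<and> (\<exists>B. \<forall>k. L2_norm polydisk (F k) \<le> B)"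
    then obtain B where F: "\<And>k. F k \<in> bergman polydisk" "\<And>k. L2_norm polydisk (F k) \<le> B" by blast
    obtain r G where r: "strict_mono (r :: nat \<Rightarrow> nat)" and G: "G \<in> bergman polydisk" "L2_norm polydisk G \<le> B"
      and ul: "\<And>K. compact K \<Longrightarrow> K \<subseteq> polydisk \<Longrightarrow> uniform_limit K (\<lambda>k. F (r k)) G sequentially"
      by (rule bergman_Montel[where F = F, OF open_polydisk F]) blast
    \<comment> \<open>Subtracting the locally uniform limit reduces compactness to null sequences.
      By linearity the image of \<open>G\<close> is then the norm limit of the images.\<close>
    define f where "f k z = F (r k) z - G z" for k z
    have f: "f k \<in> bergman polydisk" for k unfolding f_def by (rule bergman_diff[OF F(1) G(1)])
    have fB: "L2_norm polydisk (f k) \<le> B + B" for k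
      unfolding f_def using L2_triangle_diff[OF bergman_L2[OF F(1)] bergman_L2[OF G(1)], of "r k"] F(2)[of "r k"] G(2) by linarith
    have ulf: "uniform_limit K f (\<lambda>_. 0) sequentially" if "compact K" "K \<subseteq> polydisk" for K
      using ul[OF that] unfolding uniform_limit_iff by (simp add: f_def dist_norm)
    have "(\<lambda>k. L2_norm polydisk (?T (f k))) \<longlonglongrightarrow> 0"
      by (rule hankel_product_null_sequence[OF c\<phi> c\<psi> dich m f fB ulf])
    moreover have "?T (f k) = (\<lambda>z. ?S (F (r k)) z - ?S G z)" for k
    proof -
      have "?T (\<lambda>z. 1 * F (r k) z + (- 1) * G z) = (\<lambda>z. 1 * ?T (F (r k)) z + (- 1) * ?T G z)"
        by (rule hankel_product_lincomb[OF m bergman_L2[OF F(1)] bergman_L2[OF G(1)]])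
      then show ?thesis unfolding S[OF F(1)] S[OF G(1)] by (simp add: f_def[abs_def])
    qed
    ultimately have "(\<lambda>k. L2_norm polydisk (\<lambda>z. ?S (F (r k)) z - ?S G z)) \<longlonglongrightarrow> 0" by simp
    moreover have "?S G \<in> bergman polydisk"
      unfolding S[OF G(1)] by (rule hankel_product_bergman[OF m bergman_L2[OF G(1)]])
    ultimately show "\<exists>h\<in>bergman polydisk. \<exists>r. strict_mono r \<and> (\<lambda>k. L2_norm polydisk (\<lambda>z. ?S (F (r k)) z - h z)) \<longlonglongrightarrow> 0"
      using r by blast
  qed
qed

end
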